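(* For $\lambda\in V_{\mathbb{C}}^*$ we have: (i) The map $G$ restricts to a linear isomorphism $G:E(\lambda)^{-W}\overset{\sim}{\longrightarrow}\mathrm{BVP}_\infty(\lambda)^W$. (ii) The space $\mathrm{BVP}_\infty(\lambda)^W$ is zero-dimensional or one-dimensional. It is one-dimensional iff $\lambda$ is a regular element from $2\pi iP$. In that case $\mathrm{BVP}_\infty(\lambda)^W$ is spanned by $\phi_\lambda^\infty:=G(\psi_\lambda^\infty)$, which is the unique $W$-invariant function on $V$ satisfying $$\phi_\lambda^\infty(v)=\frac{1}{\#W_0}\prod_{\alpha\in\Sigma_0^+}\lambda(\alpha^\vee)^{-1}\sum_{w\in W_0}(-1)^{l(w)}e^{w\lambda(v)},\qquad v\in\overline{C_+}.$$
   Context: Root systems. Let $V$ be a Euclidean space of dimension $n$ and $V^*$ the dual Euclidean space, with norm $\|\cdot\|$ and inner product $\langle\cdot,\cdot\rangle$ on $V^*$. Let $\Sigma_0\subset V^*$ be a finite, irreducible, reduced crystallographic root system. The co-root $\alpha^\vee\in V$ of $\alpha\in\Sigma_0$ is determined by $\xi(\alpha^\vee)=2\langle\xi,\alpha\rangle/\|\alpha\|^2$ for all $\xi\in V^*$. Fix a basis $I_0=\{a_1,\ldots,a_n\}$ of $\Sigma_0$, with positive roots $\Sigma_0^+$ and highest root $\varphi$. The Weyl group $W_0$ is generated by the reflections $s_\alpha$ ($\alpha\in\Sigma_0$), acting on $V$ by $s_\alpha v=v-\alpha(v)\alpha^\vee$ and on $V^*$ by $s_\alpha\xi=\xi-\xi(\alpha^\vee)\alpha$.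 $V_{\mathbb{C}}^*=V^*\oplus iV^*$ is the complexification. $P=\{\lambda\in V^*:\lambda(\alpha^\vee)\in\mathbb{Z}\ \forall\alpha\in\Sigma_0\}$ is the weight lattice. $\lambda\in V_{\mathbb{C}}^*$ is regular if $\lambda(\alpha^\vee)\ne0$ for all $\alpha\in\Sigma_0$. Affine root system. Affine linear functionals on $V$ are written as elements of $V^*\oplus\mathbb{R}$, and $D$ denotes the projection onto $V^*$ (the gradient). The affine root system is $\Sigma=\Sigma_0+\mathbb{Z}$, with basis $\{a_0=-\varphi+1,a_1,\ldots,a_n\}$ and corresponding positive roots $\Sigma^+$. For $a\in\Sigma$ write $Da^\vee=(Da)^\vee$, $V_a=a^{-1}(0)$, and $s_a(v)=v-a(v)Da^\vee$. The affine Weyl group $W$ is generated by all $s_a$ ($a\in\Sigma$); it is a Coxeter group with Coxeter generators $s_{a_0},\ldots,s_{a_n}$ and length function $l$. Put $V_{reg}=V\setminus\bigcup_{a\in\Sigma^+}V_a$, with connected components called alcoves; $C_+=\{v\in V:a_j(v)>0,\ j=0,\ldots,n\}$. $W$ acts on functions on $V$ by $(wf)(v)=f(w^{-1}v)$; superscript $W$ denotes $W$-invariants. Differential equations. Identify the symmetric algebra $S(V)$ with the polynomial functions on $V^*$; $p(\partial)$ is the constant coefficient differential operator obtained from $v\mapsto\partial_v$ (directional derivative); $S(V)^{W_0}$ and $S(V)_{\mathbb{C}}^{W_0}$ are the $W_0$-invariants in $S(V)$ and its complexification. $C^\omega(V)$ is the space of complex-valued real analytic functions on $V$, and $E(\lambda)=\{f\in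 C^\omega(V):p(\partial)f=p(\lambda)f\ \forall p\in S(V)_{\mathbb{C}}^{W_0}\}$. $E(\lambda)^{-W}$ is the space of $f\in E(\lambda)$ with $f(w^{-1}v)=(-1)^{l(w)}f(v)$ for all $w\in W$, $v\in V$. For $\lambda$ a regular element of $2\pi iP$, $$\psi_\lambda^\infty=\frac{1}{\#W_0}\prod_{\alpha\in\Sigma_0^+}\lambda(\alpha^\vee)^{-1}\sum_{w\in W_0}(-1)^{l(w)}e^{w\lambda}.$$ Impenetrable boundary value problem. $CB^1(V)$ is the space of complex-valued continuous $f$ on $V$ such that for each alcove $C$, $f|_C$ has a continuously differentiable extension to an open neighborhood of $\overline{C}$. $\mathrm{BVP}_\infty(\lambda)$ is the space of $f\in CB^1(V)$ with $f|_{V_a}\equiv0$ for all $a\in\Sigma^+$ and $p(\partial)f|_{V_{reg}}=p(\lambda)f|_{V_{reg}}$ in the distributional sense for all $p\in S(V)^{W_0}$. The map $G$. $G:C^\omega(V)\to C(V)^W$ (with $C(V)$ the complex-valued continuous functions) is defined by $(Gf)(w^{-1}v)=f(v)$ for $w\in W$, $v\in\overline{C_+}$. *)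

theory Defs
  imports "HOL-Analysis.Analysis" "HOL-Library.Function_Algebras"
begin

text \<open>
  The Euclidean space \<open>V\<close> is a type of class \<open>euclidean_space\<close>. Its dual \<open>V\<^sup>*\<close> is the type of bounded
  linear functionals, whose operator norm is the dual Euclidean norm. The complexification
  \<open>V\<^sup>* \<oplus> iV\<^sup>*\<close> is the space of real-linear maps from \<open>V\<close> to the complex numbers.
  The spectral parameter \<open>\<lambda>\<close> is written \<open>\<mu>\<close>, as \<open>\<lambda>\<close> is reserved for abstraction.
\<close>

type_synonym 'a dual = "'a \<Rightarrow>\<^sub>L real"
type_synonym 'a cdual = "'a \<Rightarrow>\<^sub>L complex"

definition dual_inner :: "'a::euclidean_space dual \<Rightarrow> 'a dual \<Rightarrow> real" where
  "dual_inner \<xi> \<eta> = (\<Sum>b\<in>Basis. blinfun_apply \<xi> b * blinfun_apply \<eta> b)"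

definition coroot :: "'a::euclidean_space dual \<Rightarrow> 'a" where
  "coroot \<alpha> = (THE v. \<forall>\<xi>. blinfun_apply \<xi> v = 2 * dual_inner \<xi> \<alpha> / (norm \<alpha>)\<^sup>2)"

definition root_system :: "'a::euclidean_space dual set \<Rightarrow> bool" where
  "root_system R \<longleftrightarrow> finite R \<and> 0 \<notin> R \<and> span R = UNIV \<and>
     (\<forall>\<alpha>\<in>R. \<forall>\<beta>\<in>R. \<beta> - blinfun_apply \<beta> (coroot \<alpha>) *\<^sub>R \<alpha> \<in> R)"

definition crystallographic :: "'a::euclidean_space dual set \<Rightarrow> bool" where
  "crystallographic R \<longleftrightarrow> (\<forall>\<alpha>\<in>R. \<forall>\<beta>\<in>R. blinfun_apply \<beta> (coroot \<alpha>) \<in> \<int>)"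

definition reduced :: "'a::euclidean_space dual set \<Rightarrow> bool" where
  "reduced R \<longleftrightarrow> (\<forall>\<alpha>\<in>R. \<forall>c::real. c *\<^sub>R \<alpha> \<in> R \<longrightarrow> c = 1 \<or> c = - 1)"

definition irreducible_roots :: "'a::euclidean_space dual set \<Rightarrow> bool" where
  "irreducible_roots R \<longleftrightarrow> R \<noteq> {} \<and>
     \<not> (\<exists>S T. S \<noteq> {} \<and> T \<noteq> {} \<and> S \<union> T = R \<and> S \<inter> T = {} \<and>
              (\<forall>\<alpha>\<in>S. \<forall>\<beta>\<in>T. dual_inner \<alpha> \<beta> = 0))"

definition nonneg_comb :: "'b::real_vector set \<Rightarrow> 'b set" where
  "nonneg_comb B = {x. \<exists>c :: 'b \<Rightarrow> nat. x = (\<Sum>b\<in>B. real (c b) *\<^sub>R b)}"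

definition root_basis :: "'a::euclidean_space dual set \<Rightarrow> 'a dual set \<Rightarrow> bool" where
  "root_basis R B \<longleftrightarrow> B \<subseteq> R \<and> independent B \<and>
     (\<forall>\<alpha>\<in>R. \<alpha> \<in> nonneg_comb B \<or> - \<alpha> \<in> nonneg_comb B)"

definition pos_roots :: "'a::euclidean_space dual set \<Rightarrow> 'a dual set \<Rightarrow> 'a dual set" where
  "pos_roots R B = R \<inter> nonneg_comb B"

definition highest_root :: "'a::euclidean_space dual set \<Rightarrow> 'a dual set \<Rightarrow> 'a dual \<Rightarrow> bool" where
  "highest_root R B \<phi> \<longleftrightarrow> \<phi> \<in> R \<and> (\<forall>\<alpha>\<in>R. \<phi> - \<alpha> \<in> nonneg_comb B)"

definition weight_lattice :: "'a::euclidean_space dual set \<Rightarrow> 'a dual set" where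
  "weight_lattice R = {\<xi>. \<forall>\<alpha>\<in>R. blinfun_apply \<xi> (coroot \<alpha>) \<in> \<int>}"

definition two_pi_i_weights :: "'a::euclidean_space dual set \<Rightarrow> 'a cdual set" where
  "two_pi_i_weights R =
     {\<mu>. \<exists>\<xi>\<in>weight_lattice R. \<forall>v. blinfun_apply \<mu> v = 2 * of_real pi * \<i> * of_real (blinfun_apply \<xi> v)}"

definition regular :: "'a::euclidean_space dual set \<Rightarrow> 'a cdual \<Rightarrow> bool" where
  "regular R \<mu> \<longleftrightarrow> (\<forall>\<alpha>\<in>R. blinfun_apply \<mu> (coroot \<alpha>) \<noteq> 0)"

text \<open>
  The pair \<open>(\<xi>, t)\<close> stands for the affine functional \<open>\<xi> + t\<close>; its gradient is \<open>fst\<close>.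
\<close>

type_synonym 'a affine_fun = "'a dual \<times> real"

definition aff_apply :: "'a::euclidean_space affine_fun \<Rightarrow> 'a \<Rightarrow> real" where
  "aff_apply a v = blinfun_apply (fst a) v + snd a"

definition aff_refl :: "'a::euclidean_space affine_fun \<Rightarrow> 'a \<Rightarrow> 'a" where
  "aff_refl a v = v - aff_apply a v *\<^sub>R coroot (fst a)"

definition hyperplane :: "'a::euclidean_space affine_fun \<Rightarrow> 'a set" where
  "hyperplane a = {v. aff_apply a v = 0}"

definition aff_roots :: "'a::euclidean_space dual set \<Rightarrow> 'a affine_fun set" where
  "aff_roots R = {(\<alpha>, of_int k) | \<alpha> k. \<alpha> \<in> R}"

definition aff_basis :: "'a::euclidean_space dual set \<Rightarrow> 'a dual \<Rightarrow> 'a affine_fun set" where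
  "aff_basis B \<phi> = insert (- \<phi>, 1) ((\<lambda>\<alpha>. (\<alpha>, 0)) ` B)"

definition aff_pos_roots ::
  "'a::euclidean_space dual set \<Rightarrow> 'a dual set \<Rightarrow> 'a dual \<Rightarrow> 'a affine_fun set" where
  "aff_pos_roots R B \<phi> = aff_roots R \<inter> nonneg_comb (aff_basis B \<phi>)"

text \<open>
  All generating sets used below consist of involutions, so the set of words in them is the
  group they generate.
\<close>

definition word_prod :: "('a \<Rightarrow> 'a) list \<Rightarrow> 'a \<Rightarrow> 'a" where
  "word_prod ws = foldr (\<circ>) ws id"

definition aff_weyl :: "'a::euclidean_space dual set \<Rightarrow> ('a \<Rightarrow> 'a) set" where
  "aff_weyl R = word_prod ` lists (aff_refl ` aff_roots R)"

definition weyl :: "'a::euclidean_space dual set \<Rightarrow> ('a \<Rightarrow> 'a) set" where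
  "weyl R = word_prod ` lists ((\<lambda>\<alpha>. aff_refl (\<alpha>, 0)) ` R)"

text \<open>
  \<open>W\<^sub>0\<close> is a standard parabolic subgroup of \<open>W\<close>, so that this length restricts to the length on \<open>W\<^sub>0\<close>.
\<close>

definition len :: "'a::euclidean_space dual set \<Rightarrow> 'a dual \<Rightarrow> ('a \<Rightarrow> 'a) \<Rightarrow> nat" where
  "len B \<phi> w =
     (LEAST k. \<exists>ws\<in>lists (aff_refl ` aff_basis B \<phi>). length ws = k \<and> word_prod ws = w)"

text \<open>
  The action of \<open>W\<^sub>0\<close> on the complexified dual is contragredient; for \<open>w = s\<^sub>\<alpha>\<close> it is
  \<open>\<mu> \<mapsto> \<mu> - \<mu>(\<alpha>\<^sup>\<or>) \<alpha>\<close>.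
\<close>

definition dual_act :: "('a \<Rightarrow> 'a) \<Rightarrow> 'a::euclidean_space cdual \<Rightarrow> 'a cdual" where
  "dual_act w \<mu> = Blinfun (\<lambda>v. blinfun_apply \<mu> (inv w v))"

definition V_reg :: "'a::euclidean_space dual set \<Rightarrow> 'a dual set \<Rightarrow> 'a dual \<Rightarrow> 'a set" where
  "V_reg R B \<phi> = UNIV - (\<Union>a\<in>aff_pos_roots R B \<phi>. hyperplane a)"

definition alcoves :: "'a::euclidean_space dual set \<Rightarrow> 'a dual set \<Rightarrow> 'a dual \<Rightarrow> 'a set set" where
  "alcoves R B \<phi> = components (V_reg R B \<phi>)"

definition C_plus :: "'a::euclidean_space dual set \<Rightarrow> 'a dual \<Rightarrow> 'a set" where
  "C_plus B \<phi> = {v. \<forall>a\<in>aff_basis B \<phi>. aff_apply a v > 0}"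

definition W_invariant :: "'a::euclidean_space dual set \<Rightarrow> ('a \<Rightarrow> complex) \<Rightarrow> bool" where
  "W_invariant R f \<longleftrightarrow> (\<forall>w\<in>aff_weyl R. \<forall>v. f (inv w v) = f v)"

definition dir_deriv :: "'a::euclidean_space \<Rightarrow> ('a \<Rightarrow> complex) \<Rightarrow> 'a \<Rightarrow> complex" where
  "dir_deriv v f x = frechet_derivative f (at x) v"

text \<open>
  The relation \<open>const_coeff_op K p D\<close> says that \<open>p\<close> is a polynomial function with coefficients in \<open>K\<close>,
  and that \<open>D\<close> is an expression for \<open>p(\<partial>)\<close>: \<open>p\<close> is written in terms of vectors \<open>v\<close>, read as the functions
  \<open>\<xi> \<mapsto> \<xi>(v)\<close>, and of constants, and \<open>D\<close> is obtained by replacing each \<open>v\<close> by the directional derivative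
  \<open>\<partial>\<^sub>v\<close>. On smooth functions directional derivatives commute, and \<open>D\<close> depends on \<open>p\<close> only.
  Polynomials on \<open>V\<^sup>*\<close> are represented by their unique polynomial extensions to the complexified
  dual, so that \<open>p(\<mu>)\<close> is literally \<open>p \<mu>\<close>. Taking \<open>K = \<real>\<close> gives \<open>S(V)\<close>, and \<open>K = UNIV\<close> gives its
  complexification.
\<close>

inductive const_coeff_op ::
  "complex set \<Rightarrow> ('a::euclidean_space cdual \<Rightarrow> complex) \<Rightarrow>
     (('a \<Rightarrow> complex) \<Rightarrow> 'a \<Rightarrow> complex) \<Rightarrow> bool"
  for K :: "complex set" where
  const: "c \<in> K \<Longrightarrow> const_coeff_op K (\<lambda>\<xi>. c) (\<lambda>f x. c * f x)"
| vector: "const_coeff_op K (\<lambda>\<xi>. blinfun_apply \<xi> v) (dir_deriv v)"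
| add: "const_coeff_op K p D \<Longrightarrow> const_coeff_op K q E \<Longrightarrow>
         const_coeff_op K (\<lambda>\<xi>. p \<xi> + q \<xi>) (\<lambda>f x. D f x + E f x)"
| mult: "const_coeff_op K p D \<Longrightarrow> const_coeff_op K q E \<Longrightarrow>
         const_coeff_op K (\<lambda>\<xi>. p \<xi> * q \<xi>) (\<lambda>f. D (E f))"

definition weyl_invariant ::
  "'a::euclidean_space dual set \<Rightarrow> ('a cdual \<Rightarrow> complex) \<Rightarrow> bool" where
  "weyl_invariant R p \<longleftrightarrow> (\<forall>w\<in>weyl R. \<forall>\<xi>. p (dual_act w \<xi>) = p \<xi>)"

text \<open>
  Real analyticity: local expansions \<open>f(y) = \<Sum>\<^sub>m c\<^sub>m (y - x)\<^sup>m\<close>, where \<open>m\<close> ranges over multi-indices,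
  that is, exponent functions on the standard basis, and the sum is unconditional.
\<close>

definition multi_indices :: "('a::euclidean_space \<Rightarrow> nat) set" where
  "multi_indices = {m. \<forall>b. b \<notin> Basis \<longrightarrow> m b = 0}"

definition real_analytic :: "('a::euclidean_space \<Rightarrow> complex) \<Rightarrow> bool" where
  "real_analytic f \<longleftrightarrow>
     (\<forall>x. \<exists>r>0. \<exists>c :: ('a \<Rightarrow> nat) \<Rightarrow> complex. \<forall>y\<in>ball x r.
        ((\<lambda>m. c m * of_real (\<Prod>b\<in>Basis. ((y - x) \<bullet> b) ^ m b)) has_sum f y) multi_indices)"

definition eigenspace_E ::
  "'a::euclidean_space dual set \<Rightarrow> 'a cdual \<Rightarrow> ('a \<Rightarrow> complex) set" where
  "eigenspace_E R \<mu> =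
     {f. real_analytic f \<and>
         (\<forall>p D. const_coeff_op UNIV p D \<and> weyl_invariant R p \<longrightarrow> (\<forall>x. D f x = p \<mu> * f x))}"

definition eigenspace_E_anti ::
  "'a::euclidean_space dual set \<Rightarrow> 'a dual set \<Rightarrow> 'a dual \<Rightarrow> 'a cdual \<Rightarrow> ('a \<Rightarrow> complex) set" where
  "eigenspace_E_anti R B \<phi> \<mu> =
     {f \<in> eigenspace_E R \<mu>. \<forall>w\<in>aff_weyl R. \<forall>v. f (inv w v) = (- 1) ^ len B \<phi> w * f v}"

definition psi_inf ::
  "'a::euclidean_space dual set \<Rightarrow> 'a dual set \<Rightarrow> 'a dual \<Rightarrow> 'a cdual \<Rightarrow> 'a \<Rightarrow> complex" where
  "psi_inf R B \<phi> \<mu> v =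
     1 / of_nat (card (weyl R)) * (\<Prod>\<alpha>\<in>pos_roots R B. inverse (blinfun_apply \<mu> (coroot \<alpha>))) *
     (\<Sum>w\<in>weyl R. (- 1) ^ len B \<phi> w * exp (blinfun_apply (dual_act w \<mu>) v))"

definition C1_on :: "'a::euclidean_space set \<Rightarrow> ('a \<Rightarrow> complex) \<Rightarrow> bool" where
  "C1_on U g \<longleftrightarrow>
     (\<exists>g' :: 'a \<Rightarrow> 'a \<Rightarrow>\<^sub>L complex.
        (\<forall>x\<in>U. (g has_derivative blinfun_apply (g' x)) (at x)) \<and> continuous_on U g')"

definition CB1 ::
  "'a::euclidean_space dual set \<Rightarrow> 'a dual set \<Rightarrow> 'a dual \<Rightarrow> ('a \<Rightarrow> complex) set" where
  "CB1 R B \<phi> =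
     {f. continuous_on UNIV f \<and>
         (\<forall>C\<in>alcoves R B \<phi>. \<exists>U g. open U \<and> closure C \<subseteq> U \<and> C1_on U g \<and> (\<forall>x\<in>C. g x = f x))}"

definition smooth :: "('a::euclidean_space \<Rightarrow> complex) \<Rightarrow> bool" where
  "smooth h \<longleftrightarrow> (\<forall>vs. foldr dir_deriv vs h differentiable_on UNIV)"

definition test_function :: "'a::euclidean_space set \<Rightarrow> ('a \<Rightarrow> complex) \<Rightarrow> bool" where
  "test_function \<Omega> h \<longleftrightarrow>
     smooth h \<and> compact (closure {x. h x \<noteq> 0}) \<and> closure {x. h x \<noteq> 0} \<subseteq> \<Omega>"

text \<open>
  The formal transpose of \<open>p(\<partial>)\<close> is \<open>q(\<partial>)\<close> with \<open>q(\<xi>) = p(-\<xi>)\<close>.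
\<close>

definition weak_eigen ::
  "'a::euclidean_space set \<Rightarrow> ('a cdual \<Rightarrow> complex) \<Rightarrow> 'a cdual \<Rightarrow> ('a \<Rightarrow> complex) \<Rightarrow> bool" where
  "weak_eigen \<Omega> p \<mu> f \<longleftrightarrow>
     (\<forall>D h. const_coeff_op UNIV (\<lambda>\<xi>. p (- \<xi>)) D \<and> test_function \<Omega> h \<longrightarrow>
        (LINT x|lborel. f x * D h x) = p \<mu> * (LINT x|lborel. f x * h x))"

definition BVP_inf ::
  "'a::euclidean_space dual set \<Rightarrow> 'a dual set \<Rightarrow> 'a dual \<Rightarrow> 'a cdual \<Rightarrow> ('a \<Rightarrow> complex) set" where
  "BVP_inf R B \<phi> \<mu> =
     {f \<in> CB1 R B \<phi>.
        (\<forall>a\<in>aff_pos_roots R B \<phi>. \<forall>v\<in>hyperplane a. f v = 0) \<and>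
        (\<forall>p D. const_coeff_op \<real> p D \<and> weyl_invariant R p \<longrightarrow> weak_eigen (V_reg R B \<phi>) p \<mu> f)}"

definition BVP_inf_W ::
  "'a::euclidean_space dual set \<Rightarrow> 'a dual set \<Rightarrow> 'a dual \<Rightarrow> 'a cdual \<Rightarrow> ('a \<Rightarrow> complex) set" where
  "BVP_inf_W R B \<phi> \<mu> = {f \<in> BVP_inf R B \<phi> \<mu>. W_invariant R f}"

definition G_map ::
  "'a::euclidean_space dual set \<Rightarrow> 'a dual set \<Rightarrow> 'a dual \<Rightarrow> ('a \<Rightarrow> complex) \<Rightarrow> 'a \<Rightarrow> complex" where
  "G_map R B \<phi> f =
     (THE g. \<forall>w\<in>aff_weyl R. \<forall>v\<in>closure (C_plus B \<phi>). g (inv w v) = f v)"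

definition fscale :: "complex \<Rightarrow> ('a \<Rightarrow> complex) \<Rightarrow> 'a \<Rightarrow> complex" where
  "fscale c f = (\<lambda>x. c * f x)"

interpretation cfun: vector_space "fscale :: complex \<Rightarrow> ('a \<Rightarrow> complex) \<Rightarrow> 'a \<Rightarrow> complex"
  by standard (auto simp: fscale_def fun_eq_iff algebra_simps)

definition linear_iso ::
  "(('a \<Rightarrow> complex) \<Rightarrow> 'a \<Rightarrow> complex) \<Rightarrow> ('a \<Rightarrow> complex) set \<Rightarrow> ('a \<Rightarrow> complex) set \<Rightarrow> bool" where
  "linear_iso T X Y \<longleftrightarrow> cfun.subspace X \<and> cfun.subspace Y \<and> bij_betw T X Y \<and>
     (\<forall>f\<in>X. \<forall>g\<in>X. T (f + g) = T f + T g) \<and> (\<forall>c. \<forall>f\<in>X. T (fscale c f) = fscale c (T f))"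

text \<open>
  The library's \<open>dim\<close> assigns \<open>0\<close> to infinite-dimensional spaces, hence an explicit finite basis.
\<close>

definition has_dim :: "('a \<Rightarrow> complex) set \<Rightarrow> nat \<Rightarrow> bool" where
  "has_dim X d \<longleftrightarrow> (\<exists>S. finite S \<and> card S = d \<and> cfun.independent S \<and> cfun.span S = X)"

end

theory Submission
  imports Defs "HOL-Computational_Algebra.Polynomial"
begin

text \<open>
  Fourier analysis on the fundamental alcove replaces elliptic regularity. A solution \<open>f\<close> restricted
  to the closed alcove is Lipschitz and vanishes on the walls, and so do the antisymmetric exponential
  sums \<open>A \<nu>\<close> with \<open>\<nu> \<in> 2\<pi>iP\<close>. Testing the Laplace equation of \<open>f\<close> against \<open>A \<nu>\<close> times a cutoff that
  tends to \<open>1\<close> shows that \<open>f\<close> is orthogonal to all \<open>A \<nu>\<close> except the finitely many ones with the right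
  Laplace eigenvalue. As the \<open>A \<nu>\<close> are complete on the alcove (Stone-Weierstrass, applied to the
  functions that multiply their span into itself), \<open>f\<close> is an antisymmetric exponential sum. The other
  invariant polynomials then force its exponents into the orbit of \<open>\<mu>\<close>, so that \<open>f\<close> is a multiple of
  \<open>A \<mu>\<close>. The same argument applies to the antisymmetric elements of \<open>E(\<mu>)\<close>.
\<close>

text \<open>Among the invariant operators the Laplacian has to come first because of its order:
  Green's identity then meets at most two derivatives of the cutoff, and the simple zeros of the two
  factors at a wall pay for exactly that. An operator of higher order would leave terms that no
  Lipschitz bound controls. Once the solution is known to be an exponential sum, all other invariant
  operators can be tested away from the walls. That only finitely many exponents share a Laplace
  eigenvalue comes from the discreteness of the weight lattice. Two facts about \<open>W\<close>
  support everything. The closed alcove meets every orbit exactly once, which makes \<open>G\<close>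
  well defined and lets orbit sums separate the points of the alcove. The sign of \<open>w\<close>
  is multiplicative, which is not visible from \<open>len\<close>, a minimum over words; hence the
  study of words and of separating hyperplanes. Completeness cannot be had by applying
  Stone-Weierstrass to the antisymmetric sums themselves, since a product of two of them is
  symmetric.\<close>

abbreviation app :: "('a::real_normed_vector \<Rightarrow>\<^sub>L 'b::real_normed_vector) \<Rightarrow> 'a \<Rightarrow> 'b" where
  "app \<equiv> blinfun_apply"

section \<open>Duals and affine reflections\<close>

definition riesz :: "'a::euclidean_space dual \<Rightarrow> 'a" where
  "riesz \<xi> = (\<Sum>b\<in>Basis. app \<xi> b *\<^sub>R b)"

lemma blinfun_eq_riesz: "app \<xi> v = riesz \<xi> \<bullet> v"
proof -
  have "app \<xi> v = app \<xi> (\<Sum>b\<in>Basis. (v \<bullet> b) *\<^sub>R b)"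
    by (simp add: euclidean_representation)
  also have "\<dots> = riesz \<xi> \<bullet> v"
    by (simp add: riesz_def blinfun.sum_right blinfun.scaleR_right inner_sum_left inner_commute[of v] mult.commute)
  finally show ?thesis .
qed

lemma riesz_diff: "riesz (\<xi> - \<eta>) = riesz \<xi> - riesz \<eta>"
  by (simp add: riesz_def blinfun.diff_left algebra_simps sum_subtractf)

lemma riesz_add: "riesz (\<xi> + \<eta>) = riesz \<xi> + riesz \<eta>"
  by (simp add: riesz_def blinfun.add_left algebra_simps sum.distrib)

lemma riesz_scaleR: "riesz (c *\<^sub>R \<xi>) = c *\<^sub>R riesz \<xi>"
  by (simp add: riesz_def blinfun.scaleR_left scaleR_sum_right)

lemma riesz_minus: "riesz (- \<xi>) = - riesz \<xi>"
  using riesz_scaleR[of "-1" \<xi>] by simp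

lemma riesz_sum: "riesz (sum f I) = (\<Sum>i\<in>I. riesz (f i))"
  by (induction I rule: infinite_finite_induct) (simp_all add: riesz_add, simp_all add: riesz_def)

lemma riesz_zero [simp]: "riesz 0 = 0"
  by (simp add: riesz_def)

lemma riesz_eq_0_iff: "riesz \<xi> = 0 \<longleftrightarrow> \<xi> = 0"
proof
  assume "riesz \<xi> = 0"
  then show "\<xi> = 0" by (intro blinfun_eqI) (simp add: blinfun_eq_riesz)
qed simp

lemma dual_inner_riesz: "dual_inner \<xi> \<eta> = riesz \<xi> \<bullet> riesz \<eta>"
proof -
  have "riesz \<xi> \<bullet> riesz \<eta> = (\<Sum>b\<in>Basis. app \<xi> b * (b \<bullet> riesz \<eta>))"
    unfolding riesz_def[of \<xi>] by (simp add: inner_sum_left)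
  then show ?thesis by (simp add: dual_inner_def blinfun_eq_riesz[of \<eta>] inner_commute)
qed

lemma norm_riesz: "norm \<xi> = norm (riesz \<xi>)"
proof (rule antisym)
  show "norm \<xi> \<le> norm (riesz \<xi>)"
    by (rule norm_blinfun_bound) (auto simp: blinfun_eq_riesz Cauchy_Schwarz_ineq2)
  show "norm (riesz \<xi>) \<le> norm \<xi>"
  proof (cases "riesz \<xi> = 0")
    case False
    have "norm (riesz \<xi>) * norm (riesz \<xi>) \<le> norm \<xi> * norm (riesz \<xi>)"
      using norm_blinfun[of \<xi> "riesz \<xi>"]
      by (simp add: blinfun_eq_riesz dot_square_norm power2_eq_square)
    then show ?thesis using False by simp
  qed simp
qed

lemma norm_sq_riesz: "(norm \<xi>)\<^sup>2 = riesz \<xi> \<bullet> riesz \<xi>"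
  by (simp add: norm_riesz dot_square_norm)

lemma coroot_property: "app \<xi> ((2 / (riesz \<alpha> \<bullet> riesz \<alpha>)) *\<^sub>R riesz \<alpha>) = 2 * dual_inner \<xi> \<alpha> / (norm \<alpha>)\<^sup>2"
  by (subst norm_sq_riesz, subst blinfun_eq_riesz, subst dual_inner_riesz)
    (simp only: inner_scaleR_right times_divide_eq_left)

lemma coroot_eq: "coroot \<alpha> = (2 / (riesz \<alpha> \<bullet> riesz \<alpha>)) *\<^sub>R riesz \<alpha>"
  unfolding coroot_def
proof (rule the_equality)
  show "\<forall>\<xi>. app \<xi> ((2 / (riesz \<alpha> \<bullet> riesz \<alpha>)) *\<^sub>R riesz \<alpha>) = 2 * dual_inner \<xi> \<alpha> / (norm \<alpha>)\<^sup>2"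
    by (intro allI coroot_property)
next
  fix v assume v: "\<forall>\<xi>. app \<xi> v = 2 * dual_inner \<xi> \<alpha> / (norm \<alpha>)\<^sup>2"
  show "v = (2 / (riesz \<alpha> \<bullet> riesz \<alpha>)) *\<^sub>R riesz \<alpha>" (is "v = ?c")
  proof (rule euclidean_eqI)
    fix b :: 'a
    have "app (blinfun_inner_left b) v = app (blinfun_inner_left b) ?c"
      by (simp only: v[rule_format] coroot_property)
    then show "v \<bullet> b = ?c \<bullet> b" by (simp only: blinfun_inner_left.rep_eq)
  qed
qed

lemma apply_coroot: "app \<xi> (coroot \<alpha>) = 2 * (riesz \<xi> \<bullet> riesz \<alpha>) / (riesz \<alpha> \<bullet> riesz \<alpha>)"
  by (simp add: coroot_eq blinfun_eq_riesz)

lemma apply_coroot_self: "\<alpha> \<noteq> 0 \<Longrightarrow> app \<alpha> (coroot \<alpha>) = 2"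
  by (simp add: apply_coroot riesz_eq_0_iff)

lemma coroot_minus: "coroot (- \<alpha>) = - coroot \<alpha>"
  by (simp add: coroot_eq riesz_minus)

lemma inner_reflection:
  fixes a b c :: "'a::real_inner"
  assumes "a \<noteq> 0"
  shows "(b - (2 * (b \<bullet> a) / (a \<bullet> a)) *\<^sub>R a) \<bullet> (c - (2 * (c \<bullet> a) / (a \<bullet> a)) *\<^sub>R a) = b \<bullet> c"
  using assms by (simp add: inner_diff_left inner_diff_right inner_commute field_simps)

text \<open>A reflection is an isometry, so the root and its image are normalised by the same
  squared length. This is the equivariance of the map from roots to coroots.\<close>

lemma coroot_reflection:
  assumes "\<alpha> \<noteq> 0"
  shows "coroot (\<beta> - app \<beta> (coroot \<alpha>) *\<^sub>R \<alpha>)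
     = coroot \<beta> - app \<alpha> (coroot \<beta>) *\<^sub>R coroot \<alpha>"
proof -
  let ?a = "riesz \<alpha>" and ?b = "riesz \<beta>"
  have a: "?a \<noteq> 0" using assms by (simp add: riesz_eq_0_iff)
  have r: "riesz (\<beta> - app \<beta> (coroot \<alpha>) *\<^sub>R \<alpha>) = ?b - (2 * (?b \<bullet> ?a) / (?a \<bullet> ?a)) *\<^sub>R ?a"
    by (simp add: riesz_diff riesz_scaleR apply_coroot)
  show ?thesis
    unfolding coroot_eq[of "\<beta> - _"] r inner_reflection[OF a]
    unfolding coroot_eq[of \<alpha>] coroot_eq[of \<beta>] blinfun.scaleR_right blinfun_eq_riesz
    by (simp add: algebra_simps inner_commute)
qed

section \<open>Affine functionals and affine reflections\<close>

lemma aff_apply_add: "aff_apply (a + b) v = aff_apply a v + aff_apply b v"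
  by (simp add: aff_apply_def blinfun.add_left)

lemma aff_apply_diff: "aff_apply (a - b) v = aff_apply a v - aff_apply b v"
  by (simp add: aff_apply_def blinfun.diff_left)

lemma aff_apply_minus: "aff_apply (- a) v = - aff_apply a v"
  by (simp add: aff_apply_def blinfun.minus_left)

lemma aff_apply_scaleR: "aff_apply (c *\<^sub>R a) v = c * aff_apply a v"
  by (simp add: aff_apply_def blinfun.scaleR_left algebra_simps)

lemma aff_apply_sum: "aff_apply (sum f I) v = (\<Sum>i\<in>I. aff_apply (f i) v)"
  by (induction I rule: infinite_finite_induct) (simp_all add: aff_apply_add, simp_all add: aff_apply_def)

lemma continuous_aff_apply: "continuous_on X (aff_apply a)"
  unfolding aff_apply_def by (intro continuous_intros)

lemma aff_apply_convex_comb: "u + v = 1 \<Longrightarrow>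
    aff_apply a (u *\<^sub>R x + v *\<^sub>R y) = u * aff_apply a x + v * aff_apply a y"
proof -
  assume "u + v = 1"
  then have "snd a = u * snd a + v * snd a" by (metis distrib_right mult_1)
  then show ?thesis by (simp add: aff_apply_def blinfun.add_right blinfun.scaleR_right algebra_simps)
qed

text \<open>The pullback of \<open>a\<close> along \<open>aff_refl b\<close>, see
  \<open>aff_apply_act\<close>. Gradient and constant term are treated at once by subtracting a
  multiple of the pair \<open>b\<close>.\<close>

definition act :: "'a::euclidean_space affine_fun \<Rightarrow> 'a affine_fun \<Rightarrow> 'a affine_fun" where
  "act b a = a - app (fst a) (coroot (fst b)) *\<^sub>R b"

lemma aff_apply_act: "aff_apply (act b a) v = aff_apply a (aff_refl b v)"
  by (simp add: act_def aff_apply_diff aff_apply_scaleR aff_refl_def)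
     (simp add: aff_apply_def blinfun.diff_right blinfun.scaleR_right)

lemma aff_apply_refl_self: "fst a \<noteq> 0 \<Longrightarrow> aff_apply a (aff_refl a v) = - aff_apply a v"
  unfolding aff_apply_act[symmetric] act_def aff_apply_diff aff_apply_scaleR
  by (simp add: apply_coroot_self)

lemma act_self: "fst a \<noteq> 0 \<Longrightarrow> act a a = - a"
  by (simp add: act_def apply_coroot_self) (simp add: scaleR_2)

lemma aff_refl_minus: "aff_refl (- a) = aff_refl a"
  by (simp add: aff_refl_def fun_eq_iff coroot_minus aff_apply_minus)

lemma aff_refl_involution: "fst a \<noteq> 0 \<Longrightarrow> aff_refl a (aff_refl a v) = v"
  unfolding aff_refl_def[of a "aff_refl a v"] by (simp add: aff_apply_refl_self) (simp add: aff_refl_def)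

lemma aff_refl_fixed_iff: "fst a \<noteq> 0 \<Longrightarrow> aff_refl a v = v \<longleftrightarrow> aff_apply a v = 0"
  by (auto simp: aff_refl_def coroot_eq riesz_eq_0_iff)

lemma act_involution: "fst b \<noteq> 0 \<Longrightarrow> act b (act b a) = a"
  by (simp add: act_def blinfun.diff_left blinfun.scaleR_left apply_coroot_self)

lemma aff_refl_act: 
  assumes "fst b \<noteq> 0"
  shows "aff_refl (act b a) = aff_refl b \<circ> aff_refl a \<circ> aff_refl b"
proof
  fix v
  let ?c = "coroot (fst a)" and ?u = "aff_refl b v"
  have c: "coroot (fst (act b a)) = ?c - app (fst b) ?c *\<^sub>R coroot (fst b)"
    using coroot_reflection[OF assms] by (simp add: act_def)
  have "aff_refl b (aff_refl a ?u) = aff_refl b (?u - aff_apply a ?u *\<^sub>R ?c)"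
    by (simp add: aff_refl_def[of a])
  also have "\<dots> = aff_refl b ?u - aff_apply a ?u *\<^sub>R (?c - app (fst b) ?c *\<^sub>R coroot (fst b))"
    unfolding aff_refl_def[of b "?u - _"] aff_refl_def[of b ?u]
    by (simp add: aff_apply_def blinfun.diff_right blinfun.add_right blinfun.scaleR_right algebra_simps)
  finally show "aff_refl (act b a) v = (aff_refl b \<circ> aff_refl a \<circ> aff_refl b) v"
    by (simp add: aff_refl_involution[OF assms] c[symmetric] aff_refl_def[of "act b a"] aff_apply_act)
qed

lemma aff_refl_isometry:
  assumes "fst a \<noteq> 0" shows "norm (aff_refl a x - aff_refl a y) = norm (x - y)"
proof -
  let ?a = "riesz (fst a)"
  have a: "?a \<noteq> 0" using assms by (simp add: riesz_eq_0_iff)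
  have "aff_refl a x - aff_refl a y = (x - y) - (2 * ((x - y) \<bullet> ?a) / (?a \<bullet> ?a)) *\<^sub>R ?a"
    by (simp add: aff_refl_def aff_apply_def coroot_eq blinfun_eq_riesz inner_commute algebra_simps
        inner_diff_left add_divide_distrib diff_divide_distrib)
  then show ?thesis by (simp add: norm_eq_sqrt_inner inner_reflection[OF a])
qed

section \<open>Nonnegative integral combinations and words of involutions\<close>

lemma nonneg_comb_zero: "0 \<in> nonneg_comb A"
  unfolding nonneg_comb_def by (auto intro!: exI[of _ "\<lambda>_. 0"])

lemma nonneg_comb_add: "x \<in> nonneg_comb A \<Longrightarrow> y \<in> nonneg_comb A \<Longrightarrow> x + y \<in> nonneg_comb A"
proof -
  assume "x \<in> nonneg_comb A" "y \<in> nonneg_comb A"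
  then obtain c d :: "'a \<Rightarrow> nat" where "x = (\<Sum>b\<in>A. real (c b) *\<^sub>R b)" "y = (\<Sum>b\<in>A. real (d b) *\<^sub>R b)"
    by (auto simp: nonneg_comb_def)
  then have "x + y = (\<Sum>b\<in>A. real (c b + d b) *\<^sub>R b)"
    by (simp add: scaleR_left_distrib sum.distrib)
  then show "x + y \<in> nonneg_comb A" unfolding nonneg_comb_def mem_Collect_eq
    by (rule exI[of _ "\<lambda>b. c b + d b"])
qed

lemma nonneg_comb_base:
  assumes "finite A" "x \<in> A" shows "x \<in> nonneg_comb A"
proof -
  have "(\<Sum>b\<in>A. real (if b = x then 1 else 0) *\<^sub>R b) = (\<Sum>b\<in>A. if b = x then b else 0)"
    by (rule sum.cong) auto
  then have "x = (\<Sum>b\<in>A. real (if b = x then 1 else 0) *\<^sub>R b)" using assms by simp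
  then show ?thesis unfolding nonneg_comb_def mem_Collect_eq
    by (rule exI[of _ "\<lambda>b. if b = x then 1 else 0"])
qed

lemma nonneg_comb_of_nat_scaleR: "x \<in> nonneg_comb A \<Longrightarrow> real n *\<^sub>R x \<in> nonneg_comb A"
  by (induction n) (auto simp: nonneg_comb_zero scaleR_left_distrib intro: nonneg_comb_add)

lemma nonneg_comb_sum:
  "(\<And>i. i \<in> I \<Longrightarrow> f i \<in> nonneg_comb A) \<Longrightarrow> sum f I \<in> nonneg_comb A"
  by (induction I rule: infinite_finite_induct) (auto simp: nonneg_comb_zero intro: nonneg_comb_add)

lemma word_prod_Nil [simp]: "word_prod [] = id"
  by (simp add: word_prod_def)

lemma word_prod_Cons [simp]: "word_prod (f # fs) = f \<circ> word_prod fs"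
  by (simp add: word_prod_def)

lemma word_prod_append [simp]: "word_prod (fs @ gs) = word_prod fs \<circ> word_prod gs"
  by (induction fs) (auto simp: o_assoc)

lemma word_prod_rev:
  "(\<And>f. f \<in> set fs \<Longrightarrow> f \<circ> f = id) \<Longrightarrow> word_prod (rev fs) \<circ> word_prod fs = id"
proof (induction fs)
  case (Cons f fs)
  have ff: "f \<circ> f = id" by (rule Cons.prems) simp
  have IH: "word_prod (rev fs) \<circ> word_prod fs = id" by (rule Cons.IH, rule Cons.prems) simp
  have "word_prod (rev (f # fs)) \<circ> word_prod (f # fs) = word_prod (rev fs) \<circ> (f \<circ> f) \<circ> word_prod fs"
    by (simp add: o_assoc)
  then show ?case by (simp only: ff IH comp_id)
qed simp

lemma inv_word_prod:
  assumes "\<And>f. f \<in> set fs \<Longrightarrow> f \<circ> f = id"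
  shows "bij (word_prod fs)" "inv (word_prod fs) = word_prod (rev fs)"
proof -
  have 1: "word_prod (rev fs) \<circ> word_prod fs = id" using assms by (rule word_prod_rev)
  have 2: "word_prod fs \<circ> word_prod (rev fs) = id" using word_prod_rev[of "rev fs"] assms by simp
  show "bij (word_prod fs)" using 1 2 by (metis o_bij)
  show "inv (word_prod fs) = word_prod (rev fs)" using 1 2 by (metis inv_unique_comp)
qed

section \<open>Root data, the simple affine roots and an interior point of the alcove\<close>

locale root_data =
  fixes R B :: "'a::euclidean_space dual set" and \<phi> :: "'a dual"
  assumes root_system: "root_system R" and reduced: "reduced R" and crystallographic: "crystallographic R"
    and root_basis: "root_basis R B" and highest_root: "highest_root R B \<phi>"
begin

abbreviation "Sig \<equiv> aff_roots R"
abbreviation "Del \<equiv> aff_basis B \<phi>"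
abbreviation "W \<equiv> aff_weyl R"
abbreviation "W0 \<equiv> weyl R"
abbreviation "C \<equiv> C_plus B \<phi>"

lemma finite_R: "finite R" and zero_notin_R: "0 \<notin> R" and span_R: "span R = UNIV"
  and refl_R: "\<alpha> \<in> R \<Longrightarrow> \<beta> \<in> R \<Longrightarrow> \<beta> - app \<beta> (coroot \<alpha>) *\<^sub>R \<alpha> \<in> R"
  using root_system unfolding root_system_def by auto

lemma R_Ints: "\<alpha> \<in> R \<Longrightarrow> \<beta> \<in> R \<Longrightarrow> app \<beta> (coroot \<alpha>) \<in> \<int>"
  using crystallographic unfolding crystallographic_def by auto

lemma R_minus: "\<alpha> \<in> R \<Longrightarrow> - \<alpha> \<in> R"
  using refl_R[of \<alpha> \<alpha>] zero_notin_R apply_coroot_self[of \<alpha>] by (cases "\<alpha> = 0") (auto simp: scaleR_2)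

lemma B_R: "B \<subseteq> R" and indep_B: "independent B" 
  and R_cases: "\<alpha> \<in> R \<Longrightarrow> \<alpha> \<in> nonneg_comb B \<or> - \<alpha> \<in> nonneg_comb B"
  using root_basis unfolding root_basis_def by auto

lemma finite_B: "finite B" using B_R finite_R by (rule finite_subset)

lemma phi_R: "\<phi> \<in> R" and phi_highest: "\<alpha> \<in> R \<Longrightarrow> \<phi> - \<alpha> \<in> nonneg_comb B"
  using highest_root unfolding highest_root_def by auto

lemma nonneg_comb_span: "x \<in> nonneg_comb A \<Longrightarrow> x \<in> span A"
  unfolding nonneg_comb_def by clarify (intro span_sum span_scale span_base)

lemma span_B: "span B = UNIV"
proof -
  have "R \<subseteq> span B" using R_cases nonneg_comb_span span_neg by fastforce
  then show ?thesis using span_R by (metis span_minimal subspace_span top.extremum_uniqueI)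
qed

lemma finite_Del: "finite Del"
  by (simp add: aff_basis_def finite_B)

lemma Sig_iff: "a \<in> Sig \<longleftrightarrow> fst a \<in> R \<and> snd a \<in> \<int>"
  by (cases a) (auto simp: aff_roots_def elim: Ints_cases)

lemma Del_Sig: "j \<in> Del \<Longrightarrow> j \<in> Sig"
  using B_R phi_R R_minus by (auto simp: aff_basis_def Sig_iff)

lemma fst_Sig: "a \<in> Sig \<Longrightarrow> fst a \<noteq> 0"
  using zero_notin_R by (auto simp: Sig_iff)

lemmas fst_Del = fst_Sig[OF Del_Sig]

lemma Sig_minus: "a \<in> Sig \<Longrightarrow> - a \<in> Sig"
  by (simp add: Sig_iff R_minus)

lemma Sig_act: "a \<in> Sig \<Longrightarrow> b \<in> Sig \<Longrightarrow> act b a \<in> Sig"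
  by (simp add: Sig_iff act_def refl_R R_Ints)

text \<open>The simple roots form a basis of the dual, and V is its own bidual: a functional
  \<open>L\<close> on the dual is evaluation at the vector whose coordinates are the values of
  \<open>L\<close> on the coordinate functionals.\<close>

lemma B_prescribe: obtains v where "\<And>b. b \<in> B \<Longrightarrow> app b v = c b"
proof -
  obtain L where L: "linear L" "\<forall>b\<in>B. L b = (c b :: real)"
    using linear_independent_extend[OF indep_B] by blast
  let ?v = "\<Sum>e\<in>Basis. L (blinfun_inner_left e) *\<^sub>R e"
  have "app \<xi> ?v = L \<xi>" for \<xi>
  proof -
    have "\<xi> = (\<Sum>e\<in>Basis. app \<xi> e *\<^sub>R blinfun_inner_left e)"
    proof (rule blinfun_eqI)
      fix v :: 'a
      have "app \<xi> v = app \<xi> (\<Sum>e\<in>Basis. (v \<bullet> e) *\<^sub>R e)"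
        by (simp add: euclidean_representation)
      then show "app \<xi> v = app (\<Sum>e\<in>Basis. app \<xi> e *\<^sub>R blinfun_inner_left e) v"
        by (simp add: blinfun.sum_left blinfun.scaleR_left blinfun.sum_right blinfun.scaleR_right mult.commute)
    qed
    then have "L \<xi> = (\<Sum>e\<in>Basis. app \<xi> e *\<^sub>R L (blinfun_inner_left e))"
      using linear_sum[OF L(1), of "\<lambda>e. app \<xi> e *\<^sub>R blinfun_inner_left e" Basis]
      by (simp add: linear_scale[OF L(1)])
    then show ?thesis by (simp add: blinfun.sum_right blinfun.scaleR_right mult.commute)
  qed
  then show thesis using L(2) by (intro that[of ?v]) simp
qed

lemma nonneg_comb_apply_nonneg:
  assumes "x \<in> nonneg_comb B" "\<And>b. b \<in> B \<Longrightarrow> app b v \<ge> 0"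
  shows "app x v \<ge> 0"
  using assms by (auto simp: nonneg_comb_def blinfun.sum_left blinfun.scaleR_left intro!: sum_nonneg)

lemma C_iff: "v \<in> C \<longleftrightarrow> (\<forall>j\<in>Del. aff_apply j v > 0)"
  by (simp add: C_plus_def)

lemma Del_cases: "j \<in> Del \<longleftrightarrow> j = (- \<phi>, 1) \<or> (\<exists>b\<in>B. j = (b, 0))"
  by (auto simp: aff_basis_def)

lemma phi_nonneg_comb: "\<phi> \<in> nonneg_comb B"
proof (rule disjE[OF R_cases[OF phi_R]])
  assume m: "- \<phi> \<in> nonneg_comb B"
  \<comment> \<open>The highest root condition for the root -\<phi> gives that 2\<phi> is
    nonnegative; adding -\<phi> then returns \<phi>.\<close>
  have "real 2 *\<^sub>R \<phi> \<in> nonneg_comb B" using phi_highest[OF R_minus[OF phi_R]] by (simp add: scaleR_2)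
  from nonneg_comb_add[OF this m] show ?thesis by (simp add: scaleR_2)
qed

lemma phi_expand:
  obtains m :: "'a dual \<Rightarrow> nat" where "\<And>v. app \<phi> v = (\<Sum>b\<in>B. real (m b) * app b v)"
proof -
  obtain m :: "'a dual \<Rightarrow> nat" where m: "\<phi> = (\<Sum>b\<in>B. real (m b) *\<^sub>R b)"
    using phi_nonneg_comb by (auto simp: nonneg_comb_def)
  have "app \<phi> v = (\<Sum>b\<in>B. real (m b) * app b v)" for v
    by (subst m) (simp add: blinfun.sum_left blinfun.scaleR_left)
  then show ?thesis by (rule that)
qed

text \<open>Evaluation at the point \<open>x\<^sub>0\<close>, where all simple affine roots take the same value, measures heights.\<close>

definition x0 :: 'a where
  "x0 = (SOME v. \<exists>t>0. \<forall>j\<in>Del. aff_apply j v = t)"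

lemma x0_exists: "\<exists>t>0. \<forall>j\<in>Del. aff_apply j x0 = t"
  unfolding x0_def
proof (rule someI_ex)
  obtain m :: "'a dual \<Rightarrow> nat" where m: "\<And>v. app \<phi> v = (\<Sum>b\<in>B. real (m b) * app b v)"
    using phi_expand by blast
  \<comment> \<open>The common value t must satisfy t = 1 - t * ht(\<phi>), so it is 1/h with h one
    more than the height of \<phi>.\<close>
  define h where "h = 1 + (\<Sum>b\<in>B. real (m b))"
  have h: "h > 0" unfolding h_def by (simp add: sum_nonneg add_pos_nonneg)
  obtain v where v: "\<And>b. b \<in> B \<Longrightarrow> app b v = 1 / h" using B_prescribe[of "\<lambda>_. 1 / h"] by auto
  have "app \<phi> v = (\<Sum>b\<in>B. real (m b)) / h"
    by (simp add: m v sum_divide_distrib)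
  then have "1 - app \<phi> v = 1 / h" using h by (simp add: h_def field_simps)
  then have "\<forall>j\<in>Del. aff_apply j v = 1 / h"
    using v by (auto simp: Del_cases aff_apply_def blinfun.minus_left)
  then show "\<exists>v. \<exists>t>0. \<forall>j\<in>Del. aff_apply j v = t" using h by (meson zero_less_divide_1_iff)
qed

definition t0 :: real where "t0 = (SOME t. t > 0 \<and> (\<forall>j\<in>Del. aff_apply j x0 = t))"

lemma t0: "t0 > 0" "j \<in> Del \<Longrightarrow> aff_apply j x0 = t0"
proof -
  have "t0 > 0 \<and> (\<forall>j\<in>Del. aff_apply j x0 = t0)"
    unfolding t0_def by (rule someI_ex[OF x0_exists])
  then show "t0 > 0" "j \<in> Del \<Longrightarrow> aff_apply j x0 = t0" by auto
qed

lemma x0_C: "x0 \<in> C" by (simp add: C_iff t0)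

lemma lift_nonneg_comb:
  assumes "\<alpha> \<in> nonneg_comb B" shows "(\<alpha>, 0) \<in> nonneg_comb Del"
proof -
  obtain c where c: "\<alpha> = (\<Sum>b\<in>B. real (c b) *\<^sub>R b)" using assms by (auto simp: nonneg_comb_def)
  have "(\<alpha>, 0) = (\<Sum>b\<in>B. real (c b) *\<^sub>R (b, 0::real))"
    unfolding c by (rule prod_eqI) (simp_all add: fst_sum snd_sum)
  also have "\<dots> \<in> nonneg_comb Del"
    by (intro nonneg_comb_sum nonneg_comb_of_nat_scaleR nonneg_comb_base finite_Del) (auto simp: Del_cases)
  finally show ?thesis .
qed

lemma const_nonneg_comb: "(0, real k) \<in> nonneg_comb Del"
proof -
  have "(- \<phi>, 1) + (\<phi>, 0) \<in> nonneg_comb Del"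
    by (intro nonneg_comb_add lift_nonneg_comb phi_nonneg_comb nonneg_comb_base finite_Del)
      (auto simp: Del_cases)
  from nonneg_comb_of_nat_scaleR[OF this, of k] show ?thesis by simp
qed

lemma Sig_cases:
  assumes "a \<in> Sig" shows "a \<in> nonneg_comb Del \<or> - a \<in> nonneg_comb Del"
proof -
  have main: "(\<alpha>, of_int k) \<in> nonneg_comb Del \<or> - (\<alpha>, of_int k :: real) \<in> nonneg_comb Del"
    if a: "\<alpha> \<in> R" "\<alpha> \<in> nonneg_comb B" for \<alpha> k
  proof (cases "k \<ge> 0")
    case True
    have "(\<alpha>, 0) + (0, real (nat k)) \<in> nonneg_comb Del"
      using a by (intro nonneg_comb_add lift_nonneg_comb const_nonneg_comb)
    then show ?thesis using True by simp
  next
    case False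
    \<comment> \<open>For k < 0 one has -(\<alpha> + k) = (\<phi> - \<alpha>) + (1 - \<phi>) + (-k -
      1); the middle root uses up one unit of the constant.\<close>
    have "(\<phi> - \<alpha>, 0) + ((- \<phi>, 1) + (0, real (nat (- k - 1)))) \<in> nonneg_comb Del"
      by (intro nonneg_comb_add lift_nonneg_comb[OF phi_highest[OF a(1)]] const_nonneg_comb
          nonneg_comb_base[OF finite_Del]) (simp add: Del_cases)
    then show ?thesis using False by simp
  qed
  obtain \<alpha> k where a: "a = (\<alpha>, of_int k)" "\<alpha> \<in> R" using assms by (auto simp: aff_roots_def)
  from R_cases[OF a(2)] show ?thesis
  proof
    assume "- \<alpha> \<in> nonneg_comb B"
    from main[OF R_minus[OF a(2)] this, of "-k"] show ?thesis by (simp add: a disj_commute)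
  qed (use main a in auto)
qed

section \<open>Positive affine roots\<close>

definition pos :: "'a affine_fun \<Rightarrow> bool" where "pos a \<longleftrightarrow> a \<in> Sig \<and> aff_apply a x0 > 0"

lemma nonneg_comb_Del_nonneg:
  assumes "a \<in> nonneg_comb Del" "\<And>j. j \<in> Del \<Longrightarrow> aff_apply j v \<ge> 0"
  shows "aff_apply a v \<ge> 0"
  using assms by (auto simp: nonneg_comb_def aff_apply_sum aff_apply_scaleR intro!: sum_nonneg)

lemma Sig_x0_nonzero: assumes "a \<in> nonneg_comb Del" "a \<in> Sig" shows "aff_apply a x0 > 0"
proof -
  obtain c where c: "a = (\<Sum>j\<in>Del. real (c j) *\<^sub>R j)" using assms(1) by (auto simp: nonneg_comb_def)
  have *: "aff_apply a x0 = (\<Sum>j\<in>Del. real (c j)) * t0"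
    by (simp add: c aff_apply_sum aff_apply_scaleR t0(2) sum_distrib_right)
  have "(\<Sum>j\<in>Del. real (c j)) \<noteq> 0"
  proof
    assume "(\<Sum>j\<in>Del. real (c j)) = 0"
    then have "\<forall>j\<in>Del. c j = 0" using finite_Del by (simp add: sum_nonneg_eq_0_iff)
    then have "a = 0" unfolding c by simp
    then show False using fst_Sig[OF assms(2)] by simp
  qed
  moreover have "(\<Sum>j\<in>Del. real (c j)) \<ge> 0" by (intro sum_nonneg) simp
  ultimately have "(\<Sum>j\<in>Del. real (c j)) > 0" by linarith
  then show ?thesis using * t0(1) by simp
qed

text \<open>Every affine root in the cone of \<open>Del\<close> is positive at \<open>x0\<close>,
  and of a root and its negative one lies in the cone; so a single evaluation decides.\<close>

lemma pos_iff: "pos a \<longleftrightarrow> a \<in> Sig \<and> a \<in> nonneg_comb Del"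
  using Sig_cases[of a] Sig_x0_nonzero[of a] Sig_x0_nonzero[of "-a"] Sig_minus[of a]
  by (auto simp: pos_def aff_apply_minus)

lemma aff_pos_roots_eq: "aff_pos_roots R B \<phi> = {a. pos a}"
  by (auto simp: aff_pos_roots_def pos_iff)

lemma pos_minus: "a \<in> Sig \<Longrightarrow> pos (- a) \<longleftrightarrow> \<not> pos a"
  using Sig_cases[of a] Sig_x0_nonzero[of a] Sig_x0_nonzero[of "-a"] Sig_minus[of a]
  by (auto simp: pos_def aff_apply_minus)

lemma Del_pos: "j \<in> Del \<Longrightarrow> pos j" by (simp add: pos_def Del_Sig t0)

lemma pos_on_C: assumes "pos a" "v \<in> C" shows "aff_apply a v > 0"
proof -
  obtain c where c: "a = (\<Sum>j\<in>Del. real (c j) *\<^sub>R j)" using assms(1) by (auto simp: pos_iff nonneg_comb_def)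
  have *: "aff_apply a v = (\<Sum>j\<in>Del. real (c j) * aff_apply j v)"
    by (simp add: c aff_apply_sum aff_apply_scaleR)
  have nn: "\<And>j. j \<in> Del \<Longrightarrow> real (c j) * aff_apply j v \<ge> 0" using assms(2) by (simp add: C_iff less_imp_le)
  have "aff_apply a v \<noteq> 0"
  proof
    assume "aff_apply a v = 0"
    then have "\<forall>j\<in>Del. real (c j) * aff_apply j v = 0"
      using * nn finite_Del by (simp add: sum_nonneg_eq_0_iff)
    then have "c j = 0" if "j \<in> Del" for j using assms(2) that by (force simp: C_iff)
    then have "a = 0" unfolding c by simp
    then show False using fst_Sig[of a] assms(1) by (simp add: pos_def)
  qed
  moreover have "aff_apply a v \<ge> 0" using * nn by (simp add: sum_nonneg)
  ultimately show ?thesis by simp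
qed

text \<open>For -\<phi> + 1 the point \<open>x0\<close> is scaled until \<phi> equals 1. For b in B
  the value of b is lowered from \<open>t0\<close> to 0, which keeps \<phi> below 1.\<close>

lemma wall_point:
  assumes "j \<in> Del" obtains y where "aff_apply j y = 0" "\<And>i. i \<in> Del \<Longrightarrow> i \<noteq> j \<Longrightarrow> aff_apply i y > 0"
proof (cases "j = (- \<phi>, 1)")
  case True
  have b: "app b x0 = t0" if "b \<in> B" for b
    using t0(2)[of "(b, 0)"] that by (auto simp: Del_cases aff_apply_def)
  have "app \<phi> x0 > 0"
    using Sig_x0_nonzero[of "(\<phi>, 0)"] lift_nonneg_comb[OF phi_nonneg_comb] phi_R
    by (auto simp: Sig_iff aff_apply_def)
  then show ?thesis using b t0(1) True
    by (intro that[of "(1 / app \<phi> x0) *\<^sub>R x0"])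
      (auto simp: Del_cases aff_apply_def blinfun.minus_left blinfun.scaleR_right)
next
  case False
  then obtain b where b: "b \<in> B" "j = (b, 0)" using assms by (auto simp: Del_cases)
  obtain y where y: "\<And>b'. b' \<in> B \<Longrightarrow> app b' y = (if b' = b then 0 else t0)"
    using B_prescribe[of "\<lambda>b'. if b' = b then 0 else t0"] by blast
  obtain m :: "'a dual \<Rightarrow> nat" where m: "\<And>v. app \<phi> v = (\<Sum>b\<in>B. real (m b) * app b v)"
    using phi_expand by blast
  have b0: "app b x0 = t0" if "b \<in> B" for b
    using t0(2)[of "(b, 0)"] that by (auto simp: Del_cases aff_apply_def)
  have "app \<phi> y \<le> app \<phi> x0"
    unfolding m using t0(1) by (intro sum_mono) (simp add: y b0)
  also have "\<dots> < 1" using t0(1) t0(2)[of "(- \<phi>, 1)"] by (simp add: Del_cases aff_apply_def blinfun.minus_left)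
  finally show ?thesis using y b t0(1)
    by (intro that[of y]) (auto simp: Del_cases aff_apply_def blinfun.minus_left split: if_splits)
qed

text \<open>The reflection in j fixes a point y of wall j that is strictly inside all other walls.
  If a became negative, then a(y) would be at most 0, so a would have no coefficient besides that of
  j, and reducedness leaves only a = j.\<close>

lemma pos_act:
  assumes j: "j \<in> Del" and a: "pos a" "a \<noteq> j"
  shows "pos (act j a)"
proof (rule ccontr)
  assume n: "\<not> pos (act j a)"
  have S: "act j a \<in> Sig" using a j by (simp add: Sig_act Del_Sig pos_def)
  then have neg: "- act j a \<in> nonneg_comb Del" using n Sig_cases[OF S] by (simp add: pos_iff)
  obtain y where y: "aff_apply j y = 0" "\<And>i. i \<in> Del \<Longrightarrow> i \<noteq> j \<Longrightarrow> aff_apply i y > 0"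
    using wall_point[OF j] by blast
  obtain c where c: "a = (\<Sum>i\<in>Del. real (c i) *\<^sub>R i)" using a(1) by (auto simp: pos_iff nonneg_comb_def)
  have y0: "aff_apply i y \<ge> 0" if "i \<in> Del" for i using y that by (cases "i = j") (auto simp: less_imp_le)
  have "aff_apply (act j a) y = aff_apply a y"
    by (simp add: aff_apply_act aff_refl_def y(1))
  moreover have "aff_apply (- act j a) y \<ge> 0" using nonneg_comb_Del_nonneg[OF neg] y0 by blast
  ultimately have "aff_apply a y \<le> 0" by (simp add: aff_apply_minus)
  moreover have e: "aff_apply a y = (\<Sum>i\<in>Del. real (c i) * aff_apply i y)"
    by (simp add: c aff_apply_sum aff_apply_scaleR)
  moreover have "(\<Sum>i\<in>Del. real (c i) * aff_apply i y) \<ge> 0" using y0 by (intro sum_nonneg) simp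
  ultimately have "\<forall>i\<in>Del. real (c i) * aff_apply i y = 0"
    using finite_Del y0 by (simp add: sum_nonneg_eq_0_iff)
  then have z: "c i = 0" if "i \<in> Del" "i \<noteq> j" for i using y(2)[OF that] that by auto
  have "a = (\<Sum>i\<in>Del. if i = j then real (c j) *\<^sub>R j else 0)"
    unfolding c by (rule sum.cong) (auto simp: z)
  then have aj: "a = real (c j) *\<^sub>R j" using j finite_Del by simp
  have "real (c j) *\<^sub>R fst j \<in> R" using a(1) aj by (metis Sig_iff fst_scaleR pos_def)
  moreover have "fst j \<in> R" using j Del_Sig Sig_iff by blast
  ultimately have "real (c j) = 1 \<or> real (c j) = - 1"
    using reduced unfolding reduced_def by blast
  then have "real (c j) = 1" by linarith
  then show False using aj a(2) by simp
qed

end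

section \<open>The affine Weyl group and its fundamental alcove\<close>

context root_data begin

lemma aff_refl_comp_self: "a \<in> Sig \<Longrightarrow> aff_refl a \<circ> aff_refl a = id"
  by (simp add: fun_eq_iff aff_refl_involution fst_Sig)

lemma W_id: "id \<in> W"
  unfolding aff_weyl_def by (rule image_eqI[of _ _ "[]"]) auto

lemma W_comp: "v \<in> W \<Longrightarrow> w \<in> W \<Longrightarrow> v \<circ> w \<in> W"
proof -
  assume "v \<in> W" "w \<in> W"
  then obtain vs ws where "vs \<in> lists (aff_refl ` Sig)" "ws \<in> lists (aff_refl ` Sig)"
    "v = word_prod vs" "w = word_prod ws" unfolding aff_weyl_def by blast
  then show "v \<circ> w \<in> W" unfolding aff_weyl_def
    by (intro image_eqI[of _ _ "vs @ ws"]) (simp_all only: word_prod_append append_in_lists_conv simp_thms)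
qed

lemma aff_refl_W: "a \<in> Sig \<Longrightarrow> aff_refl a \<in> W"
  unfolding aff_weyl_def by (rule image_eqI[of _ _ "[aff_refl a]"]) auto

lemma W_induct [consumes 1, case_names id refl]:
  assumes "w \<in> W" "P id" "\<And>a w. a \<in> Sig \<Longrightarrow> w \<in> W \<Longrightarrow> P w \<Longrightarrow> P (aff_refl a \<circ> w)"
  shows "P w"
proof -
  obtain ws where ws: "ws \<in> lists (aff_refl ` Sig)" "w = word_prod ws"
    using assms(1) by (auto simp: aff_weyl_def)
  have "word_prod ws \<in> W \<and> P (word_prod ws)" using ws(1)
  proof (induction ws)
    case Nil
    show ?case by (simp only: word_prod_Nil assms(2) W_id simp_thms)
  next
    case (Cons f ws)
    then obtain a where a: "a \<in> Sig" "f = aff_refl a" by blast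
    show ?case unfolding word_prod_Cons a(2)
      using Cons.IH a(1) assms(3) W_comp[OF aff_refl_W] by blast
  qed
  then show ?thesis using ws by simp
qed

lemma W_inv:
  assumes "w \<in> W" shows "bij w" "inv w \<in> W"
proof -
  obtain ws where ws: "ws \<in> lists (aff_refl ` Sig)" "w = word_prod ws"
    using assms by (auto simp: aff_weyl_def)
  have i: "f \<circ> f = id" if "f \<in> set ws" for f
    using ws(1) that aff_refl_comp_self unfolding lists_eq_set by blast
  show "bij w" unfolding ws by (rule inv_word_prod[OF i])
  have "rev ws \<in> lists (aff_refl ` Sig)" using ws(1) by (simp add: lists_eq_set)
  then have "word_prod (rev ws) \<in> W" unfolding aff_weyl_def by (rule imageI)
  then show "inv w \<in> W" unfolding ws(2) using inv_word_prod(2)[OF i] by simp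
qed

lemma W_inv_apply: "w \<in> W \<Longrightarrow> inv w (w v) = v" "w \<in> W \<Longrightarrow> w (inv w v) = v"
  using W_inv(1) by (auto simp: bij_is_inj bij_is_surj surj_f_inv_f)

text \<open>Pullback along w permutes the affine roots and conjugation permutes the reflections
  accordingly. One and the same b serves both purposes, as the exchange argument requires.\<close>

lemma W_Sig:
  assumes "w \<in> W" "a \<in> Sig"
  shows "\<exists>b\<in>Sig. (\<forall>v. aff_apply b v = aff_apply a (w v)) \<and> w \<circ> aff_refl b = aff_refl a \<circ> w"
  using assms
proof (induction arbitrary: a rule: W_induct)
  case id
  then show ?case by (intro bexI[of _ a]) auto
next
  case (refl c w)
  then obtain b where b: "b \<in> Sig" "\<forall>v. aff_apply b v = aff_apply (act c a) (w v)"
    "w \<circ> aff_refl b = aff_refl (act c a) \<circ> w"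
    using Sig_act by metis
  have "aff_refl c \<circ> w \<circ> aff_refl b = aff_refl c \<circ> (aff_refl (act c a) \<circ> w)"
    by (simp only: b(3) o_assoc[symmetric])
  also have "\<dots> = (aff_refl c \<circ> aff_refl c) \<circ> aff_refl a \<circ> (aff_refl c \<circ> w)"
    by (simp only: aff_refl_act[OF fst_Sig[OF refl(1)]] o_assoc)
  also have "\<dots> = aff_refl a \<circ> (aff_refl c \<circ> w)"
    by (simp only: aff_refl_comp_self[OF refl(1)] id_comp)
  finally have "aff_refl c \<circ> w \<circ> aff_refl b = aff_refl a \<circ> (aff_refl c \<circ> w)" .
  moreover have "\<forall>v. aff_apply b v = aff_apply a ((aff_refl c \<circ> w) v)"
    using b(2) by (simp add: aff_apply_act)
  ultimately show ?case using b(1) by blast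
qed

section \<open>Words in the simple reflections\<close>

definition sw :: "'a affine_fun list \<Rightarrow> 'a \<Rightarrow> 'a" where
  "sw js = word_prod (map aff_refl js)"

lemma sw_simps [simp]: "sw [] = id" "sw (j # js) = aff_refl j \<circ> sw js" "sw (us @ js) = sw us \<circ> sw js"
  by (simp_all add: sw_def)

lemma sw_W: "set js \<subseteq> Del \<Longrightarrow> sw js \<in> W"
proof (induction js)
  case Nil
  show ?case unfolding sw_simps by (rule W_id)
next
  case (Cons j js)
  then have "j \<in> Del" "sw js \<in> W" by auto
  then show ?case unfolding sw_simps by (intro W_comp aff_refl_W Del_Sig)
qed

lemma exists_Del_inner_pos:
  assumes "r \<bullet> r > 0" "r = (\<Sum>j\<in>J. real (c j) *\<^sub>R riesz (f j))"
  shows "\<exists>j\<in>J. r \<bullet> riesz (f j) > 0"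
proof (rule ccontr)
  assume "\<not> ?thesis"
  then have "r \<bullet> riesz (f j) \<le> 0" if "j \<in> J" for j using that by force
  then have "(\<Sum>j\<in>J. real (c j) * (r \<bullet> riesz (f j))) \<le> 0"
    by (intro sum_nonpos mult_nonneg_nonpos) auto
  moreover have "r \<bullet> r = (\<Sum>j\<in>J. real (c j) * (r \<bullet> riesz (f j)))"
    using arg_cong[OF assms(2), of "\<lambda>x. r \<bullet> x"] by (simp add: inner_sum_right)
  ultimately show False using assms(1) by linarith
qed

text \<open>A positive integral multiple of j is subtracted, so the height, measured at
  \<open>x0\<close> in units of \<open>t0\<close>, drops, while \<open>pos_act\<close> preserves
  positivity. This drives the inductions for reflections and for coroots.\<close>

lemma descend:
  assumes a: "pos a" "aff_apply a x0 = real n * t0" and j: "j \<in> Del" "a \<noteq> j"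
    and p: "riesz (fst a) \<bullet> riesz (fst j) > 0"
  obtains m where "m < n" "pos (act j a)" "aff_apply (act j a) x0 = real m * t0"
proof -
  let ?k = "app (fst a) (coroot (fst j))"
  have "?k \<in> \<int>" using R_Ints a(1) j Del_Sig by (simp add: Sig_iff pos_def)
  then obtain k where k: "?k = of_int k" by (rule Ints_cases)
  have "riesz (fst j) \<bullet> riesz (fst j) > 0" using fst_Del[OF j(1)] by (simp add: riesz_eq_0_iff)
  then have "?k > 0" using p by (simp add: apply_coroot)
  then have k0: "k > 0" by (simp add: k)
  have v: "aff_apply (act j a) x0 = (real n - of_int k) * t0"
    by (simp add: act_def aff_apply_diff aff_apply_scaleR k a(2) t0(2)[OF j(1)] left_diff_distrib)
  have pa: "pos (act j a)" using pos_act j a by simp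
  then have "(real n - of_int k) * t0 > 0" using v by (simp add: pos_def)
  then have "real n - of_int k > 0" using t0(1) by (simp add: zero_less_mult_iff)
  then have "k < int n" by linarith
  then have "real (n - nat k) = real n - of_int k" using k0 by (simp add: of_nat_diff)
  with v pa k0 \<open>k < int n\<close> show ?thesis by (intro that[of "n - nat k"]) auto
qed

lemma pos_height:
  assumes "pos a" obtains n where "aff_apply a x0 = real n * t0"
proof -
  obtain c where c: "a = (\<Sum>j\<in>Del. real (c j) *\<^sub>R j)" using assms by (auto simp: pos_iff nonneg_comb_def)
  have "aff_apply a x0 = real (\<Sum>j\<in>Del. c j) * t0"
    by (simp add: c aff_apply_sum aff_apply_scaleR t0(2) sum_distrib_right)
  then show ?thesis by (rule that)
qed

text \<open>Induction on the height: conjugation by a simple reflection adds two letters, so the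
  length stays odd. The parity is what gives every reflection the sign -1.\<close>

lemma aff_refl_simple_word:
  assumes "a \<in> Sig" shows "\<exists>js. set js \<subseteq> Del \<and> aff_refl a = sw js \<and> odd (length js)"
proof -
  have main: "pos a \<Longrightarrow> aff_apply a x0 = real n * t0 \<Longrightarrow>
      \<exists>js. set js \<subseteq> Del \<and> aff_refl a = sw js \<and> odd (length js)" for n a
  proof (induction n arbitrary: a rule: less_induct)
    case (less n)
    show ?case
    proof (cases "a \<in> Del")
      case True
      then show ?thesis by (intro exI[of _ "[a]"]) simp
    next
      case False
      obtain c where c: "a = (\<Sum>j\<in>Del. real (c j) *\<^sub>R j)"
        using less.prems(1) by (auto simp: pos_iff nonneg_comb_def)
      have "riesz (fst a) = (\<Sum>j\<in>Del. real (c j) *\<^sub>R riesz (fst j))"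
        by (subst c) (simp add: fst_sum riesz_sum riesz_scaleR)
      moreover have "riesz (fst a) \<bullet> riesz (fst a) > 0"
        using less.prems(1) fst_Sig[of a] by (simp add: pos_def riesz_eq_0_iff)
      ultimately obtain j where j: "j \<in> Del" "riesz (fst a) \<bullet> riesz (fst j) > 0"
        using exists_Del_inner_pos by blast
      obtain m where m: "m < n" "pos (act j a)" "aff_apply (act j a) x0 = real m * t0"
        using descend[OF less.prems j(1) _ j(2)] False j(1) by blast
      from less.IH[OF m] obtain js where js: "set js \<subseteq> Del" "aff_refl (act j a) = sw js" "odd (length js)"
        by blast
      have "aff_refl a = aff_refl (act j (act j a))" by (simp add: act_involution fst_Del j)
      also have "\<dots> = sw (j # js @ [j])"
        by (simp only: aff_refl_act[OF fst_Del[OF j(1)], of "act j a"] js sw_simps comp_id o_assoc)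
      finally show ?thesis using js j by (intro exI[of _ "j # js @ [j]"]) simp
    qed
  qed
  show ?thesis
  proof (cases "pos a")
    case True
    then obtain n where "aff_apply a x0 = real n * t0" by (rule pos_height)
    then show ?thesis by (rule main[OF True])
  next
    case False
    then have p: "pos (- a)" by (simp add: pos_minus assms)
    then obtain n where "aff_apply (- a) x0 = real n * t0" by (rule pos_height)
    from main[OF p this] show ?thesis by (simp add: aff_refl_minus)
  qed
qed

lemma W_simple: "w \<in> W \<Longrightarrow> \<exists>js. set js \<subseteq> Del \<and> w = sw js"
proof (induction rule: W_induct)
  case id
  show ?case by (intro exI[of _ "[]"]) simp
next
  case (refl a w)
  then obtain js us where "set js \<subseteq> Del" "w = sw js" "set us \<subseteq> Del" "aff_refl a = sw us"
    using aff_refl_simple_word by metis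
  then show ?case by (intro exI[of _ "us @ js"]) simp
qed

section \<open>Geometry of the closed alcove\<close>

lemma Sig_nonzero_C: "a \<in> Sig \<Longrightarrow> v \<in> C \<Longrightarrow> aff_apply a v \<noteq> 0"
  using pos_on_C[of a v] pos_on_C[of "-a" v] pos_minus[of a] by (auto simp: aff_apply_minus)

lemma Sig_nonzero_WC: "a \<in> Sig \<Longrightarrow> v \<in> C \<Longrightarrow> w \<in> W \<Longrightarrow> aff_apply a (w v) \<noteq> 0"
  using W_Sig[of w a] Sig_nonzero_C by metis

lemma closure_C: "closure C = {v. \<forall>j\<in>Del. aff_apply j v \<ge> 0}"
proof
  have "{v. \<forall>j\<in>Del. aff_apply j v \<ge> 0} = (\<Inter>j\<in>Del. {v. 0 \<le> aff_apply j v})" by auto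
  also have "closed \<dots>"
    by (intro closed_INT ballI closed_Collect_le continuous_aff_apply continuous_intros)
  finally have "closed {v. \<forall>j\<in>Del. aff_apply j v \<ge> 0}" .
  then show "closure C \<subseteq> {v. \<forall>j\<in>Del. aff_apply j v \<ge> 0}"
    by (rule closure_minimal[rotated]) (auto simp: C_iff less_imp_le)
next
  show "{v. \<forall>j\<in>Del. aff_apply j v \<ge> 0} \<subseteq> closure C"
  proof
    fix v assume v: "v \<in> {v. \<forall>j\<in>Del. aff_apply j v \<ge> 0}"
    \<comment> \<open>Points on the segment from v to the interior point \<open>x0\<close>, other
      than v, satisfy all the inequalities strictly.\<close>
    let ?f = "\<lambda>n. (1 - inverse (real (Suc n))) *\<^sub>R v + inverse (real (Suc n)) *\<^sub>R x0"
    have "?f n \<in> C" for n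
    proof -
      have "(1 - inverse (real (Suc n))) * aff_apply j v + inverse (real (Suc n)) * aff_apply j x0 > 0"
        if "j \<in> Del" for j
        using v that t0(1) t0(2)[OF that] by (intro add_nonneg_pos mult_nonneg_nonneg mult_pos_pos) (auto simp: field_simps)
      then show ?thesis unfolding C_iff by (subst aff_apply_convex_comb) auto
    qed
    moreover have "?f \<longlonglongrightarrow> (1 - 0) *\<^sub>R v + 0 *\<^sub>R x0"
      by (intro tendsto_intros LIMSEQ_inverse_real_of_nat)
    ultimately show "v \<in> closure C" unfolding closure_sequential by (intro exI[of _ ?f]) simp
  qed
qed

abbreviation "S \<equiv> closure C"

lemma S_iff: "v \<in> S \<longleftrightarrow> (\<forall>j\<in>Del. aff_apply j v \<ge> 0)"
  by (simp add: closure_C)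

lemma C_S: "v \<in> C \<Longrightarrow> v \<in> S" using closure_subset by auto

lemma pos_on_S: "pos a \<Longrightarrow> v \<in> S \<Longrightarrow> aff_apply a v \<ge> 0"
  using nonneg_comb_Del_nonneg[of a v] by (simp add: pos_iff S_iff)

lemma open_C: "open C"
proof -
  have "C = (\<Inter>j\<in>Del. {v. aff_apply j v > 0})" by (auto simp: C_iff)
  also have "open \<dots>" by (intro open_INT finite_Del ballI open_Collect_less continuous_aff_apply continuous_intros)
  finally show ?thesis .
qed

lemma convex_C: "convex C"
proof (rule convexI)
  fix x y and u v :: real
  assume a: "x \<in> C" "y \<in> C" "0 \<le> u" "0 \<le> v" "u + v = 1"
  have "u * aff_apply j x + v * aff_apply j y > 0" if "j \<in> Del" for j
  proof (cases "u = 0")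
    case False
    then show ?thesis using a that by (intro add_pos_nonneg mult_pos_pos mult_nonneg_nonneg) (auto simp: C_iff less_imp_le)
  qed (use a that in \<open>auto simp: C_iff\<close>)
  then show "u *\<^sub>R x + v *\<^sub>R y \<in> C" using a(5) by (simp add: C_iff aff_apply_convex_comb)
qed

text \<open>On the closed alcove each simple root satisfies 0 \<le> b \<le> \<phi> \<le> 1, because
  \<phi> - b is a nonnegative combination. The simple roots span the dual, so all coordinates are
  bounded.\<close>

lemma bounded_S: "bounded S"
proof -
  have b1: "\<bar>app b v\<bar> \<le> 1" if "v \<in> S" "b \<in> B" for b v
  proof -
    have nn: "app b' v \<ge> 0" if "b' \<in> B" for b'
      using \<open>v \<in> S\<close>[unfolded S_iff, rule_format, of "(b', 0)"] that by (simp add: Del_cases aff_apply_def)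
    have "app (\<phi> - b) v \<ge> 0"
      by (rule nonneg_comb_apply_nonneg[OF phi_highest[OF subsetD[OF B_R that(2)]] nn])
    moreover have "app \<phi> v \<le> 1"
      using \<open>v \<in> S\<close>[unfolded S_iff, rule_format, of "(- \<phi>, 1)"] by (simp add: Del_cases aff_apply_def blinfun.minus_left)
    ultimately show ?thesis using nn[OF that(2)] by (simp add: blinfun.diff_left)
  qed
  have ex: "\<exists>K. \<forall>v\<in>S. \<bar>v \<bullet> e\<bar> \<le> K" for e
  proof -
    have "blinfun_inner_left e \<in> span B" by (simp add: span_B)
    then obtain u where u: "blinfun_inner_left e = (\<Sum>b\<in>B. u b *\<^sub>R b)"
      by (auto simp: span_finite[OF finite_B])
    have "\<bar>v \<bullet> e\<bar> \<le> (\<Sum>b\<in>B. \<bar>u b\<bar>)" if "v \<in> S" for v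
    proof -
      have "v \<bullet> e = app (\<Sum>b\<in>B. u b *\<^sub>R b) v" by (simp add: blinfun_inner_left.rep_eq flip: u)
      also have "\<bar>\<dots>\<bar> \<le> (\<Sum>b\<in>B. \<bar>u b * app b v\<bar>)"
        by (simp add: blinfun.sum_left blinfun.scaleR_left)
      also have "\<dots> \<le> (\<Sum>b\<in>B. \<bar>u b\<bar>)"
        using b1[OF that] by (intro sum_mono) (simp add: abs_mult mult_left_le)
      finally show ?thesis .
    qed
    then show ?thesis by blast
  qed
  then obtain K where K: "\<And>e v. v \<in> S \<Longrightarrow> \<bar>v \<bullet> e\<bar> \<le> K e" by metis
  show ?thesis
  proof (rule boundedI)
    fix v assume "v \<in> S"
    have "norm v \<le> (\<Sum>e\<in>Basis. \<bar>v \<bullet> e\<bar>)" by (rule norm_le_l1)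
    also have "\<dots> \<le> (\<Sum>e\<in>Basis. K e)" using K \<open>v \<in> S\<close> by (intro sum_mono) auto
    finally show "norm v \<le> (\<Sum>e\<in>Basis. K e)" .
  qed
qed

lemma compact_S: "compact S" using bounded_S by (simp add: compact_eq_bounded_closed)

section \<open>Separating hyperplanes, the sign and the exchange condition\<close>

definition neg_count :: "'a \<Rightarrow> nat" where "neg_count v = card {a. pos a \<and> aff_apply a v < 0}"

lemma finite_neg: "finite {a. pos a \<and> aff_apply a v < 0}"
proof -
  \<comment> \<open>If a is positive at \<open>x0\<close> and negative at v, its constant term is
    squeezed between two bounds that M dominates for all gradients at once.\<close>
  define M where "M = (\<Sum>\<alpha>\<in>R. \<bar>app \<alpha> x0\<bar> + \<bar>app \<alpha> v\<bar>)"
  have "{a. pos a \<and> aff_apply a v < 0} \<subseteq> (\<lambda>(\<alpha>, k). (\<alpha>, of_int k)) ` (R \<times> {- \<lceil>M\<rceil>..\<lceil>M\<rceil>})"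
  proof
    fix a assume a: "a \<in> {a. pos a \<and> aff_apply a v < 0}"
    then obtain \<alpha> k where k: "a = (\<alpha>, of_int k)" "\<alpha> \<in> R" by (auto simp: pos_def aff_roots_def)
    have "\<bar>app \<alpha> x0\<bar> + \<bar>app \<alpha> v\<bar> \<le> M" unfolding M_def
      by (rule member_le_sum[OF k(2) _ finite_R]) auto
    moreover have "app \<alpha> x0 + of_int k > 0" "app \<alpha> v + of_int k < 0"
      using a by (auto simp: pos_def aff_apply_def k)
    ultimately have "\<bar>of_int k\<bar> \<le> M" by linarith
    then have "k \<in> {- \<lceil>M\<rceil>..\<lceil>M\<rceil>}" by simp linarith
    then show "a \<in> (\<lambda>(\<alpha>, k). (\<alpha>, of_int k)) ` (R \<times> {- \<lceil>M\<rceil>..\<lceil>M\<rceil>})"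
      using k by auto
  qed
  then show ?thesis by (rule finite_subset) (simp add: finite_R)
qed

text \<open>By \<open>pos_act\<close> the reflection permutes the positive roots other than j, so
  exactly the root j leaves the set that is counted.\<close>

lemma neg_count_refl:
  assumes j: "j \<in> Del" "aff_apply j v < 0" shows "neg_count v = Suc (neg_count (aff_refl j v))"
proof -
  let ?A = "\<lambda>v. {a. pos a \<and> aff_apply a v < 0}"
  have nz: "fst j \<noteq> 0" by (rule fst_Del[OF j(1)])
  have inj: "inj_on (act j) X" for X by (rule inj_on_inverseI[of _ "act j"]) (simp add: act_involution nz)
  have jj: "aff_apply j (aff_refl j v) = - aff_apply j v" by (simp add: aff_apply_refl_self nz)
  have "?A (aff_refl j v) = act j ` (?A v - {j})"
  proof (intro equalityI subsetI)
    fix a assume a: "a \<in> ?A (aff_refl j v)"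
    then have aj: "a \<noteq> j" using jj j by auto
    have "act j a \<noteq> j"
    proof
      assume "act j a = j"
      then have "a = act j j" using act_involution[OF nz, of a] by simp
      then have "a = - j" by (simp add: act_self nz)
      then show False using a Del_pos[OF j(1)] pos_minus[of j] Del_Sig[OF j(1)] by simp
    qed
    then have "act j a \<in> ?A v - {j}" using a aj pos_act[OF j(1)] by (simp add: aff_apply_act)
    then show "a \<in> act j ` (?A v - {j})" by (rule rev_image_eqI) (simp add: act_involution nz)
  next
    fix a assume "a \<in> act j ` (?A v - {j})"
    then obtain b where "pos b" "aff_apply b v < 0" "b \<noteq> j" "a = act j b" by auto
    then show "a \<in> ?A (aff_refl j v)" using pos_act[OF j(1)]
      by (simp add: aff_apply_act aff_refl_involution nz)
  qed
  then have "neg_count (aff_refl j v) = card (?A v - {j})" by (simp add: neg_count_def card_image[OF inj])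
  moreover have "j \<in> ?A v" using j Del_pos by simp
  ultimately show ?thesis using card_Suc_Diff1[OF finite_neg[of v], of j] by (simp add: neg_count_def)
qed

lemma neg_count_parity: "j \<in> Del \<Longrightarrow> aff_apply j v \<noteq> 0 \<Longrightarrow> even (neg_count (aff_refl j v)) \<longleftrightarrow> odd (neg_count v)"
  using neg_count_refl[of j v] neg_count_refl[of j "aff_refl j v"] fst_Del[of j]
  by (cases "aff_apply j v < 0") (auto simp: aff_apply_refl_self aff_refl_involution)

text \<open>Reflecting in a violated wall lowers \<open>neg_count\<close>, so the process stops
  inside the closed alcove.\<close>

lemma exists_W_S: "\<exists>w\<in>W. w v \<in> S"
proof (induction "neg_count v" arbitrary: v rule: less_induct)
  case less
  show ?case
  proof (cases "v \<in> S")
    case True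
    then show ?thesis by (intro bexI[OF _ W_id]) simp
  next
    case False
    then obtain j where j: "j \<in> Del" "aff_apply j v < 0" by (force simp: S_iff)
    then obtain w where "w \<in> W" "w (aff_refl j v) \<in> S" using less[of "aff_refl j v"] neg_count_refl[OF j] by auto
    then show ?thesis using j by (intro bexI[of _ "w \<circ> aff_refl j"] W_comp aff_refl_W Del_Sig) auto
  qed
qed

lemma neg_count_C: "v \<in> C \<Longrightarrow> neg_count v = 0"
proof -
  assume "v \<in> C"
  then have "{a. pos a \<and> aff_apply a v < 0} = {}" using pos_on_C by (auto dest: less_asym)
  then show "neg_count v = 0" by (simp only: neg_count_def card.empty)
qed

lemma neg_count_word: "set js \<subseteq> Del \<Longrightarrow> v \<in> C \<Longrightarrow> even (neg_count (sw js v)) \<longleftrightarrow> even (length js)"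
proof (induction js)
  case (Cons j js)
  then show ?case using neg_count_parity[of j "sw js v"] Sig_nonzero_WC[OF Del_Sig _ sw_W, of j v js] by auto
qed (simp add: neg_count_C)

text \<open>
  The sign is multiplicative because its value at \<open>w\<close> is the parity of the number of hyperplanes
  separating \<open>C\<^sub>+\<close> and \<open>w C\<^sub>+\<close>, which every simple reflection changes by one.
\<close>

definition eps :: "('a \<Rightarrow> 'a) \<Rightarrow> complex" where "eps w = (- 1) ^ len B \<phi> w"

lemma len_word:
  assumes "w \<in> W" obtains js where "set js \<subseteq> Del" "length js = len B \<phi> w" "sw js = w"
proof -
  obtain js where js: "set js \<subseteq> Del" "w = sw js" using W_simple[OF assms] by blast
  have "\<exists>k. \<exists>ws\<in>lists (aff_refl ` Del). length ws = k \<and> word_prod ws = w"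
    using js by (intro exI[of _ "length js"] bexI[of _ "map aff_refl js"]) (auto simp: sw_def lists_eq_set)
  from LeastI_ex[OF this] obtain ws where ws: "ws \<in> lists (aff_refl ` Del)" "length ws = len B \<phi> w" "word_prod ws = w"
    unfolding len_def by blast
  have "\<exists>js. set js \<subseteq> Del \<and> ws = map aff_refl js" using ws(1)
  proof (induction ws)
    case (Cons f ws)
    then obtain js j where "set js \<subseteq> Del" "ws = map aff_refl js" "j \<in> Del" "f = aff_refl j" by auto
    then show ?case by (intro exI[of _ "j # js"]) simp
  qed simp
  then show ?thesis using that ws by (auto simp: sw_def)
qed

lemma eps_eq_neg_count: "w \<in> W \<Longrightarrow> v \<in> C \<Longrightarrow> eps w = (if even (neg_count (w v)) then 1 else - 1)"
  using len_word[of w] neg_count_word[of _ v] unfolding eps_def by (metis minus_one_power_iff)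

lemma eps_sw: "set js \<subseteq> Del \<Longrightarrow> eps (sw js) = (- 1) ^ length js"
  using eps_eq_neg_count[OF sw_W x0_C] neg_count_word[OF _ x0_C, of js] by (simp add: minus_one_power_iff)

lemma eps_id [simp]: "eps id = 1" "eps (\<lambda>x. x) = 1"
  using eps_sw[of "[]"] by (auto simp: id_def)

lemma eps_comp: 
  assumes "v \<in> W" "w \<in> W" shows "eps (v \<circ> w) = eps v * eps w"
proof -
  obtain js us where "set js \<subseteq> Del" "v = sw js" "set us \<subseteq> Del" "w = sw us"
    using W_simple assms by metis
  moreover from this have "eps (sw (js @ us)) = (- 1) ^ length (js @ us)" by (intro eps_sw) auto
  ultimately show ?thesis by (simp add: eps_sw power_add)
qed

lemma eps_refl: "a \<in> Sig \<Longrightarrow> eps (aff_refl a) = - 1"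
  using aff_refl_simple_word[of a] eps_sw by auto

lemma eps_square: "eps w * eps w = 1"
  by (simp add: eps_def flip: power_add)

lemma eps_inv: "w \<in> W \<Longrightarrow> eps (inv w) = eps w"
proof -
  assume w: "w \<in> W"
  have "eps (inv w \<circ> w) = eps (inv w) * eps w" using w W_inv by (intro eps_comp) auto
  moreover have "inv w \<circ> w = id" using W_inv_apply[OF w] by (simp add: fun_eq_iff)
  ultimately have "eps (inv w) * (eps w * eps w) = eps w" by simp
  then show ?thesis by (simp add: eps_square)
qed

text \<open>Drop letters from the end of the word until j is positive at the image of
  \<open>x0\<close>. The pullback of j along what remains is a positive root that the last dropped
  letter i makes negative, hence is i itself by \<open>pos_act\<close>; the reflection in i then
  cancels against that in j.\<close>

lemma exchange:
  assumes "set js \<subseteq> Del" "j \<in> Del" "aff_apply j (sw js x0) < 0"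
  shows "\<exists>ks. set ks \<subseteq> Del \<and> Suc (length ks) = length js \<and> aff_refl j \<circ> sw js = sw ks"
  using assms(1,3)
proof (induction js rule: rev_induct)
  case Nil
  then show ?case using t0(1) t0(2)[of j] assms(2) by simp
next
  case (snoc i js)
  then have i: "i \<in> Del" and js: "set js \<subseteq> Del" by auto
  show ?case
  proof (cases "aff_apply j (sw js x0) < 0")
    case True
    then obtain ks where "set ks \<subseteq> Del" "Suc (length ks) = length js" "aff_refl j \<circ> sw js = sw ks"
      using snoc.IH[OF js True] by blast
    then show ?thesis using i by (intro exI[of _ "ks @ [i]"]) (simp add: fun_eq_iff)
  next
    case False
    then have p: "aff_apply j (sw js x0) > 0"
      using Sig_nonzero_WC[OF Del_Sig[OF assms(2)] x0_C sw_W[OF js]] by linarith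
    obtain b where b: "b \<in> Sig" "\<forall>v. aff_apply b v = aff_apply j (sw js v)"
      "sw js \<circ> aff_refl b = aff_refl j \<circ> sw js"
      using W_Sig[OF sw_W[OF js] Del_Sig[OF assms(2)]] by blast
    have "pos b" using b p by (simp add: pos_def)
    moreover have "\<not> pos (act i b)" using snoc.prems b(2) by (simp add: pos_def aff_apply_act)
    ultimately have "b = i" using pos_act[OF i] by blast
    then have "aff_refl j (sw js (aff_refl i v)) = sw js v" for v
      using fun_cong[OF b(3), of "aff_refl i v"] by (simp add: aff_refl_involution fst_Del i)
    then show ?thesis using js by (intro exI[of _ js]) (simp add: fun_eq_iff)
  qed
qed

text \<open>Either the first letter shortens the rest of the word by exchange, or the pullback b of
  its root is positive. In the latter case b(v) is both nonnegative and nonpositive, so the first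
  letter fixes the image of v, which cannot happen for v in the open alcove.\<close>

lemma S_fundamental_word:
  "set js \<subseteq> Del \<Longrightarrow> v \<in> S \<Longrightarrow> sw js v \<in> S \<Longrightarrow> sw js v = v \<and> (v \<in> C \<longrightarrow> sw js = id)"
proof (induction "length js" arbitrary: js rule: less_induct)
  case less
  show ?case
  proof (cases js)
    case (Cons j ks)
    then have j: "j \<in> Del" and ks: "set ks \<subseteq> Del" using less.prems by auto
    show ?thesis
    proof (cases "aff_apply j (sw ks x0) < 0")
      case True
      then obtain us where "set us \<subseteq> Del" "Suc (length us) = length ks" "aff_refl j \<circ> sw ks = sw us"
        using exchange[OF ks j] by blast
      then show ?thesis using less.hyps[of us] less.prems Cons by simp
    next
      case False
      then have p: "aff_apply j (sw ks x0) > 0"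
        using Sig_nonzero_WC[OF Del_Sig[OF j] x0_C sw_W[OF ks]] by linarith
      obtain b where b: "b \<in> Sig" "\<forall>v. aff_apply b v = aff_apply j (sw ks v)"
        using W_Sig[OF sw_W[OF ks] Del_Sig[OF j]] by blast
      have pb: "pos b" using b p by (simp add: pos_def)
      have n: "aff_apply j (sw js v) = - aff_apply b v"
        using b(2) Cons by (simp add: aff_apply_refl_self fst_Del j)
      have ge: "aff_apply j (sw js v) \<ge> 0" using less.prems j by (simp add: S_iff)
      have "aff_apply b v \<ge> 0" by (rule pos_on_S[OF pb less.prems(2)])
      then have z: "aff_apply b v = 0" using n ge by linarith
      then have "v \<notin> C" using pos_on_C[OF pb] by force
      moreover have "sw js v = sw ks v" using Cons z b(2) aff_refl_fixed_iff[OF fst_Del[OF j]] by simp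
      ultimately show ?thesis using less.hyps[of ks] ks less.prems Cons by simp
    qed
  qed simp
qed

lemma S_fundamental: "w \<in> W \<Longrightarrow> v \<in> S \<Longrightarrow> w v \<in> S \<Longrightarrow> w v = v"
  using W_simple[of w] S_fundamental_word by metis

lemma stabilizer_trivial: "w \<in> W \<Longrightarrow> v \<in> C \<Longrightarrow> w v = v \<Longrightarrow> w = id"
  using W_simple[of w] S_fundamental_word[OF _ C_S] C_S by metis

end

section \<open>The finite Weyl group and the weight lattice\<close>

context root_data begin

lemma W0_induct [consumes 1, case_names id refl]:
  assumes "w \<in> W0" "P id" "\<And>\<alpha> w. \<alpha> \<in> R \<Longrightarrow> w \<in> W0 \<Longrightarrow> P w \<Longrightarrow> P (aff_refl (\<alpha>, 0) \<circ> w)"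
  shows "P w"
proof -
  obtain ws where ws: "ws \<in> lists ((\<lambda>\<alpha>. aff_refl (\<alpha>, 0)) ` R)" "w = word_prod ws"
    using assms(1) by (auto simp: weyl_def)
  have "word_prod ws \<in> W0 \<and> P (word_prod ws)" using ws(1)
  proof (induction ws)
    case Nil
    have "word_prod [] \<in> W0" unfolding weyl_def by (rule imageI) simp
    then show ?case by (simp only: word_prod_Nil assms(2) simp_thms)
  next
    case (Cons f ws)
    obtain \<alpha> where a: "\<alpha> \<in> R" "f = aff_refl (\<alpha>, 0)" using Cons.hyps by auto
    have "word_prod (f # ws) \<in> W0" unfolding weyl_def using Cons.hyps by (intro imageI lists.Cons)
    then show ?case unfolding word_prod_Cons a(2)
      using Cons.IH a(1) assms(3) by blast
  qed
  then show ?thesis using ws by simp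
qed

lemma W0_id: "id \<in> W0"
proof -
  have "word_prod [] \<in> W0" unfolding weyl_def by (rule imageI) simp
  then show ?thesis by (simp only: word_prod_Nil)
qed

lemma W0_comp: "v \<in> W0 \<Longrightarrow> w \<in> W0 \<Longrightarrow> v \<circ> w \<in> W0"
proof -
  assume "v \<in> W0" "w \<in> W0"
  then obtain vs ws where "vs \<in> lists ((\<lambda>\<alpha>. aff_refl (\<alpha>, 0)) ` R)" "ws \<in> lists ((\<lambda>\<alpha>. aff_refl (\<alpha>, 0)) ` R)"
    "v = word_prod vs" "w = word_prod ws" unfolding weyl_def by blast
  then show "v \<circ> w \<in> W0" unfolding weyl_def
    by (intro image_eqI[of _ _ "vs @ ws"]) (simp_all only: word_prod_append append_in_lists_conv simp_thms)
qed

lemma refl_W0: "\<alpha> \<in> R \<Longrightarrow> aff_refl (\<alpha>, 0) \<in> W0"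
proof -
  assume "\<alpha> \<in> R"
  then have "word_prod [aff_refl (\<alpha>, 0)] \<in> W0" unfolding weyl_def by (intro imageI) auto
  then show ?thesis by (simp only: word_prod_Cons word_prod_Nil comp_id)
qed

lemma W0_W: "w \<in> W0 \<Longrightarrow> w \<in> W"
proof (induction rule: W0_induct)
  case id
  show ?case by (rule W_id)
next
  case (refl \<alpha> w)
  then show ?case by (intro W_comp aff_refl_W) (simp_all add: Sig_iff)
qed

lemma W0_inv: "w \<in> W0 \<Longrightarrow> inv w \<in> W0"
proof (induction rule: W0_induct)
  case id
  show ?case by (simp only: inv_id W0_id)
next
  case (refl \<alpha> w)
  have s: "(\<alpha>, 0) \<in> Sig" using refl by (simp add: Sig_iff)
  have b: "bij w" "bij (aff_refl (\<alpha>, 0))" using W_inv(1) W0_W refl refl_W0 by auto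
  have "inv (aff_refl (\<alpha>, 0)) = aff_refl (\<alpha>, 0)"
    by (rule inv_unique_comp) (rule aff_refl_comp_self[OF s])+
  then have "inv (aff_refl (\<alpha>, 0) \<circ> w) = inv w \<circ> aff_refl (\<alpha>, 0)"
    using o_inv_distrib[OF b(2,1)] by simp
  then show ?case using W0_comp refl refl_W0 by metis
qed

lemmas W0_inv_apply = W_inv_apply[OF W0_W]

lemma W0_linear: "w \<in> W0 \<Longrightarrow> linear w"
proof (induction rule: W0_induct)
  case id
  show ?case by (rule linear_id)
next
  case (refl \<alpha> w)
  have "linear (aff_refl (\<alpha>, 0))"
    by (rule linearI) (simp_all add: aff_refl_def aff_apply_def blinfun.add_right blinfun.scaleR_right algebra_simps)
  then show ?case using refl by (intro linear_compose)
qed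

lemma W0_isometry: "w \<in> W0 \<Longrightarrow> norm (w v) = norm v"
proof (induction rule: W0_induct)
  case (refl \<alpha> w)
  have "fst (\<alpha>, 0 :: real) \<noteq> 0" using refl zero_notin_R by auto
  from aff_refl_isometry[OF this, of "w v" 0] show ?case
    using refl by (simp add: aff_refl_def[of _ 0] aff_apply_def)
qed simp

lemma W0_orthogonal: "w \<in> W0 \<Longrightarrow> orthogonal_transformation w"
  by (simp add: orthogonal_transformation W0_linear W0_isometry)

lemma W0_inner: "w \<in> W0 \<Longrightarrow> w x \<bullet> w y = x \<bullet> y"
  using W0_orthogonal by (simp add: orthogonal_transformation_def)

lemma W0_0: "w \<in> W0 \<Longrightarrow> w 0 = 0"
  by (simp add: W0_linear linear_0)

lemma R_separates: "(\<And>\<alpha>. \<alpha> \<in> R \<Longrightarrow> app \<alpha> x = 0) \<Longrightarrow> x = 0"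
proof -
  assume *: "\<And>\<alpha>. \<alpha> \<in> R \<Longrightarrow> app \<alpha> x = 0"
  have "subspace {\<xi> :: 'a dual. app \<xi> x = 0}"
    by (rule subspaceI) (auto simp: blinfun.add_left blinfun.scaleR_left)
  then have "span R \<subseteq> {\<xi> :: 'a dual. app \<xi> x = 0}" using * by (intro span_minimal) auto
  then have "app (blinfun_inner_left x) x = 0" using span_R by blast
  then show "x = 0" by (simp add: blinfun_inner_left.rep_eq)
qed

lemma W0_root:
  assumes "w \<in> W0" "\<alpha> \<in> R"
  shows "\<exists>\<beta>\<in>R. (\<forall>v. app \<beta> v = app \<alpha> (w v)) \<and> w (coroot \<beta>) = coroot \<alpha>"
proof -
  have "(\<alpha>, 0) \<in> Sig" using assms by (simp add: Sig_iff)
  from W_Sig[OF W0_W[OF assms(1)] this] obtain b where b: "b \<in> Sig"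
    "\<And>v. aff_apply b v = aff_apply (\<alpha>, 0) (w v)" "w \<circ> aff_refl b = aff_refl (\<alpha>, 0) \<circ> w" by auto
  have sb: "snd b = 0" using b(2)[of 0] by (simp add: aff_apply_def W0_0 assms)
  have fb: "fst b \<in> R" using b(1) by (simp add: Sig_iff)
  have ap: "app (fst b) v = app \<alpha> (w v)" for v
    using b(2)[of v] sb by (simp add: aff_apply_def)
  let ?c = "coroot (fst b)"
  have two: "app (fst b) ?c = 2" using fb zero_notin_R by (intro apply_coroot_self) auto
  note lin = W0_linear[OF assms(1)]
  \<comment> \<open>Evaluated at the coroot of b, which the reflection in b negates, the conjugation
    identity determines the image of that coroot.\<close>
  have "w (aff_refl b ?c) = aff_refl (\<alpha>, 0) (w ?c)" using fun_cong[OF b(3)] by simp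
  then have "w ?c - 2 *\<^sub>R w ?c = w ?c - 2 *\<^sub>R coroot \<alpha>"
    using two ap[of ?c] by (simp add: aff_refl_def aff_apply_def sb linear_diff[OF lin] linear_scale[OF lin])
  then have "w ?c = coroot \<alpha>" by simp
  then show ?thesis using fb ap by blast
qed

lemma W0_coroot:
  assumes "w \<in> W0" "\<beta> \<in> R" shows "\<exists>\<alpha>\<in>R. w (coroot \<beta>) = coroot \<alpha>"
proof -
  obtain \<alpha> where a: "\<alpha> \<in> R" "inv w (coroot \<alpha>) = coroot \<beta>" using W0_root[OF W0_inv[OF assms(1)] assms(2)] by blast
  then have "w (coroot \<beta>) = coroot \<alpha>" using W0_inv_apply(2)[OF assms(1), of "coroot \<alpha>"] by simp
  then show ?thesis using a(1) by blast
qed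

text \<open>The roots separate points, so w is determined by the relation it induces on the finite
  set of roots.\<close>

lemma finite_W0: "finite W0"
proof (rule finite_imageD)
  let ?f = "\<lambda>w. {p \<in> R \<times> R. \<forall>v. app (snd p) v = app (fst p) (w v)}"
  show "finite (?f ` W0)" by (rule finite_subset[of _ "Pow (R \<times> R)"]) (auto simp: finite_R)
  show "inj_on ?f W0"
  proof (rule inj_onI)
    fix w w' assume w: "w \<in> W0" "w' \<in> W0" "?f w = ?f w'"
    show "w = w'"
    proof
      fix v
      have "w v - w' v = 0"
      proof (rule R_separates)
        fix \<alpha> assume a: "\<alpha> \<in> R"
        then obtain \<beta> where "\<beta> \<in> R" "\<forall>v. app \<beta> v = app \<alpha> (w v)" using W0_root w by metis
        then have "(\<alpha>, \<beta>) \<in> ?f w" "app \<alpha> (w v) = app \<beta> v" using a by auto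
        moreover from this have "(\<alpha>, \<beta>) \<in> ?f w'" using w(3) by simp
        ultimately show "app \<alpha> (w v - w' v) = 0" by (simp add: blinfun.diff_right)
      qed
      then show "w v = w' v" by simp
    qed
  qed
qed

lemma bij_betw_W0_inv: "bij_betw inv W0 W0"
  by (rule bij_betw_byWitness[of _ inv]) (auto simp: W0_inv W0_W W_inv inv_inv_eq)

lemma bij_betw_W0_comp_right: "u \<in> W0 \<Longrightarrow> bij_betw (\<lambda>w. w \<circ> u) W0 W0"
  by (rule bij_betw_byWitness[of _ "\<lambda>w. w \<circ> inv u"]) (auto simp: W0_inv W0_comp fun_eq_iff W0_inv_apply)

lemma bij_betw_W0_comp_left: "u \<in> W0 \<Longrightarrow> bij_betw (\<lambda>w. u \<circ> w) W0 W0"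
  by (rule bij_betw_byWitness[of _ "\<lambda>w. inv u \<circ> w"]) (auto simp: W0_inv W0_comp fun_eq_iff W0_inv_apply)

section \<open>The coroot lattice, the weight lattice and their duality\<close>

definition Q :: "'a set" where
  "Q = {v. \<exists>n :: 'a dual \<Rightarrow> int. v = (\<Sum>b\<in>B. of_int (n b) *\<^sub>R coroot b)}"

lemma Q_I: "v = (\<Sum>b\<in>B. of_int (n b) *\<^sub>R coroot b) \<Longrightarrow> v \<in> Q"
  unfolding Q_def mem_Collect_eq by (rule exI[of _ n])

lemma Q_base: assumes "b \<in> B" shows "coroot b \<in> Q"
proof (rule Q_I[of _ "\<lambda>b'. if b' = b then 1 else 0"])
  have "(\<Sum>b'\<in>B. of_int (if b' = b then 1 else 0) *\<^sub>R coroot b') = (\<Sum>b'\<in>B. if b' = b then coroot b' else 0)"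
    by (rule sum.cong) auto
  then show "coroot b = (\<Sum>b'\<in>B. of_int (if b' = b then 1 else 0) *\<^sub>R coroot b')"
    using assms finite_B by simp
qed

lemma Q_add_scale: assumes "u \<in> Q" "v \<in> Q" shows "u + of_int k *\<^sub>R v \<in> Q"
proof -
  obtain m n where u: "u = (\<Sum>b\<in>B. of_int (m b) *\<^sub>R coroot b)" and v: "v = (\<Sum>b\<in>B. of_int (n b) *\<^sub>R coroot b)"
    using assms unfolding Q_def by blast
  show ?thesis by (rule Q_I[of _ "\<lambda>b. m b + k * n b"])
    (simp add: u v scaleR_sum_right scaleR_left_distrib sum.distrib)
qed

text \<open>The descent used for reflections, restricted to simple roots in B so that the constant
  term stays 0. Equivariance writes the coroot as that of a lower root plus an integral multiple of
  a simple coroot.\<close>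

lemma coroot_Q_pos:
  "pos (\<alpha>, 0) \<Longrightarrow> \<alpha> \<in> nonneg_comb B \<Longrightarrow> aff_apply (\<alpha>, 0) x0 = real n * t0 \<Longrightarrow> coroot \<alpha> \<in> Q"
proof (induction n arbitrary: \<alpha> rule: less_induct)
  case (less n)
  show ?case
  proof (cases "\<alpha> \<in> B")
    case False
    obtain c where c: "\<alpha> = (\<Sum>b\<in>B. real (c b) *\<^sub>R b)"
      using less.prems(2) by (auto simp: nonneg_comb_def)
    have r: "riesz \<alpha> = (\<Sum>b\<in>B. real (c b) *\<^sub>R riesz b)"
      by (subst c) (simp add: riesz_sum riesz_scaleR)
    have R: "\<alpha> \<in> R" using less.prems by (simp add: pos_def Sig_iff)
    then have "riesz \<alpha> \<bullet> riesz \<alpha> > 0" using zero_notin_R by (auto simp: riesz_eq_0_iff)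
    from exists_Del_inner_pos[OF this r] obtain b where b: "b \<in> B" "riesz \<alpha> \<bullet> riesz b > 0" by blast
    let ?k = "app \<alpha> (coroot b)" and ?\<beta> = "\<alpha> - app \<alpha> (coroot b) *\<^sub>R b"
    have bD: "(b, 0) \<in> Del" using b(1) by (simp add: Del_cases)
    have ne: "(\<alpha>, 0 :: real) \<noteq> (b, 0)" using False b(1) by auto
    have act: "act (b, 0) (\<alpha>, 0) = (?\<beta>, 0)" by (simp add: act_def)
    obtain m where m: "m < n" "pos (?\<beta>, 0)" "aff_apply (?\<beta>, 0) x0 = real m * t0"
      using descend[OF less.prems(1,3) bD ne] b(2) by (auto simp: act)
    have bR: "?\<beta> \<in> R" using m(2) by (simp add: pos_def Sig_iff)
    have "?\<beta> \<in> nonneg_comb B"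
    proof (rule ccontr)
      assume "?\<beta> \<notin> nonneg_comb B"
      then have "- ?\<beta> \<in> nonneg_comb B" using R_cases[OF bR] by blast
      from lift_nonneg_comb[OF this] have "pos (- (?\<beta>, 0))" using R_minus[OF bR] by (simp add: pos_iff Sig_iff)
      then show False using m(2) pos_minus[of "(?\<beta>, 0)"] bR by (simp add: Sig_iff)
    qed
    from less.IH[OF m(1,2) this m(3)] have q: "coroot ?\<beta> \<in> Q" .
    have b0: "b \<noteq> 0" using b(1) B_R zero_notin_R by auto
    obtain k where k: "app b (coroot \<alpha>) = of_int k" 
      using R_Ints[OF R, of b] b(1) B_R by (auto elim: Ints_cases)
    have "coroot \<alpha> = coroot ?\<beta> + of_int k *\<^sub>R coroot b"
      using coroot_reflection[OF b0, of \<alpha>] by (simp add: k)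
    then show ?thesis using Q_add_scale[OF q Q_base[OF b(1)]] by simp
  qed (rule Q_base)
qed

lemma coroot_Q: assumes "\<alpha> \<in> R" shows "coroot \<alpha> \<in> Q"
proof -
  have main: "coroot \<alpha> \<in> Q" if "\<alpha> \<in> R" "\<alpha> \<in> nonneg_comb B" for \<alpha>
  proof -
    have p: "pos (\<alpha>, 0)" using that lift_nonneg_comb by (simp add: pos_iff Sig_iff)
    then obtain n where "aff_apply (\<alpha>, 0) x0 = real n * t0" by (rule pos_height)
    then show ?thesis using coroot_Q_pos p that by blast
  qed
  show ?thesis
  proof (cases "\<alpha> \<in> nonneg_comb B")
    case False
    then have "coroot (- \<alpha>) \<in> Q" using main R_cases[OF assms] R_minus[OF assms] by blast
    from Q_add_scale[OF _ this, of 0 "-1"] show ?thesis by (simp add: coroot_minus Q_I[of 0 "\<lambda>_. 0"])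
  qed (use main assms in blast)
qed

lemma translation_W: assumes "q \<in> Q" shows "(\<lambda>v. v + q) \<in> W"
proof -
  obtain n where n: "q = (\<Sum>b\<in>B. of_int (n b) *\<^sub>R coroot b)" using assms unfolding Q_def by blast
  have "(\<lambda>v. v + (\<Sum>b\<in>X. of_int (n b) *\<^sub>R coroot b)) \<in> W" if "finite X" "X \<subseteq> B" for X using that
  proof (induction X)
    case empty
    have "(\<lambda>v :: 'a. v + (\<Sum>b\<in>{}. of_int (n b) *\<^sub>R coroot b)) = id" by (simp add: fun_eq_iff)
    then show ?case by (simp only: W_id)
  next
    case (insert b X)
    \<comment> \<open>Reflections in the parallel hyperplanes b = 0 and b = \<open>n b\<close>
      compose to the translation by \<open>n b\<close> times the coroot.\<close>
    let ?t = "aff_refl (b, of_int (- n b)) \<circ> aff_refl (b, 0)"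
    have b: "b \<in> R" "b \<noteq> 0" using insert B_R zero_notin_R by auto
    have "?t v = v + of_int (n b) *\<^sub>R coroot b" for v
    proof -
      let ?u = "aff_refl (b, 0) v"
      have "?t v = aff_refl (b, 0) ?u + of_int (n b) *\<^sub>R coroot b"
        by (simp add: aff_refl_def aff_apply_def algebra_simps)
      then show ?thesis using b by (simp add: aff_refl_involution)
    qed
    then have "(\<lambda>v. v + (\<Sum>b\<in>insert b X. of_int (n b) *\<^sub>R coroot b))
        = ?t \<circ> (\<lambda>v. v + (\<Sum>b\<in>X. of_int (n b) *\<^sub>R coroot b))"
      using insert by (simp add: fun_eq_iff algebra_simps)
    moreover have "\<dots> \<in> W" using insert b by (intro W_comp aff_refl_W) (simp_all add: Sig_iff)
    ultimately show ?case by simp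
  qed
  from this[OF finite_B subset_refl] show ?thesis by (simp only: n)
qed

abbreviation "P \<equiv> weight_lattice R"

lemma coroots_span: obtains k :: "'a dual \<Rightarrow> real" where "x = (\<Sum>b\<in>B. k b *\<^sub>R coroot b)"
proof -
  have "blinfun_inner_left x \<in> span B" by (simp add: span_B)
  then obtain u where u: "blinfun_inner_left x = (\<Sum>b\<in>B. u b *\<^sub>R b)"
    by (auto simp: span_finite[OF finite_B])
  have "x = riesz (blinfun_inner_left x)"
    by (rule euclidean_eqI) (metis blinfun_eq_riesz blinfun_inner_left.rep_eq inner_commute)
  also have "\<dots> = (\<Sum>b\<in>B. u b *\<^sub>R riesz b)" by (simp add: u riesz_sum riesz_scaleR)
  also have "\<dots> = (\<Sum>b\<in>B. (u b * (riesz b \<bullet> riesz b) / 2) *\<^sub>R coroot b)"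
  proof (rule sum.cong)
    fix b assume "b \<in> B"
    then have "b \<noteq> 0" using B_R zero_notin_R by auto
    then have "riesz b \<bullet> riesz b \<noteq> 0" by (simp add: riesz_eq_0_iff)
    then show "u b *\<^sub>R riesz b = (u b * (riesz b \<bullet> riesz b) / 2) *\<^sub>R coroot b" by (simp add: coroot_eq)
  qed simp
  finally show ?thesis by (rule that)
qed

lemma fundamental_weight:
  assumes "b \<in> B"
  obtains \<omega> where "\<omega> \<in> P" "\<And>k. app \<omega> (\<Sum>c\<in>B. k c *\<^sub>R coroot c) = k b"
proof -
  \<comment> \<open>The factor \<open>(riesz b \<bullet> riesz b) / 2\<close> compensates the
    normalisation of coroots, so that \<omega> is dual to the simple coroots.\<close>
  obtain u where u: "\<And>c. c \<in> B \<Longrightarrow> app c u = (if c = b then (riesz b \<bullet> riesz b) / 2 else 0)"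
    using B_prescribe[of "\<lambda>c. if c = b then (riesz b \<bullet> riesz b) / 2 else 0"] by blast
  define \<omega> where "\<omega> = blinfun_inner_left u"
  have w: "app \<omega> (coroot c) = (if c = b then 1 else 0)" if "c \<in> B" for c
  proof -
    have "c \<noteq> 0" using that B_R zero_notin_R by auto
    then have "riesz c \<bullet> riesz c \<noteq> 0" by (simp add: riesz_eq_0_iff)
    then show ?thesis using u[OF that]
      by (simp add: \<omega>_def blinfun_inner_left.rep_eq coroot_eq blinfun_eq_riesz split: if_splits)
  qed
  have v: "app \<omega> (\<Sum>c\<in>B. k c *\<^sub>R coroot c) = k b" for k
  proof -
    have "app \<omega> (\<Sum>c\<in>B. k c *\<^sub>R coroot c) = (\<Sum>c\<in>B. if c = b then k c else 0)"
      unfolding blinfun.sum_right blinfun.scaleR_right by (rule sum.cong) (auto simp: w)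
    then show ?thesis using assms finite_B by simp
  qed
  have "\<omega> \<in> P"
    unfolding weight_lattice_def
  proof (clarify)
    fix \<alpha> assume "\<alpha> \<in> R"
    from coroot_Q[OF this] obtain n where "coroot \<alpha> = (\<Sum>b\<in>B. of_int (n b) *\<^sub>R coroot b)" unfolding Q_def by blast
    then show "app \<omega> (coroot \<alpha>) \<in> \<int>" by (simp add: v)
  qed
  then show ?thesis using v that by blast
qed

text \<open>The coefficients of x in the simple coroots are its values under the fundamental
  weights.\<close>

lemma P_dual: assumes "\<And>\<xi>. \<xi> \<in> P \<Longrightarrow> app \<xi> x \<in> \<int>" shows "x \<in> Q"
proof -
  obtain k where k: "x = (\<Sum>b\<in>B. k b *\<^sub>R coroot b)" by (rule coroots_span)
  have "\<exists>n. k b = of_int n" if b: "b \<in> B" for b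
  proof -
    obtain \<omega> where "\<omega> \<in> P" "\<And>k. app \<omega> (\<Sum>c\<in>B. k c *\<^sub>R coroot c) = k b"
      using fundamental_weight[OF b] by blast
    then have "k b \<in> \<int>" using assms[of \<omega>] by (simp add: k)
    then show ?thesis by (auto elim: Ints_cases)
  qed
  then obtain n where "\<And>b. b \<in> B \<Longrightarrow> k b = of_int (n b)" by metis
  then show ?thesis unfolding k by (intro Q_I[of _ n] sum.cong) auto
qed

lemma dual_eqI_coroots: 
  assumes "\<And>b. b \<in> B \<Longrightarrow> app \<xi> (coroot b) = app \<eta> (coroot b)"
  shows "\<xi> = \<eta>"
proof (rule blinfun_eqI)
  fix x
  obtain k where k: "x = (\<Sum>b\<in>B. k b *\<^sub>R coroot b)" by (rule coroots_span)
  show "app \<xi> x = app \<eta> x"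
    unfolding k blinfun.sum_right blinfun.scaleR_right by (rule sum.cong) (simp_all add: assms)
qed

text \<open>A weight is determined by its integral values on the simple coroots, and a norm bound
  confines these to a finite box. The floor only converts them to \<open>int\<close>.\<close>

lemma finite_P_bounded: "finite {\<xi> \<in> P. norm \<xi> \<le> r}"
proof (rule finite_imageD)
  let ?f = "\<lambda>\<xi>. \<lambda>b\<in>B. \<lfloor>app \<xi> (coroot b)\<rfloor>"
  define K where "K b = \<lceil>r * norm (coroot b)\<rceil>" for b :: "'a dual"
  have i: "of_int \<lfloor>app \<xi> (coroot b)\<rfloor> = app \<xi> (coroot b)" if "\<xi> \<in> P" "b \<in> B" for \<xi> b
  proof -
    have "app \<xi> (coroot b) \<in> \<int>" using that B_R by (auto simp: weight_lattice_def)
    then show ?thesis by (auto elim!: Ints_cases)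
  qed
  show "finite (?f ` {\<xi> \<in> P. norm \<xi> \<le> r})"
  proof (rule finite_subset)
    show "?f ` {\<xi> \<in> P. norm \<xi> \<le> r} \<subseteq> (\<Pi>\<^sub>E b\<in>B. {- K b..K b})"
    proof (rule image_subsetI, rule restrict_PiE[THEN iffD2], rule Pi_I)
      fix \<xi> :: "'a dual" and b assume x: "\<xi> \<in> {\<xi> \<in> P. norm \<xi> \<le> r}" and b: "b \<in> B"
      have "\<bar>app \<xi> (coroot b)\<bar> \<le> norm \<xi> * norm (coroot b)"
        using norm_blinfun[of \<xi> "coroot b"] by simp
      also have "\<dots> \<le> r * norm (coroot b)" using x by (simp add: mult_right_mono)
      also have "\<dots> \<le> of_int (K b)" by (simp add: K_def)
      finally have "\<bar>app \<xi> (coroot b)\<bar> \<le> of_int (K b)" .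
      then show "\<lfloor>app \<xi> (coroot b)\<rfloor> \<in> {- K b..K b}"
        unfolding atLeastAtMost_iff le_floor_iff floor_le_iff by (auto simp: abs_le_iff)
    qed
    show "finite (\<Pi>\<^sub>E b\<in>B. {- K b..K b})" by (intro finite_PiE finite_B) simp
  qed
  show "inj_on ?f {\<xi> \<in> P. norm \<xi> \<le> r}"
  proof (rule inj_onI, rule dual_eqI_coroots)
    fix \<xi> \<eta> b assume x: "\<xi> \<in> {\<xi> \<in> P. norm \<xi> \<le> r}" "\<eta> \<in> {\<xi> \<in> P. norm \<xi> \<le> r}"
      and e: "?f \<xi> = ?f \<eta>" and b: "b \<in> B"
    have "\<lfloor>app \<xi> (coroot b)\<rfloor> = \<lfloor>app \<eta> (coroot b)\<rfloor>"
      using fun_cong[OF e, of b] b by simp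
    moreover have "of_int \<lfloor>app \<xi> (coroot b)\<rfloor> = app \<xi> (coroot b)"
      "of_int \<lfloor>app \<eta> (coroot b)\<rfloor> = app \<eta> (coroot b)"
      using i x b by blast+
    ultimately show "app \<xi> (coroot b) = app \<eta> (coroot b)" by metis
  qed
qed

text \<open>The vector representing \<xi> is fixed by w. Scaled down it avoids all affine
  hyperplanes, so it can be moved into the open alcove, where stabilizers in \<open>W\<close> are
  trivial.\<close>

lemma regular_stabilizer:
  fixes \<xi> :: "'a dual"
  assumes reg: "\<And>\<alpha>. \<alpha> \<in> R \<Longrightarrow> app \<xi> (coroot \<alpha>) \<noteq> 0"
    and w: "w \<in> W0" "\<And>v. app \<xi> (w v) = app \<xi> v"
  shows "w = id"
proof -
  let ?x = "riesz \<xi>"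
  have wx: "w ?x = ?x"
  proof (rule vector_eq_rdot[THEN iffD1], rule allI)
    fix z
    have "w ?x \<bullet> z = w ?x \<bullet> w (inv w z)" using W0_inv_apply[OF w(1)] by simp
    also have "\<dots> = app \<xi> (inv w z)" by (simp add: W0_inner[OF w(1)] blinfun_eq_riesz)
    also have "\<dots> = ?x \<bullet> z" using w(2)[of "inv w z"] W0_inv_apply[OF w(1)] by (simp add: blinfun_eq_riesz)
    finally show "w ?x \<bullet> z = ?x \<bullet> z" .
  qed
  have nz: "app \<alpha> ?x \<noteq> 0" if "\<alpha> \<in> R" for \<alpha>
    using reg[OF that] unfolding apply_coroot by (auto simp: blinfun_eq_riesz inner_commute)
  \<comment> \<open>After division by M every root has absolute value below 1 at the vector, so
    \<alpha> + k can vanish there only for k = 0, which regularity excludes.\<close>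
  define M where "M = 1 + (\<Sum>\<alpha>\<in>R. \<bar>app \<alpha> ?x\<bar>)"
  have M: "M > 0" unfolding M_def by (simp add: add_pos_nonneg sum_nonneg)
  let ?y = "(1 / M) *\<^sub>R ?x"
  have wy: "w ?y = ?y" using wx by (simp add: linear_scale[OF W0_linear[OF w(1)]])
  have ry: "aff_apply a ?y \<noteq> 0" if aS: "a \<in> Sig" for a
  proof
    assume 0: "aff_apply a ?y = 0"
    obtain \<alpha> k where a: "a = (\<alpha>, of_int k)" "\<alpha> \<in> R" using aS by (auto simp: aff_roots_def)
    have "\<bar>app \<alpha> ?x\<bar> < M" unfolding M_def
      using member_le_sum[OF a(2) _ finite_R, of "\<lambda>\<alpha>. \<bar>app \<alpha> ?x\<bar>"] by simp
    then have "\<bar>app \<alpha> ?y\<bar> < 1" using M by (simp add: blinfun.scaleR_right abs_mult)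
    then have "\<bar>of_int k :: real\<bar> < 1" using 0 by (simp add: a aff_apply_def)
    then have "k = 0" by linarith
    then show False using 0 nz[OF a(2)] M by (simp add: a aff_apply_def blinfun.scaleR_right)
  qed
  obtain u where u: "u \<in> W" "u ?y \<in> S" using exists_W_S by blast
  have uC: "u ?y \<in> C"
    unfolding C_iff
  proof
    fix j assume j: "j \<in> Del"
    obtain b where "b \<in> Sig" "\<forall>v. aff_apply b v = aff_apply j (u v)" using W_Sig[OF u(1) Del_Sig[OF j]] by blast
    then have "aff_apply j (u ?y) \<noteq> 0" using ry by metis
    then show "aff_apply j (u ?y) > 0" using u(2) j by (force simp: S_iff)
  qed
  have c: "u \<circ> w \<circ> inv u = id"
    using uC by (intro stabilizer_trivial[of _ "u ?y"] W_comp W_inv u W0_W[OF w(1)]) (simp_all add: W_inv_apply[OF u(1)] wy)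
  have "w v = v" for v
  proof -
    have "u (w v) = u v" using fun_cong[OF c, of "u v"] by (simp add: W_inv_apply(1)[OF u(1)])
    then have "inv u (u (w v)) = inv u (u v)" by simp
    then show ?thesis by (simp only: W_inv_apply(1)[OF u(1)])
  qed
  then show ?thesis by (simp add: fun_eq_iff)
qed

text \<open>Existence rests on \<open>S_fundamental\<close>, the uniqueness of the orbit
  representative in the closed alcove, and uniqueness on \<open>exists_W_S\<close>, its
  existence.\<close>

lemma G_map_ex1: "\<exists>!g. \<forall>w\<in>W. \<forall>v\<in>S. g (inv w v) = f v"
proof (rule ex_ex1I)
  define rep where "rep x = (SOME y. y \<in> S \<and> (\<exists>w\<in>W. y = w x))" for x
  have rep: "rep x \<in> S \<and> (\<exists>w\<in>W. rep x = w x)" for x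
    unfolding rep_def by (rule someI_ex) (use exists_W_S[of x] in blast)
  have "rep (inv w v) = v" if w: "w \<in> W" "v \<in> S" for w v
  proof -
    obtain u where u: "u \<in> W" "rep (inv w v) = u (inv w v)" using rep by blast
    have "(u \<circ> inv w) v = v"
      using u rep[of "inv w v"] w by (intro S_fundamental W_comp W_inv) auto
    then show ?thesis using u by simp
  qed
  then show "\<exists>g. \<forall>w\<in>W. \<forall>v\<in>S. g (inv w v) = f v"
    by (intro exI[of _ "\<lambda>x. f (rep x)"]) simp
next
  fix g h assume g: "\<forall>w\<in>W. \<forall>v\<in>S. g (inv w v) = f v" and h: "\<forall>w\<in>W. \<forall>v\<in>S. h (inv w v) = f v"
  show "g = h"
  proof
    fix x
    obtain w where w: "w \<in> W" "w x \<in> S" using exists_W_S by blast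
    then have "g (inv w (w x)) = h (inv w (w x))" using g h by simp
    then show "g x = h x" using W_inv_apply[OF w(1)] by simp
  qed
qed

abbreviation "G \<equiv> G_map R B \<phi>"

lemma G_apply: "w \<in> W \<Longrightarrow> v \<in> S \<Longrightarrow> G f (w v) = f v"
proof -
  assume w: "w \<in> W" "v \<in> S"
  have "\<forall>w\<in>W. \<forall>v\<in>S. G f (inv w v) = f v" unfolding G_map_def by (rule theI'[OF G_map_ex1])
  then have "G f (inv (inv w) v) = f v" using w W_inv by blast
  then show ?thesis using W_inv(1)[OF w(1)] by (simp add: inv_inv_eq)
qed

lemma G_S: "v \<in> S \<Longrightarrow> G f v = f v"
  using G_apply[OF W_id] by simp

lemma W_orbit_S: obtains w v where "w \<in> W" "v \<in> S" "x = w v"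
proof -
  obtain w where w: "w \<in> W" "w x \<in> S" using exists_W_S by blast
  then show ?thesis using that[of "inv w" "w x"] W_inv W_inv_apply by simp
qed

lemma W_invariant_iff: "W_invariant R g \<longleftrightarrow> (\<forall>w\<in>W. \<forall>v. g (w v) = g v)"
  unfolding W_invariant_def
proof (safe)
  fix w v assume "\<forall>w\<in>W. \<forall>v. g (inv w v) = g v" "w \<in> W"
  then show "g (w v) = g v" using W_inv_apply(1)[of w v] by metis
next
  fix w v assume "\<forall>w\<in>W. \<forall>v. g (w v) = g v" "w \<in> W"
  then show "g (inv w v) = g v" using W_inv(2)[of w] by blast
qed

lemma W_invariant_G: "W_invariant R (G f)"
  unfolding W_invariant_iff
proof (intro ballI allI)
  fix w x assume w: "w \<in> W"
  obtain u v where u: "u \<in> W" "v \<in> S" "x = u v" by (rule W_orbit_S)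
  have "G f ((w \<circ> u) v) = f v" using w u by (intro G_apply W_comp)
  then show "G f (w x) = G f x" using u G_apply by simp
qed

lemma W_invariant_eq_G: "W_invariant R g \<Longrightarrow> (\<And>v. v \<in> S \<Longrightarrow> g v = f v) \<Longrightarrow> g = G f"
proof
  fix x assume g: "W_invariant R g" "\<And>v. v \<in> S \<Longrightarrow> g v = f v"
  obtain u v where u: "u \<in> W" "v \<in> S" "x = u v" by (rule W_orbit_S)
  then show "g x = G f x" using g G_apply by (simp add: W_invariant_iff)
qed

section \<open>Antisymmetric functions\<close>

definition anti :: "('a \<Rightarrow> complex) \<Rightarrow> bool" where
  "anti f \<longleftrightarrow> (\<forall>w\<in>W. \<forall>v. f (w v) = eps w * f v)"

lemma anti_iff_inv: "anti f \<longleftrightarrow> (\<forall>w\<in>W. \<forall>v. f (inv w v) = (- 1) ^ len B \<phi> w * f v)"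
  unfolding anti_def eps_def[symmetric]
proof safe
  fix w v assume "\<forall>w\<in>W. \<forall>v. f (w v) = eps w * f v" "w \<in> W"
  then show "f (inv w v) = eps w * f v" using W_inv(2)[of w] eps_inv[of w] by simp
next
  fix w v assume "\<forall>w\<in>W. \<forall>v. f (inv w v) = eps w * f v" "w \<in> W"
  then show "f (w v) = eps w * f v" using W_inv[of w] eps_inv[of w] inv_inv_eq[of w] by metis
qed

lemma anti_wall: "anti f \<Longrightarrow> a \<in> Sig \<Longrightarrow> aff_apply a v = 0 \<Longrightarrow> f v = 0"
proof -
  assume "anti f" "a \<in> Sig" "aff_apply a v = 0"
  then have "f (aff_refl a v) = - f v" "aff_refl a v = v"
    using eps_refl[of a] aff_refl_W[of a] aff_refl_fixed_iff[OF fst_Sig] unfolding anti_def by auto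
  then show "f v = 0" by simp
qed

lemma anti_eqI: "anti f \<Longrightarrow> anti g \<Longrightarrow> (\<And>v. v \<in> S \<Longrightarrow> f v = g v) \<Longrightarrow> f = g"
proof
  fix x assume a: "anti f" "anti g" "\<And>v. v \<in> S \<Longrightarrow> f v = g v"
  obtain u v where u: "u \<in> W" "v \<in> S" "x = u v" by (rule W_orbit_S)
  then show "f x = g x" using a by (simp add: anti_def)
qed

section \<open>Regular points and alcoves\<close>

lemma W_homeo: "w \<in> W \<Longrightarrow> continuous_on X w"
proof (induction rule: W_induct)
  case (refl a w)
  have "continuous_on (w ` X) (aff_refl a)" unfolding aff_refl_def
    by (intro continuous_intros continuous_aff_apply)
  then show ?case using refl by (intro continuous_on_compose)
qed (simp add: id_def)

lemma open_W_C: "w \<in> W \<Longrightarrow> open (w ` C)"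
proof -
  assume w: "w \<in> W"
  have "w ` C = inv w -` C"
    using W_inv(1)[OF w] by (simp add: bij_vimage_eq_inv_image bij_imp_bij_inv inv_inv_eq)
  moreover have "open (inv w -` C)"
    using W_homeo[OF W_inv(2)[OF w]] open_C by (intro open_vimage)
  ultimately show ?thesis by simp
qed

lemma V_reg_eq: "V_reg R B \<phi> = {v. \<forall>a\<in>Sig. aff_apply a v \<noteq> 0}"
proof -
  have "(\<forall>a. pos a \<longrightarrow> aff_apply a v \<noteq> 0) \<longleftrightarrow> (\<forall>a\<in>Sig. aff_apply a v \<noteq> 0)" for v
    using pos_minus by (metis aff_apply_minus neg_equal_0_iff_equal pos_def)
  then show ?thesis by (auto simp: V_reg_def aff_pos_roots_eq hyperplane_def)
qed

lemma W_V_reg: assumes "w \<in> W" "v \<in> V_reg R B \<phi>" shows "w v \<in> V_reg R B \<phi>"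
  unfolding V_reg_eq
proof (clarify)
  fix a assume "a \<in> Sig" "aff_apply a (w v) = 0"
  then show False using W_Sig[OF assms(1), of a] assms(2) by (auto simp: V_reg_eq)
qed

lemma V_reg_S_C: "x \<in> V_reg R B \<phi> \<Longrightarrow> x \<in> S \<Longrightarrow> x \<in> C"
  using Del_Sig by (auto simp: V_reg_eq C_iff S_iff less_le)

lemma V_reg_orbit:
  assumes "x \<in> V_reg R B \<phi>" obtains w v where "w \<in> W" "v \<in> C" "x = w v"
proof -
  obtain w v where w: "w \<in> W" "v \<in> S" "x = w v" by (rule W_orbit_S)
  have "v = inv w x" using w W_inv_apply by simp
  then have "v \<in> V_reg R B \<phi>" using W_V_reg[OF W_inv(2)[OF w(1)] assms] by simp
  then have "v \<in> C" using w(2) by (intro V_reg_S_C)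
  then show ?thesis using w that by blast
qed

lemma W_C_V_reg: "w \<in> W \<Longrightarrow> v \<in> C \<Longrightarrow> w v \<in> V_reg R B \<phi>"
  using Sig_nonzero_WC by (simp add: V_reg_eq)

text \<open>On antisymmetric functions \<open>G\<close> is multiplication by the locally constant sign \<open>chi\<close>.\<close>

definition chi :: "'a \<Rightarrow> complex" where
  "chi x = (if x \<in> V_reg R B \<phi> then if even (neg_count x) then 1 else - 1 else 0)"

lemma chi_WC: "w \<in> W \<Longrightarrow> v \<in> C \<Longrightarrow> chi (w v) = eps w"
  by (simp add: chi_def W_C_V_reg eps_eq_neg_count)

lemma chi_locally_constant:
  assumes "x \<in> V_reg R B \<phi>"
  obtains U where "open U" "x \<in> U" "U \<subseteq> V_reg R B \<phi>" "\<And>y. y \<in> U \<Longrightarrow> chi y = chi x"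
proof -
  obtain w v where w: "w \<in> W" "v \<in> C" "x = w v" by (rule V_reg_orbit[OF assms])
  show ?thesis using w by (intro that[of "w ` C"] open_W_C) (auto simp: chi_WC W_C_V_reg)
qed

lemma G_chi: "anti f \<Longrightarrow> G f x = chi x * f x"
proof -
  assume f: "anti f"
  obtain w v where w: "w \<in> W" "v \<in> S" "x = w v" by (rule W_orbit_S)
  have fx: "f x = eps w * f v" using f w by (simp add: anti_def)
  show "G f x = chi x * f x"
  proof (cases "x \<in> V_reg R B \<phi>")
    case True
    have "v = inv w x" using w W_inv_apply by simp
    then have "v \<in> V_reg R B \<phi>" using W_V_reg[OF W_inv(2)[OF w(1)] True] by simp
    then have "v \<in> C" using w(2) by (intro V_reg_S_C)
    then show ?thesis using w fx chi_WC G_apply eps_square by (simp flip: mult.assoc)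
  next
    case False
    then have "f x = 0" using anti_wall[OF f] by (auto simp: V_reg_eq)
    then have "f v = 0" using fx by (auto simp: eps_def)
    then show ?thesis using w G_apply False by (simp add: chi_def)
  qed
qed

lemma C_alcove: "C \<in> alcoves R B \<phi>"
  unfolding alcoves_def
proof (rule in_components_maximal[THEN iffD2], intro conjI allI impI)
  show "C \<noteq> {}" using x0_C by blast
  show "C \<subseteq> V_reg R B \<phi>" using W_C_V_reg[OF W_id] by auto
  show "connected C" by (rule convex_connected[OF convex_C])
  fix D assume D: "D \<noteq> {} \<and> C \<subseteq> D \<and> D \<subseteq> V_reg R B \<phi> \<and> connected D"
  show "D = C"
  proof (rule ccontr)
    assume "D \<noteq> C"
    \<comment> \<open>Thus C is both open and relatively closed in the connected set D.\<close>
    have "D \<inter> S = C"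
      using D C_S V_reg_S_C by blast
    then have "C \<inter> - S \<inter> D = {}" "D \<subseteq> C \<union> - S" "C \<inter> D \<noteq> {}" "- S \<inter> D \<noteq> {}"
      using D \<open>D \<noteq> C\<close> x0_C C_S by auto
    moreover have "open (- S)" by auto
    ultimately show False using D open_C unfolding connected_def by blast
  qed
qed

end

section \<open>Smooth functions and integration by parts\<close>

lemma dir_deriv_eq: "(f has_derivative f') (at x) \<Longrightarrow> dir_deriv v f x = f' v"
  unfolding dir_deriv_def by (metis frechet_derivative_at)

lemma has_derivative_dir_deriv: "f differentiable at x \<Longrightarrow> (f has_derivative (\<lambda>v. dir_deriv v f x)) (at x)"
  unfolding dir_deriv_def by (simp add: frechet_derivative_works eta_contract_eq)

lemma dir_deriv_add:
  "f differentiable at x \<Longrightarrow> g differentiable at x \<Longrightarrow>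
    dir_deriv v (\<lambda>x. f x + g x) x = dir_deriv v f x + dir_deriv v g x"
  by (rule dir_deriv_eq[OF has_derivative_add]) (simp_all add: has_derivative_dir_deriv)

lemma dir_deriv_mult:
  "f differentiable at x \<Longrightarrow> g differentiable at x \<Longrightarrow>
    dir_deriv v (\<lambda>x. f x * g x) x = f x * dir_deriv v g x + dir_deriv v f x * g x"
  by (rule dir_deriv_eq[OF has_derivative_mult]) (simp_all add: has_derivative_dir_deriv)

lemma dir_deriv_const [simp]: "dir_deriv v (\<lambda>x. c) x = 0"
  by (rule dir_deriv_eq) simp

lemma dir_deriv_cmult: "f differentiable at x \<Longrightarrow> dir_deriv v (\<lambda>x. c * f x) x = c * dir_deriv v f x"
  by (rule dir_deriv_eq[OF has_derivative_mult_right]) (simp add: has_derivative_dir_deriv)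

lemma dir_deriv_local:
  assumes "open U" "x \<in> U" "\<And>y. y \<in> U \<Longrightarrow> f y = g y" "f differentiable at x"
  shows "g differentiable at x" "dir_deriv v g x = dir_deriv v f x"
proof -
  have "(g has_derivative (\<lambda>v. dir_deriv v f x)) (at x)"
    by (rule has_derivative_transform_within_open[OF has_derivative_dir_deriv[OF assms(4)] assms(1-3)])
  then show "g differentiable at x" "dir_deriv v g x = dir_deriv v f x"
    by (auto simp: differentiable_def intro: dir_deriv_eq)
qed

lemma dir_deriv_basis:
  assumes "f differentiable at x"
  shows "dir_deriv v f x = (\<Sum>b\<in>Basis. of_real (v \<bullet> b) * dir_deriv b f x)"
proof -
  have lin: "linear (\<lambda>v. dir_deriv v f x)" by (rule has_derivative_linear[OF has_derivative_dir_deriv[OF assms]])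
  have "dir_deriv v f x = dir_deriv (\<Sum>b\<in>Basis. (v \<bullet> b) *\<^sub>R b) f x" by (simp add: euclidean_representation)
  also have "\<dots> = (\<Sum>b\<in>Basis. of_real (v \<bullet> b) * dir_deriv b f x)"
    using linear_sum[OF lin, of "\<lambda>b. (v \<bullet> b) *\<^sub>R b" Basis] by (simp add: linear_scale[OF lin] scaleR_conv_of_real)
  finally show ?thesis .
qed

text \<open>Iterated derivatives never leave the class X, so each smoothness proof only has to
  exhibit such a class.\<close>

lemma smoothI_class:
  assumes "f \<in> X" "\<And>g x. g \<in> X \<Longrightarrow> g differentiable at x" "\<And>g v. g \<in> X \<Longrightarrow> dir_deriv v g \<in> X"
  shows "smooth f"
  unfolding smooth_def
proof
  fix vs
  have "foldr dir_deriv vs f \<in> X" by (induction vs) (use assms in auto)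
  then show "foldr dir_deriv vs f differentiable_on UNIV"
    using assms(2) by (simp add: differentiable_on_def)
qed

lemma smooth_differentiable: "smooth f \<Longrightarrow> f differentiable at x"
  unfolding smooth_def by (drule spec[of _ "[]"]) (simp add: differentiable_on_def)

lemma smooth_dir_deriv: "smooth f \<Longrightarrow> smooth (dir_deriv v f)"
  unfolding smooth_def
proof
  fix vs assume "\<forall>vs. foldr dir_deriv vs f differentiable_on UNIV"
  then have "foldr dir_deriv (vs @ [v]) f differentiable_on UNIV" by blast
  then show "foldr dir_deriv vs (dir_deriv v f) differentiable_on UNIV" by simp
qed

lemma smooth_continuous: "smooth f \<Longrightarrow> continuous_on X f"
  by (meson continuous_at_imp_continuous_on differentiable_imp_continuous_within smooth_differentiable)

text \<open>A class for \<open>smoothI_class\<close> that contains products: the product rule yields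
  sums of products, hence closure under both operations.\<close>

inductive_set smooth_algebra :: "('a::euclidean_space \<Rightarrow> complex) set" where
  base: "smooth f \<Longrightarrow> f \<in> smooth_algebra"
| add: "f \<in> smooth_algebra \<Longrightarrow> g \<in> smooth_algebra \<Longrightarrow> (\<lambda>x. f x + g x) \<in> smooth_algebra"
| mult: "f \<in> smooth_algebra \<Longrightarrow> g \<in> smooth_algebra \<Longrightarrow> (\<lambda>x. f x * g x) \<in> smooth_algebra"

lemma smooth_algebra_step:
  "f \<in> smooth_algebra \<Longrightarrow> (\<forall>x. f differentiable at x) \<and> (\<forall>v. dir_deriv v f \<in> smooth_algebra)"
proof (induction rule: smooth_algebra.induct)
  case (base f)
  then show ?case by (auto intro: smooth_differentiable smooth_dir_deriv smooth_algebra.base)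
next
  case (add f g)
  then have "dir_deriv v (\<lambda>x. f x + g x) = (\<lambda>x. dir_deriv v f x + dir_deriv v g x)" for v
    by (auto simp: dir_deriv_add)
  then show ?case using add by (auto intro: smooth_algebra.add)
next
  case (mult f g)
  then have e: "dir_deriv v (\<lambda>x. f x * g x) = (\<lambda>x. f x * dir_deriv v g x + dir_deriv v f x * g x)" for v
    by (auto simp: dir_deriv_mult)
  have "(\<lambda>x. f x * dir_deriv v g x + dir_deriv v f x * g x) \<in> smooth_algebra" for v
    using mult by (intro smooth_algebra.add smooth_algebra.mult) auto
  then show ?case using mult unfolding e by auto
qed

lemma smooth_algebra_smooth: "f \<in> smooth_algebra \<Longrightarrow> smooth f"
  by (rule smoothI_class[of _ smooth_algebra]) (use smooth_algebra_step in auto)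

lemma smooth_add: "smooth f \<Longrightarrow> smooth g \<Longrightarrow> smooth (\<lambda>x. f x + g x)"
  by (rule smooth_algebra_smooth[OF smooth_algebra.add[OF smooth_algebra.base smooth_algebra.base]])

lemma smooth_mult: "smooth f \<Longrightarrow> smooth g \<Longrightarrow> smooth (\<lambda>x. f x * g x)"
  by (rule smooth_algebra_smooth[OF smooth_algebra.mult[OF smooth_algebra.base smooth_algebra.base]])

lemma smooth_const: "smooth (\<lambda>x. c)"
  by (rule smoothI_class[of _ "range (\<lambda>c x. c)"]) (auto simp: fun_eq_iff)

lemma smooth_cmult: "smooth f \<Longrightarrow> smooth (\<lambda>x. c * f x)"
  by (intro smooth_mult smooth_const)

lemma smooth_sum: "(\<And>i. i \<in> I \<Longrightarrow> smooth (f i)) \<Longrightarrow> smooth (\<lambda>x. \<Sum>i\<in>I. f i x)"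
  by (induction I rule: infinite_finite_induct) (auto intro: smooth_const smooth_add)

lemma dir_deriv_sum:
  "(\<And>i. i \<in> I \<Longrightarrow> f i differentiable at x) \<Longrightarrow>
    dir_deriv v (\<lambda>x. \<Sum>i\<in>I. f i x) x = (\<Sum>i\<in>I. dir_deriv v (f i) x)"
  by (rule dir_deriv_eq[OF has_derivative_sum]) (simp add: has_derivative_dir_deriv)

lemma const_coeff_op_support:
  assumes "const_coeff_op K p D" "smooth h" "closed X" "\<And>x. x \<notin> X \<Longrightarrow> h x = 0"
  shows "smooth (D h) \<and> (\<forall>x. x \<notin> X \<longrightarrow> D h x = 0)"
  using assms(1,2,4)
proof (induction arbitrary: h rule: const_coeff_op.induct)
  case (const c)
  then show ?case by (simp add: smooth_cmult)
next
  case (vector v)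
  have "dir_deriv v h x = 0" if "x \<notin> X" for x
    using dir_deriv_local(2)[of "- X" x "\<lambda>x. 0" h] vector that assms(3) by auto
  then show ?case using vector by (simp add: smooth_dir_deriv)
next
  case (add p D q E)
  then show ?case by (simp add: smooth_add)
next
  case (mult p D q E)
  then show ?case by blast
qed

lemma smooth_const_coeff_op: "const_coeff_op K p D \<Longrightarrow> smooth h \<Longrightarrow> smooth (D h)"
  using const_coeff_op_support[of K p D h UNIV] by simp

section \<open>Integration by parts and formal transposes\<close>

lemma integrable_continuous_compact_support:
  fixes k :: "'a::euclidean_space \<Rightarrow> complex"
  assumes "continuous_on UNIV k" "compact X" "\<And>x. x \<notin> X \<Longrightarrow> k x = 0"
  shows "integrable lborel k"
proof -
  have "integrable lborel (\<lambda>x. indicator X x *\<^sub>R k x)"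
    using assms by (intro borel_integrable_compact continuous_on_subset[OF assms(1)]) auto
  moreover have "(\<lambda>x. indicator X x *\<^sub>R k x) = k"
    using assms(3) by (auto simp: fun_eq_iff indicator_def)
  ultimately show ?thesis by simp
qed

lemma integral_lborel_translation:
  fixes k :: "'a::euclidean_space \<Rightarrow> complex"
  shows "(LINT x|lborel. k (x + v)) = (LINT x|lborel. k x)"
proof (cases "k \<in> borel_measurable borel")
  case True
  have "(LINT x|lborel. k x) = (LINT x|distr lborel borel ((+) v). k x)" by (simp add: lborel_distr_plus)
  also have "\<dots> = (LINT x|lborel. k (v + x))" using True by (intro integral_distr) auto
  finally show ?thesis by (simp add: add.commute)
next
  \<comment> \<open>A function that is not integrable has integral 0 by convention, so both sides
    are 0 when k is not measurable.\<close>
  case False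
  have "\<not> integrable lborel k" using False borel_measurable_integrable[of lborel k] by (metis measurable_lborel2)
  moreover have "\<not> integrable lborel (\<lambda>x. k (x + v))"
  proof
    assume "integrable lborel (\<lambda>x. k (x + v))"
    then have "(\<lambda>x. k (x + v)) \<in> borel_measurable borel" using borel_measurable_integrable by (metis measurable_lborel2)
    then have "(\<lambda>x. k (x + v)) \<circ> (\<lambda>x. x - v) \<in> borel_measurable borel" by measurable
    then show False using False by (simp add: o_def)
  qed
  ultimately show ?thesis by (simp add: not_integrable_integral_eq)
qed

text \<open>The difference quotients integrate to 0 by translation invariance, and dominated
  convergence passes to the derivative.\<close>

lemma integral_dir_deriv_eq_0:
  fixes k :: "'a::euclidean_space \<Rightarrow> complex"
  assumes diff: "\<And>x. k differentiable at x" and cont: "continuous_on UNIV (dir_deriv v k)"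
    and X: "compact X" "\<And>x. x \<notin> X \<Longrightarrow> k x = 0"
  shows "(LINT x|lborel. dir_deriv v k x) = 0"
proof -
  obtain r where r: "r > 0" "X \<subseteq> cball 0 r"
    using compact_imp_bounded[OF X(1)] unfolding bounded_pos by (auto simp: subset_eq)
  \<comment> \<open>The increments are at most v in length, so this ball contains the supports of
    all the difference quotients.\<close>
  let ?Y = "cball 0 (r + norm v) :: 'a set"
  have kc: "continuous_on UNIV k"
    using diff by (meson continuous_at_imp_continuous_on differentiable_imp_continuous_within)
  obtain M where M: "\<And>x. x \<in> ?Y \<Longrightarrow> norm (dir_deriv v k x) \<le> M"
  proof -
    have "compact (dir_deriv v k ` ?Y)"
      by (intro compact_continuous_image compact_cball continuous_on_subset[OF cont]) auto
    then show ?thesis using that by (meson bounded_iff compact_imp_bounded imageI)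
  qed
  have dz: "dir_deriv v k x = 0" if "x \<notin> cball 0 r" for x
    using dir_deriv_local(2)[of "- X" x "\<lambda>x. 0" k v] that r(2) X compact_imp_closed[OF X(1)]
    by (auto simp: subset_eq)
  have M0: "M \<ge> 0" using M[of 0] r(1) norm_ge_zero order_trans by (metis centre_in_cball add_nonneg_nonneg less_imp_le)
  have Mall: "norm (dir_deriv v k x) \<le> M" for x
  proof (cases "x \<in> cball 0 r")
    case True
    then have "x \<in> ?Y" by (simp add: add_increasing2)
    then show ?thesis by (rule M)
  qed (simp add: dz M0)
  define q where "q n x = real (Suc n) *\<^sub>R (k (x + (1 / real (Suc n)) *\<^sub>R v) - k x)" for n x
  have path: "((\<lambda>t. k (x + t *\<^sub>R v)) has_vector_derivative dir_deriv v k (x + t *\<^sub>R v)) (at t)" for x t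
  proof -
    have "((\<lambda>t. k (x + t *\<^sub>R v)) has_derivative (\<lambda>h. dir_deriv (h *\<^sub>R v) k (x + t *\<^sub>R v))) (at t)"
      by (rule has_derivative_compose[OF _ has_derivative_dir_deriv[OF diff]])
        (auto intro!: derivative_eq_intros)
    moreover have "dir_deriv (h *\<^sub>R v) k y = h *\<^sub>R dir_deriv v k y" for h y
      using linear_scale[OF has_derivative_linear[OF has_derivative_dir_deriv[OF diff]]] .
    ultimately show ?thesis by (simp add: has_vector_derivative_def)
  qed
  have qb: "norm (q n x) \<le> M" for n x
  proof -
    let ?t = "1 / real (Suc n)"
    have "norm (k (x + ?t *\<^sub>R v) - k (x + 0 *\<^sub>R v)) \<le> M * ?t - M * 0"
    proof (rule differentiable_bound_general[where f = "\<lambda>t. k (x + t *\<^sub>R v)"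
          and f' = "\<lambda>t. dir_deriv v k (x + t *\<^sub>R v)" and \<phi>' = "\<lambda>_. M"])
      show "continuous_on {0..?t} (\<lambda>t. k (x + t *\<^sub>R v))"
        by (intro continuous_on_compose2[OF kc] continuous_intros) auto
      show "((*) M has_vector_derivative M) (at t)" for t
        by (auto intro!: derivative_eq_intros simp: has_vector_derivative_def)
    qed (auto intro!: Mall path continuous_intros)
    then have "norm (k (x + ?t *\<^sub>R v) - k x) \<le> ?t * M" by (simp add: mult.commute)
    then have "real (Suc n) * norm (k (x + ?t *\<^sub>R v) - k x) \<le> real (Suc n) * (?t * M)"
      by (intro mult_left_mono) auto
    then show ?thesis by (simp add: q_def del: of_nat_Suc)
  qed
  have ql: "(\<lambda>n. q n x) \<longlonglongrightarrow> dir_deriv v k x" for x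
  proof -
    let ?t = "\<lambda>n. 1 / real (Suc n)"
    have "((\<lambda>h. norm (k (x + h *\<^sub>R v) - k x - h *\<^sub>R dir_deriv v k x) / norm h) \<longlongrightarrow> 0) (at 0)"
      using path[of x 0] unfolding has_vector_derivative_def has_derivative_at by simp
    moreover have "filterlim ?t (at 0) sequentially"
      unfolding filterlim_at using LIMSEQ_inverse_real_of_nat by (auto simp: inverse_eq_divide)
    ultimately have "(\<lambda>n. norm (k (x + ?t n *\<^sub>R v) - k x - ?t n *\<^sub>R dir_deriv v k x) / norm (?t n)) \<longlonglongrightarrow> 0"
      by (rule filterlim_compose)
    moreover have "norm (k (x + ?t n *\<^sub>R v) - k x - ?t n *\<^sub>R dir_deriv v k x) / norm (?t n)
        = norm (q n x - dir_deriv v k x)" for n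
    proof -
      have "q n x - dir_deriv v k x
          = real (Suc n) *\<^sub>R (k (x + ?t n *\<^sub>R v) - k x - ?t n *\<^sub>R dir_deriv v k x)"
        by (simp add: q_def scaleR_diff_right del: of_nat_Suc)
      then show ?thesis by (simp only: norm_scaleR) (simp del: of_nat_Suc)
    qed
    ultimately have "(\<lambda>n. norm (q n x - dir_deriv v k x)) \<longlonglongrightarrow> 0" by simp
    then show ?thesis by (simp add: tendsto_norm_zero_iff LIM_zero_iff)
  qed
  have qz: "q n x = 0" if "x \<notin> ?Y" for n x
  proof -
    have n: "norm x > r + norm v" using that by simp
    have "norm ((1 / real (Suc n)) *\<^sub>R v) \<le> norm v" by (simp add: divide_le_eq mult_le_cancel_left1)
    then have "norm (x + (1 / real (Suc n)) *\<^sub>R v) > r"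
      using n norm_triangle_ineq4[of "x + (1 / real (Suc n)) *\<^sub>R v" "(1 / real (Suc n)) *\<^sub>R v"] by simp
    moreover have "norm x > r" using n by (meson add_increasing2 le_less_trans norm_ge_zero not_le order.strict_trans1 less_le_trans order_refl)
    ultimately have "x + (1 / real (Suc n)) *\<^sub>R v \<notin> X" "x \<notin> X" using r(2) by (auto simp: subset_eq not_less[symmetric])
    then show ?thesis using X(2) by (simp add: q_def)
  qed
  have ki: "integrable lborel k" by (rule integrable_continuous_compact_support[OF kc X])
  have kti: "integrable lborel (\<lambda>x. k (x + u))" for u
  proof (rule integrable_continuous_compact_support)
    show "continuous_on UNIV (\<lambda>x. k (x + u))"
      by (intro continuous_on_compose2[OF kc] continuous_intros) auto
    show "compact ((\<lambda>x. x - u) ` X)" by (intro compact_continuous_image continuous_intros X)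
    show "k (x + u) = 0" if "x \<notin> (\<lambda>x. x - u) ` X" for x
      using that X(2)[of "x + u"] by (metis add_diff_cancel imageI)
  qed
  have qi: "integrable lborel (q n)" for n
    unfolding q_def by (intro integrable_scaleR_right Bochner_Integration.integrable_diff kti ki)
  have "(\<lambda>n. LINT x|lborel. q n x) \<longlonglongrightarrow> (LINT x|lborel. dir_deriv v k x)"
  proof (rule integral_dominated_convergence[where w = "\<lambda>x. indicator ?Y x *\<^sub>R M"])
    show "dir_deriv v k \<in> borel_measurable lborel" using cont by (simp add: borel_measurable_continuous_onI)
    show "q n \<in> borel_measurable lborel" for n
      using qi by (rule borel_measurable_integrable)
    show "integrable lborel (\<lambda>x. indicator ?Y x *\<^sub>R M)"
      by (rule borel_integrable_compact) (auto intro: compact_cball)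
    show "AE x in lborel. (\<lambda>n. q n x) \<longlonglongrightarrow> dir_deriv v k x" using ql by simp
    show "\<And>n. AE x in lborel. norm (q n x) \<le> indicator ?Y x *\<^sub>R M"
      using qb qz by (intro AE_I2) (auto simp: indicator_def)
  qed
  moreover have "(LINT x|lborel. q n x) = 0" for n
    unfolding q_def by (simp add: Bochner_Integration.integral_diff[OF kti ki] integral_lborel_translation)
  ultimately show ?thesis by (simp add: LIMSEQ_const_iff)
qed

text \<open>The product has compact support even if f has not. The sign sits in the direction,
  matching the substitution of -\<xi> for \<xi> in the transposed polynomial.\<close>

lemma integration_by_parts:
  assumes f: "smooth f" and h: "smooth h" and X: "compact X" "\<And>x. x \<notin> X \<Longrightarrow> h x = 0"
  shows "(LINT x|lborel. f x * dir_deriv v h x) = (LINT x|lborel. dir_deriv (- v) f x * h x)"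
proof -
  have dh: "dir_deriv v h x = 0" if "x \<notin> X" for x
    using const_coeff_op_support[OF const_coeff_op.vector[of UNIV v] h compact_imp_closed[OF X(1)] X(2)] that by blast
  have i1: "integrable lborel (\<lambda>x. f x * dir_deriv v h x)"
    using dh by (intro integrable_continuous_compact_support[OF _ X(1)] smooth_continuous smooth_mult f smooth_dir_deriv h) auto
  have i2: "integrable lborel (\<lambda>x. dir_deriv v f x * h x)"
    using X(2) by (intro integrable_continuous_compact_support[OF _ X(1)] smooth_continuous smooth_mult f smooth_dir_deriv h) auto
  have m: "dir_deriv (- v) f x = - dir_deriv v f x" for x
    using linear_neg[OF has_derivative_linear[OF has_derivative_dir_deriv[OF smooth_differentiable[OF f]]]] .
  have "(LINT x|lborel. dir_deriv v (\<lambda>x. f x * h x) x) = 0"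
    using X(2) by (intro integral_dir_deriv_eq_0[OF _ _ X(1)] smooth_differentiable smooth_continuous smooth_dir_deriv smooth_mult f h) auto
  then have "(LINT x|lborel. f x * dir_deriv v h x + dir_deriv v f x * h x) = 0"
    by (simp add: dir_deriv_mult smooth_differentiable f h)
  then have "(LINT x|lborel. f x * dir_deriv v h x) = - (LINT x|lborel. dir_deriv v f x * h x)"
    using Bochner_Integration.integral_add[OF i1 i2] by (simp add: add_eq_0_iff)
  then show ?thesis by (simp add: m)
qed

definition formal_transpose ::
  "(('a::euclidean_space \<Rightarrow> complex) \<Rightarrow> 'a \<Rightarrow> complex) \<Rightarrow> (('a \<Rightarrow> complex) \<Rightarrow> 'a \<Rightarrow> complex) \<Rightarrow> bool" where
  "formal_transpose D D' \<longleftrightarrow> (\<forall>f h X. smooth f \<longrightarrow> smooth h \<longrightarrow> compact X \<longrightarrow> (\<forall>x. x \<notin> X \<longrightarrow> h x = 0) \<longrightarrow>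
      (LINT x|lborel. f x * D h x) = (LINT x|lborel. D' f x * h x))"

lemma formal_transposeD:
  "formal_transpose D D' \<Longrightarrow> smooth f \<Longrightarrow> smooth h \<Longrightarrow> compact X \<Longrightarrow> (\<And>x. x \<notin> X \<Longrightarrow> h x = 0) \<Longrightarrow>
      (LINT x|lborel. f x * D h x) = (LINT x|lborel. D' f x * h x)"
  unfolding formal_transpose_def by blast

lemma const_coeff_op_transpose:
  fixes D :: "('a::euclidean_space \<Rightarrow> complex) \<Rightarrow> 'a \<Rightarrow> complex"
  assumes "const_coeff_op K q D"
  shows "\<exists>D'. const_coeff_op K (\<lambda>\<xi>. q (- \<xi>)) D' \<and> formal_transpose D D'"
  using assms
proof (induction rule: const_coeff_op.induct)
  case (const c)
  show ?case
    by (rule exI, rule conjI, rule const_coeff_op.const[OF const])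
      (simp only: formal_transpose_def mult.left_commute mult.assoc simp_thms)
next
  case (vector v)
  have e: "(\<lambda>\<xi>. app (- \<xi>) v) = (\<lambda>\<xi> :: 'a cdual. app \<xi> (- v))"
    by (simp add: blinfun.minus_left blinfun.minus_right)
  show ?case unfolding e
    by (rule exI, rule conjI, rule const_coeff_op.vector) (use integration_by_parts in \<open>unfold formal_transpose_def, blast\<close>)
next
  case (add p D q E)
  then obtain D' E' where D: "const_coeff_op K (\<lambda>\<xi>. p (- \<xi>)) D'" "const_coeff_op K (\<lambda>\<xi>. q (- \<xi>)) E'"
    "formal_transpose D D'" "formal_transpose E E'" by blast
  have i: "integrable lborel (\<lambda>x. f x * F h x)" "integrable lborel (\<lambda>x. F f x * h x)"
    if "const_coeff_op K r F" "smooth f" "smooth h" "compact X" "\<forall>x. x \<notin> X \<longrightarrow> h x = 0" for f h :: "'a \<Rightarrow> complex" and X F r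
  proof -
    have "smooth (F h)" "\<forall>x. x \<notin> X \<longrightarrow> F h x = 0"
      using const_coeff_op_support[OF that(1,3) compact_imp_closed[OF that(4)]] that by auto
    then show "integrable lborel (\<lambda>x. f x * F h x)"
      using that by (intro integrable_continuous_compact_support[OF _ that(4)] smooth_continuous smooth_mult) auto
    show "integrable lborel (\<lambda>x. F f x * h x)"
      using that by (intro integrable_continuous_compact_support[OF _ that(4)] smooth_continuous smooth_mult
          smooth_const_coeff_op[OF that(1)]) auto
  qed
  show ?case
  proof (rule exI, rule conjI, rule const_coeff_op.add[OF D(1,2)], unfold formal_transpose_def, intro allI impI)
    fix f h :: "'a \<Rightarrow> complex" and X assume a: "smooth f" "smooth h" "compact X" "\<forall>x. x \<notin> X \<longrightarrow> h x = 0"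
    have "(LINT x|lborel. f x * D h x + f x * E h x) = (LINT x|lborel. D' f x * h x + E' f x * h x)"
      unfolding Bochner_Integration.integral_add[OF i(1)[OF add.hyps(1) a] i(1)[OF add.hyps(2) a]]
        Bochner_Integration.integral_add[OF i(2)[OF D(1) a] i(2)[OF D(2) a]]
      using formal_transposeD[OF D(3) a(1-3)] formal_transposeD[OF D(4) a(1-3)] a(4) by simp
    then show "(LINT x|lborel. f x * (D h x + E h x)) = (LINT x|lborel. (D' f x + E' f x) * h x)"
      by (simp add: algebra_simps)
  qed
next
  case (mult p D q E)
  then obtain D' E' where D: "const_coeff_op K (\<lambda>\<xi>. p (- \<xi>)) D'" "const_coeff_op K (\<lambda>\<xi>. q (- \<xi>)) E'"
    "formal_transpose D D'" "formal_transpose E E'" by blast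
  \<comment> \<open>Transposition reverses the order of composition, while the polynomials
    commute.\<close>
  have e: "(\<lambda>\<xi>. p (- \<xi>) * q (- \<xi>)) = (\<lambda>\<xi>. q (- \<xi>) * p (- \<xi>))" by (simp add: mult.commute)
  show ?case unfolding e
  proof (rule exI, rule conjI, rule const_coeff_op.mult[OF D(2,1)], unfold formal_transpose_def, intro allI impI)
    fix f h :: "'a \<Rightarrow> complex" and X assume a: "smooth f" "smooth h" "compact X" "\<forall>x. x \<notin> X \<longrightarrow> h x = 0"
    have s: "smooth (E h)" "\<And>x. x \<notin> X \<Longrightarrow> E h x = 0"
      using const_coeff_op_support[OF mult.hyps(2) a(2) compact_imp_closed[OF a(3)]] a(4) by auto
    have "(LINT x|lborel. f x * D (E h) x) = (LINT x|lborel. D' f x * E h x)"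
      by (rule formal_transposeD[OF D(3) a(1) s(1) a(3) s(2)])
    also have "\<dots> = (LINT x|lborel. E' (D' f) x * h x)"
      using a by (intro formal_transposeD[OF D(4) smooth_const_coeff_op[OF D(1) a(1)] a(2,3)]) auto
    finally show "(LINT x|lborel. f x * D (E h) x) = (LINT x|lborel. E' (D' f) x * h x)" .
  qed
qed

text \<open>The transpose of an operator for p(-\<xi>) is an operator for p, and it acts on f as the
  scalar \<open>p \<mu>\<close>.\<close>

lemma weak_eigen_of_strong:
  assumes "smooth f" "\<And>D x. const_coeff_op UNIV p D \<Longrightarrow> D f x = p \<mu> * f x"
  shows "weak_eigen \<Omega> p \<mu> f"
  unfolding weak_eigen_def
proof (intro allI impI, elim conjE)
  fix D h assume D: "const_coeff_op UNIV (\<lambda>\<xi>. p (- \<xi>)) D" and h: "test_function \<Omega> h"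
  obtain D' where D': "const_coeff_op UNIV (\<lambda>\<xi>. p (- (- \<xi>))) D'"
    "formal_transpose D D'"
    using const_coeff_op_transpose[OF D] by blast
  have z: "h x = 0" if "x \<notin> closure {x. h x \<noteq> 0}" for x using that closure_subset[of "{x. h x \<noteq> 0}"] by auto
  have "(LINT x|lborel. f x * D h x) = (LINT x|lborel. D' f x * h x)"
    by (rule formal_transposeD[OF D'(2) assms(1), of _ "closure {x. h x \<noteq> 0}"])
      (use h in \<open>auto simp: test_function_def intro: z\<close>)
  also have "\<dots> = (LINT x|lborel. p \<mu> * (f x * h x))"
    using assms(2)[of D'] D'(1) by (simp add: mult.assoc)
  finally show "(LINT x|lborel. f x * D h x) = p \<mu> * (LINT x|lborel. f x * h x)" by simp
qed

lemma test_functionI: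
  assumes "smooth h" "compact X" "X \<subseteq> \<Omega>" "\<And>x. x \<notin> X \<Longrightarrow> h x = 0"
  shows "test_function \<Omega> h"
proof -
  have s: "closure {x. h x \<noteq> 0} \<subseteq> X" using assms by (intro closure_minimal compact_imp_closed) auto
  have "compact (X \<inter> closure {x. h x \<noteq> 0})" by (intro compact_Int_closed assms(2) closed_closure)
  then have "compact (closure {x. h x \<noteq> 0})" using s by (simp add: inf_absorb2)
  then show ?thesis unfolding test_function_def using assms(1,3) s by blast
qed

lemma C1_on_smooth: assumes "smooth f" shows "C1_on UNIV f"
proof -
  define f' where "f' x = Blinfun (\<lambda>v. dir_deriv v f x)" for x
  have app: "app (f' x) = (\<lambda>v. dir_deriv v f x)" for x
    unfolding f'_def using has_derivative_dir_deriv[OF smooth_differentiable[OF assms]]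
    by (intro bounded_linear_Blinfun_apply has_derivative_bounded_linear)
  have "continuous_on UNIV f'"
    by (rule continuous_on_blinfun_componentwise) (simp add: app smooth_continuous smooth_dir_deriv assms)
  then show ?thesis unfolding C1_on_def
    using has_derivative_dir_deriv[OF smooth_differentiable[OF assms]] by (intro exI[of _ f']) (simp add: app)
qed

section \<open>Real analytic functions\<close>

definition multi_monom :: "('a::euclidean_space \<Rightarrow> nat) \<Rightarrow> 'a \<Rightarrow> complex" where
  "multi_monom m y = of_real (\<Prod>b\<in>Basis. (y \<bullet> b) ^ m b)"

definition analytic_at_point :: "('a::euclidean_space \<Rightarrow> complex) \<Rightarrow> 'a \<Rightarrow> bool" where
  "analytic_at_point f x \<longleftrightarrow> (\<exists>r>0. \<exists>c. \<forall>y\<in>ball x r.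
     ((\<lambda>m. c m * multi_monom m (y - x)) has_sum f y) multi_indices)"

lemma real_analytic_iff: "real_analytic f \<longleftrightarrow> (\<forall>x. analytic_at_point f x)"
  by (simp add: real_analytic_def analytic_at_point_def multi_monom_def)

text \<open>Functions in \<open>PiE\<close> are \<open>undefined\<close> off the basis while
  multi-indices are 0 there; the bijection transfers countability and the product formula for
  sums.\<close>

lemma bij_betw_multi_indices:
  "bij_betw (\<lambda>g b. if b \<in> Basis then g b else 0) (PiE Basis (\<lambda>_. UNIV :: nat set))
     (multi_indices :: ('a::euclidean_space \<Rightarrow> nat) set)"
  by (rule bij_betw_byWitness[of _ "\<lambda>m. restrict m Basis"])
    (auto simp: multi_indices_def fun_eq_iff PiE_def extensional_def)

lemma countable_multi_indices: "countable (multi_indices :: ('a::euclidean_space \<Rightarrow> nat) set)"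
  by (rule countableI_bij1[OF bij_betw_multi_indices]) (auto intro!: countable_PiE)

lemma infinite_multi_indices: "infinite (multi_indices :: ('a::euclidean_space \<Rightarrow> nat) set)"
proof
  assume f: "finite (multi_indices :: ('a \<Rightarrow> nat) set)"
  obtain e :: 'a where e: "e \<in> Basis" using nonempty_Basis by blast
  have "range (\<lambda>n b. if b = e then n else 0) \<subseteq> (multi_indices :: ('a \<Rightarrow> nat) set)"
    using e by (auto simp: multi_indices_def)
  then have "finite (range (\<lambda>n (b::'a). if b = e then n else (0::nat)))" using f finite_subset by blast
  moreover have "inj (\<lambda>n (b::'a). if b = e then n else (0::nat))"
    by (rule injI) (metis (mono_tags, lifting))
  ultimately show False using finite_imageD infinite_UNIV_nat by blast
qed

text \<open>The truncated exponent \<open>m e - 1\<close> is harmless at \<open>m e = 0\<close>,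
  where the factor \<open>m e\<close> removes the term.\<close>

lemma monom_derivative:
  "(multi_monom m has_derivative (\<lambda>h. \<Sum>e\<in>Basis. of_real (h \<bullet> e) * (of_nat (m e) * multi_monom (m(e := m e - 1)) y))) (at y)"
proof -
  have "((\<lambda>y. \<Prod>b\<in>Basis. (y \<bullet> b) ^ m b) has_derivative
      (\<lambda>h. \<Sum>e\<in>Basis. (real (m e) * (h \<bullet> e) * (y \<bullet> e) ^ (m e - 1)) * (\<Prod>b\<in>Basis - {e}. (y \<bullet> b) ^ m b))) (at y)"
    by (rule has_derivative_prod) (auto intro!: derivative_eq_intros)
  moreover have "(real (m e) * (h \<bullet> e) * (y \<bullet> e) ^ (m e - 1)) * (\<Prod>b\<in>Basis - {e}. (y \<bullet> b) ^ m b)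
      = (h \<bullet> e) * (real (m e) * (\<Prod>b\<in>Basis. (y \<bullet> b) ^ (m(e := m e - 1)) b))" if "e \<in> Basis" for e h
  proof -
    have "(\<Prod>b\<in>Basis - {e}. (y \<bullet> b) ^ (m(e := m e - 1)) b) = (\<Prod>b\<in>Basis - {e}. (y \<bullet> b) ^ m b)"
      by (rule prod.cong) auto
    then show ?thesis using prod.remove[OF finite_Basis that, of "\<lambda>b. (y \<bullet> b) ^ (m(e := m e - 1)) b"] by simp
  qed
  then have "(\<lambda>h. \<Sum>e\<in>Basis. (real (m e) * (h \<bullet> e) * (y \<bullet> e) ^ (m e - 1)) * (\<Prod>b\<in>Basis - {e}. (y \<bullet> b) ^ m b))
    = (\<lambda>h. \<Sum>e\<in>Basis. (h \<bullet> e) * (real (m e) * (\<Prod>b\<in>Basis. (y \<bullet> b) ^ (m(e := m e - 1)) b)))"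
    by (intro ext sum.cong refl)
  ultimately have "((\<lambda>y. \<Prod>b\<in>Basis. (y \<bullet> b) ^ m b) has_derivative
      (\<lambda>h. \<Sum>e\<in>Basis. (h \<bullet> e) * (real (m e) * (\<Prod>b\<in>Basis. (y \<bullet> b) ^ (m(e := m e - 1)) b)))) (at y)"
    by (simp only:)
  then have "((\<lambda>y. complex_of_real (\<Prod>b\<in>Basis. (y \<bullet> b) ^ m b)) has_derivative
      (\<lambda>h. of_real (\<Sum>e\<in>Basis. (h \<bullet> e) * (real (m e) * (\<Prod>b\<in>Basis. (y \<bullet> b) ^ (m(e := m e - 1)) b))))) (at y)"
    by (rule has_derivative_of_real)
  then show ?thesis by (simp only: multi_monom_def[abs_def] of_real_sum of_real_mult of_real_of_nat_eq)
qed

lemma norm_monom_le: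
  assumes "s \<ge> 0" "\<And>b. b \<in> Basis \<Longrightarrow> \<bar>y \<bullet> b\<bar> \<le> s"
  shows "norm (multi_monom m y) \<le> s ^ (\<Sum>b\<in>Basis. m b)"
proof -
  have "norm (multi_monom m y) = (\<Prod>b\<in>Basis. \<bar>y \<bullet> b\<bar> ^ m b)"
    by (simp add: multi_monom_def norm_of_real abs_prod power_abs del: of_real_prod)
  also have "\<dots> \<le> (\<Prod>b\<in>Basis. s ^ m b)" using assms by (intro prod_mono conjI power_mono) auto
  finally show ?thesis by (simp add: power_sum)
qed

lemma monom_One: "multi_monom m (s *\<^sub>R One) = of_real (s ^ (\<Sum>b\<in>Basis. m b))"
  by (simp add: multi_monom_def power_sum inner_sum_left_Basis)

text \<open>Halving the radius pays for the factor \<open>m e\<close>, which is at most 2 to the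
  power |m| - 1.\<close>

lemma norm_monom_derivative_le:
  assumes s: "s > 0" and y: "\<And>b. b \<in> Basis \<Longrightarrow> \<bar>y \<bullet> b\<bar> \<le> s / 2" and e: "e \<in> Basis"
  shows "norm (of_nat (m e) * multi_monom (m(e := m e - 1)) y) \<le> s ^ (\<Sum>b\<in>Basis. m b) / s"
proof (cases "m e = 0")
  case False
  let ?n = "\<Sum>b\<in>Basis. m b"
  have sum: "(\<Sum>b\<in>Basis. (m(e := m e - 1)) b) = ?n - 1"
  proof -
    have "(\<Sum>b\<in>Basis - {e}. (m(e := m e - 1)) b) = (\<Sum>b\<in>Basis - {e}. m b)" by (rule sum.cong) auto
    then show ?thesis using e False by (simp add: sum.remove[of Basis e])
  qed
  have me: "m e \<le> ?n" by (rule member_le_sum[OF e]) auto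
  then obtain k where k: "?n = Suc k" using False by (cases ?n) auto
  have "m e \<le> 2 ^ k" using me k less_exp[of k] by linarith
  then have le: "real (m e) \<le> 2 ^ k" by (metis of_nat_le_iff of_nat_numeral of_nat_power)
  have "norm (multi_monom (m(e := m e - 1)) y) \<le> (s / 2) ^ k"
    using norm_monom_le[of "s / 2" y "m(e := m e - 1)"] s y unfolding sum k by simp
  then have "real (m e) * norm (multi_monom (m(e := m e - 1)) y) \<le> 2 ^ k * (s / 2) ^ k"
    using le by (intro mult_mono) auto
  also have "\<dots> = s ^ ?n / s" using s by (simp add: k power_divide)
  finally show ?thesis by (simp add: norm_mult)
qed (use s in simp)

text \<open>A summable majorant of the termwise derivatives makes the differentiated series converge
  uniformly on U.\<close>

lemma has_derivative_series_dominated: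
  fixes T :: "nat \<Rightarrow> 'a::euclidean_space \<Rightarrow> complex"
  assumes U: "open U" "convex U" "x \<in> U"
    and T: "\<And>i y. y \<in> U \<Longrightarrow> (T i has_derivative T' i y) (at y)"
    and M: "\<And>i y h. y \<in> U \<Longrightarrow> norm (T' i y h) \<le> M i * norm h" "summable M"
    and f: "\<And>y. y \<in> U \<Longrightarrow> (\<lambda>i. T i y) sums f y"
  shows "(f has_derivative (\<lambda>h. \<Sum>i. T' i x h)) (at x)"
proof -
  have sm: "summable (\<lambda>i. norm (T' i y h))" if "y \<in> U" for y h
    by (rule summable_comparison_test'[OF summable_mult2[OF M(2), of "norm h"], of 0]) (simp add: M(1)[OF that])
  have "\<exists>g. \<forall>y\<in>U. (\<lambda>n. T n y) sums g y \<and> (g has_derivative (\<lambda>h. \<Sum>i. T' i y h)) (at y within U)"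
  proof (rule has_derivative_series[where f = T and f' = T' and g' = "\<lambda>y h. \<Sum>i. T' i y h"
        and x = x and l = "f x", OF U(2)])
    show "x \<in> U" "(\<lambda>n. T n x) sums f x" using U(3) f by auto
    show "(T n has_derivative T' n y) (at y within U)" if "y \<in> U" for n y
      using T[OF that] by (rule has_derivative_at_withinI)
    fix e :: real assume e: "e > 0"
    have "(\<lambda>n. \<Sum>i. M (i + n)) \<longlonglongrightarrow> 0" by (rule suminf_exist_split2[OF M(2)])
    then have "\<forall>\<^sub>F n in sequentially. (\<Sum>i. M (i + n)) < e" using e by (rule order_tendstoD(2))
    then show "\<forall>\<^sub>F n in sequentially. \<forall>y\<in>U. \<forall>h. norm ((\<Sum>i<n. T' i y h) - (\<Sum>i. T' i y h)) \<le> e * norm h"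
    proof eventually_elim
      case (elim n)
      show ?case
      proof (intro ballI allI)
        fix y h assume y: "y \<in> U"
        have s: "summable (\<lambda>i. T' i y h)" using sm[OF y] by (rule summable_norm_cancel)
        have "norm ((\<Sum>i<n. T' i y h) - (\<Sum>i. T' i y h)) = norm (\<Sum>i. T' (i + n) y h)"
          by (simp add: suminf_minus_initial_segment[OF s] norm_minus_commute)
        also have "\<dots> \<le> (\<Sum>i. norm (T' (i + n) y h))"
          by (rule summable_norm) (use sm[OF y] in \<open>simp add: summable_iff_shift[of "\<lambda>i. norm (T' i y h)"]\<close>)
        also have "\<dots> \<le> (\<Sum>i. M (i + n) * norm h)"
          by (rule suminf_le) (use M(1)[OF y] sm[OF y] summable_mult2[OF M(2), of "norm h"] in
              \<open>auto simp: summable_iff_shift[of "\<lambda>i. norm (T' i y h)"] summable_iff_shift[of "\<lambda>i. M i * norm h"]\<close>)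
        also have "\<dots> = (\<Sum>i. M (i + n)) * norm h"
          using M(2) by (intro suminf_mult2[symmetric]) (simp add: summable_iff_shift)
        also have "\<dots> \<le> e * norm h" using elim by (intro mult_right_mono) auto
        finally show "norm ((\<Sum>i<n. T' i y h) - (\<Sum>i. T' i y h)) \<le> e * norm h" .
      qed
    qed
  qed
  then obtain g where g: "\<And>y. y \<in> U \<Longrightarrow> (\<lambda>n. T n y) sums g y"
    "\<And>y. y \<in> U \<Longrightarrow> (g has_derivative (\<lambda>h. \<Sum>i. T' i y h)) (at y within U)" by blast
  have "(g has_derivative (\<lambda>h. \<Sum>i. T' i x h)) (at x)"
    using g(2)[OF U(3)] at_within_open[OF U(3,1)] by simp
  then show ?thesis
    by (rule has_derivative_transform_within_open[OF _ U(1,3)]) (use f g(1) sums_unique2 in blast)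
qed

text \<open>Unconditional convergence at one point with all coordinates equal to s is absolute
  there, and this single series dominates the termwise derivatives near x.\<close>

lemma analytic_at_point_derivative:
  fixes f :: "'a::euclidean_space \<Rightarrow> complex"
  assumes "analytic_at_point f x"
  shows "f differentiable at x" "e \<in> Basis \<Longrightarrow> analytic_at_point (dir_deriv e f) x"
proof -
  obtain r c where r: "r > 0"
    and c: "\<And>y. y \<in> ball x r \<Longrightarrow> ((\<lambda>m. c m * multi_monom m (y - x)) has_sum f y) multi_indices"
    using assms unfolding analytic_at_point_def by blast
  \<comment> \<open>With this s the point \<open>x + s *\<^sub>R One\<close> has distance r/2 from
    x.\<close>
  define s where "s = r / (2 * norm (One :: 'a))"
  have One0: "norm (One :: 'a) > 0" by simp
  have s: "s > 0" using r by (simp add: s_def)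
  have "x + s *\<^sub>R One \<in> ball x r" using r by (simp add: dist_norm s_def)
  from c[OF this] have "(\<lambda>m. c m * of_real (s ^ (\<Sum>b\<in>Basis. m b))) summable_on multi_indices"
    by (auto simp: monom_One summable_on_def)
  then have abs: "(\<lambda>m. norm (c m) * s ^ (\<Sum>b\<in>Basis. m b)) summable_on multi_indices"
    using s by (subst (asm) summable_on_iff_abs_summable_on_complex) (simp add: norm_mult norm_power)
  \<comment> \<open>An enumeration turns the unordered sum into a series, which can be
    differentiated termwise.\<close>
  define idx :: "nat \<Rightarrow> 'a \<Rightarrow> nat" where "idx = from_nat_into multi_indices"
  have idx: "bij_betw idx UNIV multi_indices"
    unfolding idx_def by (rule bij_betw_from_nat_into[OF countable_multi_indices infinite_multi_indices])
  define a where "a m = norm (c m) * s ^ (\<Sum>b\<in>Basis. m b)" for m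
  have "a summable_on multi_indices" using abs by (simp add: a_def[abs_def])
  then have "(\<lambda>i. a (idx i)) summable_on UNIV"
    using summable_on_reindex_bij_betw[OF idx, of a] by blast
  then have a_sum: "summable (\<lambda>i. a (idx i))" by (rule summable_on_imp_summable)
  let ?U = "ball x (min r (s / 2))"
  define d where "d e m y = c m * (of_nat (m e) * multi_monom (m(e := m e - 1)) (y - x))" for e m y
  have small: "\<bar>(y - x) \<bullet> b\<bar> \<le> s / 2" if "y \<in> ?U" "b \<in> Basis" for y b
    using that Basis_le_norm[of b "y - x"] by (simp add: dist_norm norm_minus_commute)
  have d_le: "norm (d e m y) \<le> a m / s" if "y \<in> ?U" "e \<in> Basis" for e m y
  proof -
    have "norm (d e m y) = norm (c m) * norm (of_nat (m e) * multi_monom (m(e := m e - 1)) (y - x))"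
      by (simp add: d_def norm_mult)
    also have "\<dots> \<le> norm (c m) * (s ^ (\<Sum>b\<in>Basis. m b) / s)"
      by (intro mult_left_mono norm_monom_derivative_le s small that) auto
    finally show ?thesis by (simp add: a_def)
  qed
  have T: "((\<lambda>y. c m * multi_monom m (y - x)) has_derivative (\<lambda>h. \<Sum>e\<in>Basis. of_real (h \<bullet> e) * d e m y)) (at y)" for m y
  proof -
    have "((\<lambda>y. multi_monom m (y - x)) has_derivative
        (\<lambda>h. \<Sum>e\<in>Basis. of_real (h \<bullet> e) * (of_nat (m e) * multi_monom (m(e := m e - 1)) (y - x)))) (at y)"
      by (rule has_derivative_compose[OF _ monom_derivative]) (auto intro!: derivative_eq_intros)
    from has_derivative_mult_right[OF this, of "c m"] show ?thesis
      by (simp add: d_def sum_distrib_left mult.left_commute)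
  qed
  define M where "M i = real DIM('a) * (a (idx i) / s)" for i
  have M: "summable M" unfolding M_def by (intro summable_mult summable_divide a_sum)
  have Tb: "norm (\<Sum>e\<in>Basis. of_real (h \<bullet> e) * d e (idx i) y) \<le> M i * norm h" if "y \<in> ?U" for i y h
  proof -
    have "norm (\<Sum>e\<in>Basis. of_real (h \<bullet> e) * d e (idx i) y) \<le> (\<Sum>e\<in>(Basis::'a set). norm h * (a (idx i) / s))"
    proof (intro sum_norm_le)
      fix e :: 'a assume e: "e \<in> Basis"
      show "norm (of_real (h \<bullet> e) * d e (idx i) y) \<le> norm h * (a (idx i) / s)"
        unfolding norm_mult norm_of_real
        by (intro mult_mono Basis_le_norm[OF e] d_le[OF that e]) auto
    qed
    then show ?thesis by (simp add: M_def mult.commute mult.left_commute)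
  qed
  have f_sums: "(\<lambda>i. c (idx i) * multi_monom (idx i) (y - x)) sums f y" if "y \<in> ?U" for y
    using c[of y] that has_sum_reindex_bij_betw[OF idx, of "\<lambda>m. c m * multi_monom m (y - x)" "f y"]
    by (intro has_sum_imp_sums) auto
  have deriv: "(f has_derivative (\<lambda>h. \<Sum>i. \<Sum>e\<in>Basis. of_real (h \<bullet> e) * d e (idx i) y)) (at y)" if "y \<in> ?U" for y
    by (rule has_derivative_series_dominated[OF open_ball convex_ball that T Tb M f_sums])
  have xU: "x \<in> ?U" using r s by simp
  show "f differentiable at x" using deriv[OF xU] by (auto simp: differentiable_def)
  assume e: "e \<in> Basis"
  have "((\<lambda>m. of_nat (Suc (m e)) * c (m(e := Suc (m e))) * multi_monom m (y - x)) has_sum dir_deriv e f y) multi_indices"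
    if y: "y \<in> ?U" for y
  proof -
    have "(\<Sum>e'\<in>Basis. of_real (e \<bullet> e') * d e' m y) = d e m y" for m
    proof -
      have "(\<Sum>e'\<in>Basis. of_real (e \<bullet> e') * d e' m y) = (\<Sum>e'\<in>Basis. if e' = e then d e m y else 0)"
        using e by (intro sum.cong) (auto simp: inner_Basis)
      then show ?thesis using e by simp
    qed
    then have dd: "dir_deriv e f y = (\<Sum>i. d e (idx i) y)" using dir_deriv_eq[OF deriv[OF y], of e] by simp
    have sn: "summable (\<lambda>i. norm (d e (idx i) y))"
      by (rule summable_comparison_test'[OF summable_divide[OF a_sum, of s], of 0]) (simp add: d_le[OF y e])
    have "((\<lambda>i. d e (idx i) y) has_sum dir_deriv e f y) UNIV"
      unfolding dd by (rule norm_summable_imp_has_sum[OF sn summable_sums[OF summable_norm_cancel[OF sn]]])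
    then have 1: "((\<lambda>m. d e m y) has_sum dir_deriv e f y) multi_indices"
      using has_sum_reindex_bij_betw[OF idx, of "\<lambda>m. d e m y"] by simp
    \<comment> \<open>Raising the exponent of e by one reindexes the differentiated expansion; the
      indices it misses have \<open>m e = 0\<close> and contribute 0.\<close>
    let ?up = "\<lambda>m. m(e := Suc (m e))"
    have img: "?up ` multi_indices = {m \<in> multi_indices. m e \<noteq> 0}"
    proof (intro equalityI subsetI)
      fix m assume m: "m \<in> {m \<in> multi_indices. m e \<noteq> 0}"
      then have "m = ?up (m(e := m e - 1))" "m(e := m e - 1) \<in> multi_indices"
        using e by (auto simp: multi_indices_def fun_eq_iff)
      then show "m \<in> ?up ` multi_indices" by blast
    qed (use e in \<open>auto simp: multi_indices_def\<close>)
    have "((\<lambda>m. d e m y) has_sum dir_deriv e f y) (?up ` multi_indices)"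
    proof -
      have "((\<lambda>m. d e m y) has_sum dir_deriv e f y) multi_indices \<longleftrightarrow>
          ((\<lambda>m. d e m y) has_sum dir_deriv e f y) {m \<in> multi_indices. m e \<noteq> 0}"
        by (rule has_sum_cong_neutral) (auto simp: d_def)
      then show ?thesis using 1 unfolding img by blast
    qed
    moreover have "inj_on ?up multi_indices"
    proof (rule inj_onI, rule ext)
      fix m m' :: "'a \<Rightarrow> nat" and b assume u: "?up m = ?up m'"
      show "m b = m' b" using fun_cong[OF u, of b] by (cases "b = e") auto
    qed
    ultimately have "(((\<lambda>m. d e m y) \<circ> ?up) has_sum dir_deriv e f y) multi_indices"
      using has_sum_reindex by blast
    moreover have "(\<lambda>m. d e m y) \<circ> ?up = (\<lambda>m. of_nat (Suc (m e)) * c (m(e := Suc (m e))) * multi_monom m (y - x))"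
      by (simp add: fun_eq_iff d_def del: of_nat_Suc)
    ultimately show ?thesis by simp
  qed
  then show "analytic_at_point (dir_deriv e f) x"
    unfolding analytic_at_point_def using r s
    by (intro exI[of _ "min r (s / 2)"] conjI exI[of _ "\<lambda>m. of_nat (Suc (m e)) * c (m(e := Suc (m e)))"]) auto
qed

lemma analytic_at_point_add:
  assumes "analytic_at_point f x" "analytic_at_point g x" shows "analytic_at_point (\<lambda>x. f x + g x) x"
proof -
  obtain r c r' c' where "r > 0" "r' > 0"
    and c: "\<And>y. y \<in> ball x r \<Longrightarrow> ((\<lambda>m. c m * multi_monom m (y - x)) has_sum f y) multi_indices"
    "\<And>y. y \<in> ball x r' \<Longrightarrow> ((\<lambda>m. c' m * multi_monom m (y - x)) has_sum g y) multi_indices"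
    using assms unfolding analytic_at_point_def by blast
  moreover have "((\<lambda>m. (c m + c' m) * multi_monom m (y - x)) has_sum (f y + g y)) multi_indices"
    if "y \<in> ball x (min r r')" for y
    using has_sum_add[OF c(1)[of y] c(2)[of y]] that by (simp add: algebra_simps)
  ultimately show ?thesis unfolding analytic_at_point_def
    by (intro exI[of _ "min r r'"] conjI exI[of _ "\<lambda>m. c m + c' m"]) auto
qed

lemma analytic_at_point_cmult:
  assumes "analytic_at_point f x" shows "analytic_at_point (\<lambda>x. a * f x) x"
proof -
  obtain r c where "r > 0"
    and c: "\<And>y. y \<in> ball x r \<Longrightarrow> ((\<lambda>m. c m * multi_monom m (y - x)) has_sum f y) multi_indices"
    using assms unfolding analytic_at_point_def by blast
  moreover have "((\<lambda>m. (a * c m) * multi_monom m (y - x)) has_sum (a * f y)) multi_indices" if "y \<in> ball x r" for y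
    using has_sum_cmult_right[OF c[OF that], of a] by (simp add: algebra_simps)
  ultimately show ?thesis unfolding analytic_at_point_def
    by (intro exI[of _ r] conjI exI[of _ "\<lambda>m. a * c m"]) auto
qed

lemma analytic_at_point_sum:
  assumes "finite I" "\<And>i. i \<in> I \<Longrightarrow> analytic_at_point (f i) x"
  shows "analytic_at_point (\<lambda>x. \<Sum>i\<in>I. f i x) x"
  using assms
proof (induction I)
  case empty
  have "((\<lambda>m. 0 * multi_monom m (y - x)) has_sum 0) multi_indices" for y by (simp add: has_sum_0)
  then show ?case unfolding analytic_at_point_def by (intro exI[of _ 1] conjI exI[of _ "\<lambda>_. 0"]) auto
qed (auto intro: analytic_at_point_add)

lemma real_analytic_smooth: assumes "real_analytic f" shows "smooth f"
proof (rule smoothI_class[of _ "{f. real_analytic f}"])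
  show "f \<in> {f. real_analytic f}" using assms by simp
  have d: "g differentiable at x" if "real_analytic g" for g :: "'a \<Rightarrow> complex" and x
    using that analytic_at_point_derivative(1) by (auto simp: real_analytic_iff)
  then show "g differentiable at x" if "g \<in> {f. real_analytic f}" for g :: "'a \<Rightarrow> complex" and x
    using that by simp
  fix g :: "'a \<Rightarrow> complex" and v assume "g \<in> {f. real_analytic f}"
  then have g: "real_analytic g" by simp
  have "dir_deriv v g = (\<lambda>x. \<Sum>b\<in>Basis. of_real (v \<bullet> b) * dir_deriv b g x)"
    using dir_deriv_basis[OF d[OF g]] by blast
  then show "dir_deriv v g \<in> {f. real_analytic f}"
    using g analytic_at_point_derivative(2)
    by (auto simp: real_analytic_iff intro!: analytic_at_point_sum analytic_at_point_cmult)
qed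

text \<open>The exponential factors over the coordinates of y - x, and the product of the
  one-variable series expands into a sum over multi-indices that converges for every y.\<close>

lemma analytic_at_point_exp: "analytic_at_point (\<lambda>y. exp (app (\<nu> :: 'a::euclidean_space cdual) y)) x"
proof -
  define c where "c m = exp (app \<nu> x) * (\<Prod>b\<in>Basis. app \<nu> b ^ m b / fact (m b))" for m
  have "((\<lambda>m. c m * multi_monom m (y - x)) has_sum exp (app \<nu> y)) multi_indices" for y
  proof -
    define z where "z b = of_real ((y - x) \<bullet> b) * app \<nu> b" for b
    define t where "t b n = z b ^ n / fact n" for b and n :: nat
    have tn: "summable (\<lambda>n. norm (t b n))" for b
      using summable_norm_exp[of "z b"] by (simp add: t_def norm_divide norm_power scaleR_conv_of_real field_simps)
    have te: "t b sums exp (z b)" for b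
      using exp_converges[of "z b"] by (simp add: t_def[abs_def] scaleR_conv_of_real field_simps)
    have hs: "(t b has_sum exp (z b)) UNIV" for b by (rule norm_summable_imp_has_sum[OF tn te])
    have ab: "Infinite_Sum.abs_summable_on (t b) UNIV" for b
      using hs[of b] summable_on_iff_abs_summable_on_complex[of "t b" UNIV] by (auto simp: summable_on_def)
    let ?P = "PiE (Basis :: 'a set) (\<lambda>_. UNIV :: nat set)"
    have i: "infsum (\<lambda>g. \<Prod>b\<in>Basis. t b (g b)) ?P = (\<Prod>b\<in>Basis. exp (z b))"
      using infsum_prod_PiE_abs[of Basis t "\<lambda>_. UNIV"] ab infsumI[OF hs] by simp
    \<comment> \<open>The identity \<open>i\<close> concerns only the value of
      \<open>infsum\<close>, which exists even without summability, so summability is established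
      separately.\<close>
    have "Infinite_Set_Sum.abs_summable_on (\<lambda>g. \<Prod>b\<in>Basis. t b (g b)) ?P"
    proof (rule abs_summable_on_prod_PiE)
      show "Infinite_Set_Sum.abs_summable_on (t b) UNIV" for b
        using ab[of b] unfolding abs_summable_equivalent .
    qed auto
    then have "(\<lambda>g. \<Prod>b\<in>Basis. t b (g b)) summable_on ?P"
      by (simp only: summable_on_iff_abs_summable_on_complex abs_summable_equivalent)
    from has_sum_infsum[OF this] have h: "((\<lambda>g. \<Prod>b\<in>Basis. t b (g b)) has_sum (\<Prod>b\<in>Basis. exp (z b))) ?P"
      unfolding i .
    have "((\<lambda>m. \<Prod>b\<in>Basis. t b (m b)) has_sum (\<Prod>b\<in>Basis. exp (z b))) multi_indices"
      by (subst has_sum_reindex_bij_betw[OF bij_betw_multi_indices, symmetric]) (use h in simp)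
    then have "((\<lambda>m. exp (app \<nu> x) * (\<Prod>b\<in>Basis. t b (m b))) has_sum
        (exp (app \<nu> x) * (\<Prod>b\<in>Basis. exp (z b)))) multi_indices"
      by (rule has_sum_cmult_right)
    moreover have "exp (app \<nu> x) * (\<Prod>b\<in>Basis. t b (m b)) = c m * multi_monom m (y - x)" for m
      by (simp add: c_def multi_monom_def t_def z_def power_mult_distrib prod_dividef prod.distrib)
    moreover have "exp (app \<nu> x) * (\<Prod>b\<in>Basis. exp (z b)) = exp (app \<nu> y)"
    proof -
      have "app \<nu> (y - x) = app \<nu> (\<Sum>b\<in>Basis. ((y - x) \<bullet> b) *\<^sub>R b)"
        by (simp only: euclidean_representation)
      also have "\<dots> = (\<Sum>b\<in>Basis. z b)"
        by (simp only: blinfun.sum_right blinfun.scaleR_right z_def scaleR_conv_of_real)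
      finally have "app \<nu> y = app \<nu> x + (\<Sum>b\<in>Basis. z b)"
        by (simp add: blinfun.diff_right algebra_simps)
      then show ?thesis by (simp add: exp_add exp_sum)
    qed
    ultimately show ?thesis by simp
  qed
  then show ?thesis unfolding analytic_at_point_def by (intro exI[of _ 1] conjI exI[of _ c]) auto
qed

lemma real_analytic_exp_sum:
  "finite N \<Longrightarrow> real_analytic (\<lambda>y. \<Sum>\<nu>\<in>N. c \<nu> * exp (app (\<nu> :: 'a::euclidean_space cdual) y))"
  unfolding real_analytic_iff
  by (intro allI analytic_at_point_sum analytic_at_point_cmult analytic_at_point_exp)

section \<open>Exponentials and cutoff functions\<close>

lemma has_derivative_exp_blinfun:
  "((\<lambda>y. exp (app (\<nu> :: 'a::euclidean_space cdual) y)) has_derivative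
    (\<lambda>v. app \<nu> v * exp (app \<nu> x))) (at x)"
  using has_derivative_compose[OF bounded_linear_imp_has_derivative[OF blinfun.bounded_linear_right]
      DERIV_exp[THEN has_field_derivative_imp_has_derivative], of \<nu> x UNIV]
  by (simp add: mult.commute)

lemma dir_deriv_exp: "dir_deriv v (\<lambda>y. exp (app \<nu> y)) x = app \<nu> v * exp (app \<nu> x)"
  by (rule dir_deriv_eq[OF has_derivative_exp_blinfun])

lemma smooth_exp_sum:
  "finite N \<Longrightarrow> smooth (\<lambda>y. \<Sum>\<nu>\<in>N. c \<nu> * exp (app (\<nu> :: 'a::euclidean_space cdual) y))"
  by (intro real_analytic_smooth real_analytic_exp_sum)

lemma differentiable_exp: "(\<lambda>y. exp (app (\<nu> :: 'a::euclidean_space cdual) y)) differentiable at x"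
  using has_derivative_exp_blinfun by (auto simp: differentiable_def)

lemma dir_deriv_exp_sum:
  assumes "finite N"
  shows "dir_deriv v (\<lambda>y. \<Sum>\<nu>\<in>N. c \<nu> * exp (app \<nu> y)) x
    = (\<Sum>\<nu>\<in>N. c \<nu> * app \<nu> v * exp (app \<nu> x))"
proof -
  have "dir_deriv v (\<lambda>y. \<Sum>\<nu>\<in>N. c \<nu> * exp (app \<nu> y)) x
      = (\<Sum>\<nu>\<in>N. dir_deriv v (\<lambda>y. c \<nu> * exp (app \<nu> y)) x)"
    by (rule dir_deriv_sum) (intro differentiable_mult differentiable_const differentiable_exp)
  then show ?thesis by (simp add: dir_deriv_cmult[OF differentiable_exp] dir_deriv_exp mult.assoc)
qed

lemma const_coeff_op_exp_sum:
  assumes "const_coeff_op K p D" "finite N"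
  shows "D (\<lambda>x. \<Sum>\<nu>\<in>N. c \<nu> * exp (app \<nu> x)) = (\<lambda>x. \<Sum>\<nu>\<in>N. c \<nu> * p \<nu> * exp (app \<nu> x))"
  using assms(1)
proof (induction arbitrary: c rule: const_coeff_op.induct)
  case (const a)
  show ?case by (simp add: fun_eq_iff sum_distrib_left mult_ac)
next
  case (vector v)
  show ?case by (rule ext) (rule dir_deriv_exp_sum[OF assms(2)])
next
  case (add p D q E)
  then show ?case by (simp add: fun_eq_iff algebra_simps sum.distrib)
next
  case (mult p D q E)
  show ?case unfolding mult.IH by (simp add: mult_ac)
qed

text \<open>The derivative along v minus multiplication by \<nu>0(v) removes the exponent \<nu>0 and
  multiplies each other coefficient by \<nu>(v) - \<nu>0(v), which is nonzero for a suitable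
  v.\<close>

lemma exp_linear_independent:
  fixes N :: "'a::euclidean_space cdual set"
  assumes "finite N" "open U" "U \<noteq> {}" "\<And>x. x \<in> U \<Longrightarrow> (\<Sum>\<nu>\<in>N. c \<nu> * exp (app \<nu> x)) = 0" "\<nu> \<in> N"
  shows "c \<nu> = 0"
  using assms(1,4,5)
proof (induction N arbitrary: c \<nu>)
  case (insert \<nu>0 N)
  have IHc: "c \<nu> = 0" if n: "\<nu> \<in> N" for \<nu>
  proof -
    have *: "c \<nu> * (app \<nu> v - app \<nu>0 v) = 0" for v
    proof (rule insert.IH[OF _ n, of "\<lambda>\<nu>. c \<nu> * (app \<nu> v - app \<nu>0 v)"])
      fix x assume x: "x \<in> U"
      let ?f = "\<lambda>y. \<Sum>\<nu>\<in>insert \<nu>0 N. c \<nu> * exp (app \<nu> y)"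
      have "dir_deriv v ?f x = dir_deriv v (\<lambda>x. 0) x"
        by (rule dir_deriv_local(2)[OF assms(2) x]) (simp_all only: insert.prems(1) differentiable_const)
      then have "(\<Sum>\<nu>\<in>insert \<nu>0 N. c \<nu> * app \<nu> v * exp (app \<nu> x)) = 0"
        using dir_deriv_exp_sum[of "insert \<nu>0 N" v c x] insert.hyps by simp
      then have "(\<Sum>\<nu>\<in>insert \<nu>0 N. c \<nu> * app \<nu> v * exp (app \<nu> x)) - app \<nu>0 v * ?f x = 0"
        using insert.prems(1)[OF x] by simp
      moreover have "(\<Sum>\<nu>\<in>insert \<nu>0 N. c \<nu> * app \<nu> v * exp (app \<nu> x)) - app \<nu>0 v * ?f x
          = (\<Sum>\<nu>\<in>insert \<nu>0 N. c \<nu> * (app \<nu> v - app \<nu>0 v) * exp (app \<nu> x))"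
        by (simp only: sum_distrib_left sum_subtractf[symmetric]) (simp add: algebra_simps)
      ultimately show "(\<Sum>\<nu>\<in>N. c \<nu> * (app \<nu> v - app \<nu>0 v) * exp (app \<nu> x)) = 0"
        using insert.hyps by simp
    qed
    have "\<nu> \<noteq> \<nu>0" using n insert.hyps by auto
    then obtain v where "app \<nu> v \<noteq> app \<nu>0 v" using blinfun_eqI by blast
    then show ?thesis using *[of v] by simp
  qed
  obtain x where x: "x \<in> U" using assms(3) by blast
  have "c \<nu>0 * exp (app \<nu>0 x) = 0" using insert.prems(1)[OF x] insert.hyps IHc by simp
  then have "c \<nu>0 = 0" by simp
  then show ?case using insert.prems(2) IHc by blast
qed simp

text \<open>
  Dedekind's independence of characters, for the characters \<open>\<nu> \<mapsto> exp (\<nu>(y))\<close> of the monoid \<open>M\<close>;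
  different points \<open>y\<close> may give the same character.
\<close>

lemma characters_independent:
  fixes M :: "'a::euclidean_space cdual set"
  assumes M: "0 \<in> M" "\<And>\<nu> \<eta>. \<nu> \<in> M \<Longrightarrow> \<eta> \<in> M \<Longrightarrow> \<nu> + \<eta> \<in> M"
  assumes "finite I" "\<And>\<nu>. \<nu> \<in> M \<Longrightarrow> (\<Sum>i\<in>I. c i * exp (app \<nu> (y i))) = 0" "j \<in> I"
  shows "(\<Sum>i | i \<in> I \<and> (\<forall>\<nu>\<in>M. exp (app \<nu> (y i)) = exp (app \<nu> (y j))). c i) = 0"
  using assms(3-5)
proof (induction "card I" arbitrary: I c rule: less_induct)
  case less
  define E where "E i k \<longleftrightarrow> (\<forall>\<nu>\<in>M. exp (app \<nu> (y i)) = exp (app \<nu> (y k)))" for i k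
  have fin: "finite I" and j: "j \<in> I" using less.prems by auto
  have "(\<Sum>i | i \<in> I \<and> E i j. c i) = 0"
  proof (cases "\<forall>k\<in>I. E k j")
    case True
    then have "{i. i \<in> I \<and> E i j} = I" by auto
    then show ?thesis using less.prems(2)[OF M(1)] by simp
  next
    case False
    then obtain k where k: "k \<in> I" "\<not> E k j" by blast
    then obtain \<eta> where eta: "\<eta> \<in> M" "exp (app \<eta> (y k)) \<noteq> exp (app \<eta> (y j))"
      unfolding E_def by metis
    \<comment> \<open>Twisting the relation by \<eta> and subtracting
      \<open>exp (app \<eta> (y k))\<close> times the original gives the coefficients
      \<open>c i * d i\<close>, and the whole class of k drops out.\<close>
    define d where "d i = exp (app \<eta> (y i)) - exp (app \<eta> (y k))" for i
    let ?J = "{i \<in> I. \<not> E i k}"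
    have J: "finite ?J" "card ?J < card I" "j \<in> ?J"
    proof -
      show "card ?J < card I" by (rule psubset_card_mono[OF fin]) (use k in \<open>auto simp: E_def\<close>)
      show "j \<in> ?J" using j k(2) unfolding E_def mem_Collect_eq by metis
    qed (use fin in simp)
    have "(\<Sum>i\<in>?J. c i * d i * exp (app \<nu> (y i))) = 0" if nu: "\<nu> \<in> M" for \<nu>
    proof -
      have "(\<Sum>i\<in>?J. c i * d i * exp (app \<nu> (y i))) = (\<Sum>i\<in>I. c i * d i * exp (app \<nu> (y i)))"
        by (rule sum.mono_neutral_left) (use fin eta(1) in \<open>auto simp: E_def d_def\<close>)
      also have "\<dots> = (\<Sum>i\<in>I. c i * exp (app (\<nu> + \<eta>) (y i)))
          - exp (app \<eta> (y k)) * (\<Sum>i\<in>I. c i * exp (app \<nu> (y i)))"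
        by (simp add: d_def blinfun.add_left exp_add sum_distrib_left sum_subtractf algebra_simps)
      also have "\<dots> = 0" using less.prems(2)[OF nu] less.prems(2)[OF M(2)[OF nu eta(1)]] by simp
      finally show ?thesis .
    qed
    from less.hyps[OF J(2,1) this J(3)] have "(\<Sum>i | i \<in> ?J \<and> E i j. c i * d i) = 0" by (simp add: E_def)
    moreover have "{i. i \<in> ?J \<and> E i j} = {i. i \<in> I \<and> E i j}" using J(3) by (auto simp: E_def)
    moreover have "(\<Sum>i | i \<in> I \<and> E i j. c i * d i) = (\<Sum>i | i \<in> I \<and> E i j. c i * d j)"
      by (rule sum.cong) (use eta(1) in \<open>auto simp: E_def d_def\<close>)
    ultimately have "(\<Sum>i | i \<in> I \<and> E i j. c i) * d j = 0" by (simp add: sum_distrib_right)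
    then show ?thesis using eta(2) by (auto simp: d_def)
  qed
  then show ?case by (simp add: E_def)
qed

text \<open>
  The functions \<open>flat p\<close> are closed under differentiation; \<open>flat 1\<close> is a smooth transition from \<open>0\<close> on
  the negative half line to \<open>1\<close> at infinity.
\<close>

definition flat :: "real poly \<Rightarrow> real \<Rightarrow> real" where
  "flat p t = (if t > 0 then poly p (1 / t) * exp (- (1 / t)) else 0)"

text \<open>With y = 1/t the derivative of p(y) exp(-y) in t is y^2 (p(y) - p'(y)) exp(-y).\<close>

definition flat_deriv :: "real poly \<Rightarrow> real poly" where
  "flat_deriv p = [:0, 0, 1:] * (p - pderiv p)"

lemma poly_exp_tendsto_0: "((\<lambda>y. poly p y * exp (- y)) \<longlongrightarrow> 0) (at_top :: real filter)"
proof -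
  have "((\<lambda>y. \<Sum>i\<le>degree p. coeff p i * (y ^ i / exp y)) \<longlongrightarrow> (\<Sum>i\<le>degree p. coeff p i * 0)) at_top"
    by (intro tendsto_intros tendsto_power_div_exp_0)
  moreover have "(\<lambda>y. \<Sum>i\<le>degree p. coeff p i * (y ^ i / exp y)) = (\<lambda>y. poly p y * exp (- y))"
    by (simp add: fun_eq_iff poly_altdef exp_minus sum_distrib_right divide_inverse mult.assoc)
  ultimately show ?thesis by simp
qed

lemma flat_has_derivative: "(flat p has_real_derivative flat (flat_deriv p) t) (at t)"
proof (cases t "0 :: real" rule: linorder_cases)
  case greater
  have "((\<lambda>t. poly p (1 / t) * exp (- (1 / t))) has_real_derivative flat (flat_deriv p) t) (at t)"
    using greater
    by (auto intro!: derivative_eq_intros simp: flat_def flat_deriv_def power2_eq_square field_simps)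
  then show ?thesis
    by (rule has_field_derivative_transform_within_open[of _ _ _ "{0<..}"]) (use greater in \<open>auto simp: flat_def\<close>)
next
  case less
  have "((\<lambda>t. 0) has_real_derivative flat (flat_deriv p) t) (at t)" using less by (simp add: flat_def)
  then show ?thesis
    by (rule has_field_derivative_transform_within_open[of _ _ _ "{..<0}"]) (use less in \<open>auto simp: flat_def\<close>)
next
  case equal
  \<comment> \<open>At 0 the right difference quotient is p(1/h) exp(-1/h) / h; the factor
    \<open>[:0, 1:]\<close> accounts for the division by h.\<close>
  have "((\<lambda>y. poly ([:0, 1:] * p) y * exp (- y)) \<longlongrightarrow> 0) at_top" by (rule poly_exp_tendsto_0)
  then have "((\<lambda>h. poly ([:0, 1:] * p) (inverse h) * exp (- inverse h)) \<longlongrightarrow> 0) (at_right 0)"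
    by (rule filterlim_compose[OF _ filterlim_inverse_at_top_right])
  then have "((\<lambda>h. (flat p (0 + h) - flat p 0) / h) \<longlongrightarrow> 0) (at_right 0)"
    by (rule Lim_transform_eventually) (auto simp: eventually_at_right_less eventually_at_filter flat_def field_simps inverse_eq_divide)
  moreover have "((\<lambda>h. (flat p (0 + h) - flat p 0) / h) \<longlongrightarrow> 0) (at_left 0)"
    by (rule Lim_transform_eventually[OF tendsto_const]) (auto simp: eventually_at_filter flat_def)
  ultimately have "((\<lambda>h. (flat p (0 + h) - flat p 0) / h) \<longlongrightarrow> 0) (at 0)" by (rule filterlim_split_at[rotated])
  then show ?thesis using equal by (simp add: DERIV_def flat_def)
qed

lemma flat_bounded: "\<exists>K\<ge>0. \<forall>t. \<bar>flat p t\<bar> \<le> K"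
proof -
  let ?g = "\<lambda>y. poly p y * exp (- y)"
  have "\<forall>\<^sub>F y in at_top. \<bar>?g y\<bar> < 1"
    using tendstoD[OF poly_exp_tendsto_0[of p], of 1] by simp
  then obtain Y where Y: "\<And>y. y \<ge> Y \<Longrightarrow> \<bar>?g y\<bar> < 1" unfolding eventually_at_top_linorder by blast
  have "compact (?g ` {0..Y})" by (intro compact_continuous_image continuous_intros) auto
  then have "bounded (?g ` {0..Y})" by (rule compact_imp_bounded)
  then obtain K where "\<forall>z\<in>?g ` {0..Y}. norm z \<le> K" unfolding bounded_iff by blast
  then have K: "\<bar>?g y\<bar> \<le> K" if "y \<in> {0..Y}" for y using that by force
  have "\<bar>?g y\<bar> \<le> max 1 K" if "y \<ge> 0" for y
    using Y[of y] K[of y] that by (cases "y \<ge> Y") (auto simp: less_imp_le le_max_iff_disj)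
  then have "\<bar>flat p t\<bar> \<le> max 1 K" for t by (auto simp: flat_def le_max_iff_disj)
  then show ?thesis by (intro exI[of _ "max 1 K"]) auto
qed

lemma flat_at_top: "(flat p \<longlongrightarrow> poly p 0) at_top"
proof -
  have "((\<lambda>t. poly p (inverse t) * exp (- inverse t)) \<longlongrightarrow> poly p 0 * exp (- 0)) (at_top :: real filter)"
    by (intro tendsto_intros tendsto_inverse_0_at_top filterlim_ident)
  then have "((\<lambda>t. poly p (inverse t) * exp (- inverse t)) \<longlongrightarrow> poly p 0) (at_top :: real filter)" by simp
  then show ?thesis
    by (rule Lim_transform_eventually)
      (use eventually_gt_at_top[of "0::real"] in \<open>eventually_elim, simp add: flat_def inverse_eq_divide\<close>)
qed

text \<open>In the applications \<xi> + s is n j - 1 for a simple affine root j. Then the cutoff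
  vanishes on the strip j \<le> 1/n and, for p = 1, tends to 1 inside the alcove. The polynomial is
  a parameter because differentiation changes it.\<close>

definition cutoff :: "real poly \<Rightarrow> 'a::euclidean_space dual \<Rightarrow> real \<Rightarrow> 'a \<Rightarrow> complex" where
  "cutoff p \<xi> s x = of_real (flat p (app \<xi> x + s))"

lemma has_derivative_cutoff:
  "(cutoff p \<xi> s has_derivative (\<lambda>v. of_real (app \<xi> v) * cutoff (flat_deriv p) \<xi> s x)) (at x)"
proof -
  have "((\<lambda>x. flat p (app \<xi> x + s)) has_derivative
      (\<lambda>v. flat (flat_deriv p) (app \<xi> x + s) * app \<xi> v)) (at x)"
    by (rule has_derivative_compose[OF _ flat_has_derivative[unfolded has_field_derivative_def]])
      (auto intro!: derivative_eq_intros)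
  then have "((\<lambda>x. complex_of_real (flat p (app \<xi> x + s))) has_derivative
      (\<lambda>v. of_real (flat (flat_deriv p) (app \<xi> x + s) * app \<xi> v))) (at x)"
    by (rule has_derivative_of_real)
  then show ?thesis by (simp add: cutoff_def[abs_def] mult.commute)
qed

lemma dir_deriv_cutoff: "dir_deriv v (cutoff p \<xi> s) x = of_real (app \<xi> v) * cutoff (flat_deriv p) \<xi> s x"
  by (rule dir_deriv_eq[OF has_derivative_cutoff])

lemma smooth_cutoff: "smooth (cutoff p \<xi> s)"
proof (rule smoothI_class[of _ "{f. \<exists>c q. f = (\<lambda>x. c * cutoff q \<xi> s x)}"])
  have "cutoff p \<xi> s = (\<lambda>x. 1 * cutoff p \<xi> s x)" by simp
  then show "cutoff p \<xi> s \<in> {f. \<exists>c q. f = (\<lambda>x. c * cutoff q \<xi> s x)}" by blast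
next
  fix g :: "'a \<Rightarrow> complex" and x v assume "g \<in> {f. \<exists>c q. f = (\<lambda>x. c * cutoff q \<xi> s x)}"
  then obtain c q where g: "g = (\<lambda>x. c * cutoff q \<xi> s x)" by blast
  have d: "cutoff q \<xi> s differentiable at x" for x using has_derivative_cutoff unfolding differentiable_def by blast
  show "g differentiable at x" unfolding g by (intro differentiable_mult differentiable_const d)
  have "dir_deriv v g = (\<lambda>x. (c * of_real (app \<xi> v)) * cutoff (flat_deriv q) \<xi> s x)"
    unfolding g by (rule ext) (simp add: dir_deriv_cmult[OF d] dir_deriv_cutoff)
  then show "dir_deriv v g \<in> {f. \<exists>c q. f = (\<lambda>x. c * cutoff q \<xi> s x)}" by blast
qed

section \<open>The Laplacian\<close>

definition laplacian :: "('a::euclidean_space \<Rightarrow> complex) \<Rightarrow> 'a \<Rightarrow> complex" where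
  "laplacian f x = (\<Sum>b\<in>Basis. dir_deriv b (dir_deriv b f) x)"

text \<open>The complex bilinear, not Hermitian, extension of the squared norm: the symbol of the
  Laplacian has to be a polynomial.\<close>

definition sq_poly :: "'a::euclidean_space cdual \<Rightarrow> complex" where
  "sq_poly \<xi> = (\<Sum>b\<in>Basis. app \<xi> b * app \<xi> b)"

lemma const_coeff_op_sum:
  assumes "finite I" "0 \<in> K" "\<And>i. i \<in> I \<Longrightarrow> const_coeff_op K (p i) (D i)"
  shows "const_coeff_op K (\<lambda>\<xi>. \<Sum>i\<in>I. p i \<xi>) (\<lambda>f x. \<Sum>i\<in>I. D i f x)"
  using assms(1,3)
proof (induction I)
  case empty
  show ?case using const_coeff_op.const[OF assms(2)] by simp
next
  case (insert i I)
  then show ?case using const_coeff_op.add[of K "p i" "D i"] by simp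
qed

lemma const_coeff_op_prod:
  assumes "finite I" "1 \<in> K" "\<And>i. i \<in> I \<Longrightarrow> \<exists>D. const_coeff_op K (p i) D"
  shows "\<exists>D. const_coeff_op K (\<lambda>\<xi>. \<Prod>i\<in>I. p i \<xi>) D"
  using assms(1,3)
proof (induction I)
  case empty
  show ?case using const_coeff_op.const[OF assms(2)] by auto
next
  case (insert i I)
  then obtain D E where "const_coeff_op K (p i) D" "const_coeff_op K (\<lambda>\<xi>. \<Prod>i\<in>I. p i \<xi>) E" by blast
  from const_coeff_op.mult[OF this] show ?case using insert.hyps by auto
qed

lemma const_coeff_op_laplacian: "0 \<in> K \<Longrightarrow> const_coeff_op K sq_poly laplacian"
  unfolding sq_poly_def[abs_def] laplacian_def[abs_def]
  by (intro const_coeff_op_sum const_coeff_op.mult const_coeff_op.vector) auto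

lemma sq_poly_minus: "sq_poly (- \<xi>) = sq_poly \<xi>"
  by (simp add: sq_poly_def blinfun.minus_left)

lemma laplacian_mult:
  assumes "smooth f" "smooth g"
  shows "laplacian (\<lambda>x. f x * g x) x = f x * laplacian g x
    + 2 * (\<Sum>b\<in>Basis. dir_deriv b f x * dir_deriv b g x) + laplacian f x * g x"
proof -
  have d: "f differentiable at x" "g differentiable at x" "dir_deriv v f differentiable at x" "dir_deriv v g differentiable at x" for v x
    using assms by (auto intro: smooth_differentiable smooth_dir_deriv)
  have 1: "dir_deriv b (\<lambda>x. f x * g x) = (\<lambda>x. f x * dir_deriv b g x + dir_deriv b f x * g x)" for b
    by (rule ext) (rule dir_deriv_mult[OF d(1,2)])
  have "dir_deriv b (dir_deriv b (\<lambda>x. f x * g x)) x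
      = f x * dir_deriv b (dir_deriv b g) x + 2 * (dir_deriv b f x * dir_deriv b g x) + dir_deriv b (dir_deriv b f) x * g x" for b
    unfolding 1 by (subst dir_deriv_add) (auto simp: dir_deriv_mult d algebra_simps intro!: differentiable_mult d)
  then show ?thesis by (simp add: laplacian_def sum.distrib sum_distrib_left sum_distrib_right)
qed

lemma laplacian_cutoff:
  "laplacian (cutoff p \<xi> s) x = of_real (riesz \<xi> \<bullet> riesz \<xi>) * cutoff (flat_deriv (flat_deriv p)) \<xi> s x"
proof -
  have 1: "dir_deriv b (cutoff p \<xi> s) = (\<lambda>x. of_real (app \<xi> b) * cutoff (flat_deriv p) \<xi> s x)" for b
    by (rule ext) (rule dir_deriv_cutoff)
  have "laplacian (cutoff p \<xi> s) x
      = (\<Sum>b\<in>Basis. of_real (app \<xi> b * app \<xi> b) * cutoff (flat_deriv (flat_deriv p)) \<xi> s x)"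
    unfolding laplacian_def 1
    by (simp add: dir_deriv_cmult[OF smooth_differentiable[OF smooth_cutoff]] dir_deriv_cutoff mult.assoc)
  also have "(\<Sum>b\<in>Basis. of_real (app \<xi> b * app \<xi> b) * cutoff (flat_deriv (flat_deriv p)) \<xi> s x)
     = of_real (\<Sum>b\<in>Basis. app \<xi> b * app \<xi> b) * cutoff (flat_deriv (flat_deriv p)) \<xi> s x"
    by (simp only: sum_distrib_right of_real_sum)
  also have "(\<Sum>b\<in>Basis. app \<xi> b * app \<xi> b) = riesz \<xi> \<bullet> riesz \<xi>"
    using dual_inner_riesz[of \<xi> \<xi>] by (simp add: dual_inner_def)
  finally show ?thesis .
qed

lemma smooth_laplacian: "smooth f \<Longrightarrow> smooth (laplacian f)"
  unfolding laplacian_def[abs_def] by (intro smooth_sum smooth_dir_deriv)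

section \<open>Antisymmetric exponential sums and the Dirichlet problem\<close>

context root_data begin

abbreviation "PW \<equiv> two_pi_i_weights R"

lemma dual_act_apply:
  assumes "w \<in> W0" shows "app (dual_act w \<nu>) v = app \<nu> (inv w v)"
proof -
  have "linear (inv w)" by (rule W0_linear[OF W0_inv[OF assms]])
  then have "bounded_linear (\<lambda>v. app \<nu> (inv w v))"
    by (intro bounded_linear_compose[OF blinfun.bounded_linear_right]) (simp add: linear_conv_bounded_linear)
  then show ?thesis unfolding dual_act_def by (simp add: bounded_linear_Blinfun_apply)
qed

lemma PW_E:
  assumes "\<nu> \<in> PW" obtains \<xi> where "\<xi> \<in> P" "\<And>v. app \<nu> v = 2 * of_real pi * \<i> * of_real (app \<xi> v)"
  using assms unfolding two_pi_i_weights_def by blast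

lemma PW_I: "\<xi> \<in> P \<Longrightarrow> (\<And>v. app \<nu> v = 2 * of_real pi * \<i> * of_real (app \<xi> v)) \<Longrightarrow> \<nu> \<in> PW"
  unfolding two_pi_i_weights_def by blast

lemma PW_0: "0 \<in> PW"
  by (rule PW_I[of 0]) (auto simp: weight_lattice_def)

lemma PW_add: assumes "\<nu> \<in> PW" "\<eta> \<in> PW" shows "\<nu> + \<eta> \<in> PW"
proof -
  obtain \<xi> \<zeta> where "\<xi> \<in> P" "\<And>v. app \<nu> v = 2 * of_real pi * \<i> * of_real (app \<xi> v)"
    "\<zeta> \<in> P" "\<And>v. app \<eta> v = 2 * of_real pi * \<i> * of_real (app \<zeta> v)" using assms PW_E by metis
  then show ?thesis
    by (intro PW_I[of "\<xi> + \<zeta>"]) (auto simp: weight_lattice_def blinfun.add_left algebra_simps)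
qed

lemma PW_minus: assumes "\<nu> \<in> PW" shows "- \<nu> \<in> PW"
proof -
  obtain \<xi> where "\<xi> \<in> P" "\<And>v. app \<nu> v = 2 * of_real pi * \<i> * of_real (app \<xi> v)"
    using assms PW_E by metis
  then show ?thesis by (intro PW_I[of "- \<xi>"]) (auto simp: weight_lattice_def blinfun.minus_left)
qed

lemma PW_dual_act: assumes "\<nu> \<in> PW" "w \<in> W0" shows "dual_act w \<nu> \<in> PW"
proof -
  obtain \<xi> where x: "\<xi> \<in> P" "\<And>v. app \<nu> v = 2 * of_real pi * \<i> * of_real (app \<xi> v)"
    using assms PW_E by metis
  have "linear (inv w)" by (rule W0_linear[OF W0_inv[OF assms(2)]])
  then have "bounded_linear (\<lambda>v. app \<xi> (inv w v))"
    by (intro bounded_linear_compose[OF blinfun.bounded_linear_right]) (simp add: linear_conv_bounded_linear)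
  then have b: "app (Blinfun (\<lambda>v. app \<xi> (inv w v))) v = app \<xi> (inv w v)" for v
    by (simp add: bounded_linear_Blinfun_apply)
  have "Blinfun (\<lambda>v. app \<xi> (inv w v)) \<in> P"
    unfolding weight_lattice_def
  proof clarify
    fix \<alpha> assume "\<alpha> \<in> R"
    then obtain \<beta> where "\<beta> \<in> R" "inv w (coroot \<alpha>) = coroot \<beta>" using W0_coroot[OF W0_inv[OF assms(2)]] by blast
    then show "app (Blinfun (\<lambda>v. app \<xi> (inv w v))) (coroot \<alpha>) \<in> \<int>"
      using x(1) by (simp add: b weight_lattice_def)
  qed
  then show ?thesis by (rule PW_I) (simp add: dual_act_apply assms(2) x(2) b)
qed

lemma PW_cnj_exp: "\<nu> \<in> PW \<Longrightarrow> cnj (exp (app \<nu> v)) = exp (app (- \<nu>) v)"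
  by (elim PW_E) (simp add: exp_cnj blinfun.minus_left)

lemma PW_exp_Q:
  assumes "\<nu> \<in> PW" "\<alpha> \<in> R" shows "exp (app \<nu> (of_int k *\<^sub>R coroot \<alpha>)) = 1"
proof -
  obtain \<xi> where x: "\<xi> \<in> P" "\<And>v. app \<nu> v = 2 * of_real pi * \<i> * of_real (app \<xi> v)"
    using assms PW_E by metis
  then have "app \<xi> (coroot \<alpha>) \<in> \<int>" using assms(2) by (auto simp: weight_lattice_def)
  then obtain n where "app \<xi> (coroot \<alpha>) = of_int n" by (rule Ints_cases)
  then have "app \<nu> (of_int k *\<^sub>R coroot \<alpha>) = 2 * of_int (k * n) * of_real pi * \<i>"
    by (simp add: x(2) blinfun.scaleR_right scaleR_conv_of_real)
  moreover have "exp (2 * of_int (k * n) * of_real pi * \<i>) = 1"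
    using exp_2pi_1_int[of "k * n"] by (simp add: mult_ac)
  ultimately show ?thesis by (simp only:)
qed

text \<open>Equal exponentials force every weight to be integral at x - y, and the coroot lattice is
  the dual of the weight lattice.\<close>

lemma PW_exp_eq_imp_Q:
  assumes "\<And>\<nu>. \<nu> \<in> PW \<Longrightarrow> exp (app \<nu> x) = exp (app \<nu> y)" shows "x - y \<in> Q"
proof (rule P_dual)
  fix \<xi> assume xi: "\<xi> \<in> P"
  define \<nu> :: "'a cdual" where "\<nu> = Blinfun (\<lambda>v. 2 * of_real pi * \<i> * of_real (app \<xi> v))"
  have "bounded_linear (\<lambda>v. 2 * of_real pi * \<i> * of_real (app \<xi> v))"
    by (intro bounded_linear_compose[OF bounded_linear_mult_right]
        bounded_linear_compose[OF bounded_linear_of_real blinfun.bounded_linear_right])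
  then have app: "app \<nu> v = 2 * of_real pi * \<i> * of_real (app \<xi> v)" for v
    unfolding \<nu>_def by (simp add: bounded_linear_Blinfun_apply)
  have "\<nu> \<in> PW" using xi app by (rule PW_I)
  from assms[OF this] have "exp (app \<nu> x - app \<nu> y) = 1" by (simp add: exp_diff)
  then have "exp (\<i> * of_real (2 * pi * app \<xi> (x - y))) = 1"
    by (simp add: app blinfun.diff_right algebra_simps)
  then obtain n where "2 * pi * app \<xi> (x - y) = of_int (2 * n) * pi"
    by (auto simp: exp_eq_1)
  then have "app \<xi> (x - y) = of_int n" by simp
  then show "app \<xi> (x - y) \<in> \<int>" by simp
qed

text \<open>At 2\<pi>i\<xi> the value of \<open>sq_poly\<close> is -4\<pi>^2 times the squared norm
  of \<xi>, so a level is bounded.\<close>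

lemma finite_PW_level: "finite {\<nu> \<in> PW. sq_poly \<nu> = c}"
proof -
  define \<tau> :: "'a dual \<Rightarrow> 'a cdual" where "\<tau> \<xi> = Blinfun (\<lambda>v. 2 * of_real pi * \<i> * of_real (app \<xi> v))" for \<xi>
  have "bounded_linear (\<lambda>v. 2 * of_real pi * \<i> * of_real (app \<xi> v))" for \<xi> :: "'a dual"
    by (intro bounded_linear_compose[OF bounded_linear_mult_right]
        bounded_linear_compose[OF bounded_linear_of_real blinfun.bounded_linear_right])
  then have app: "app (\<tau> \<xi>) v = 2 * of_real pi * \<i> * of_real (app \<xi> v)" for \<xi> v
    unfolding \<tau>_def by (simp add: bounded_linear_Blinfun_apply)
  have "{\<nu> \<in> PW. sq_poly \<nu> = c} \<subseteq> \<tau> ` {\<xi> \<in> P. norm \<xi> \<le> 1 + norm c}"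
  proof
    fix \<nu> assume nu: "\<nu> \<in> {\<nu> \<in> PW. sq_poly \<nu> = c}"
    then obtain \<xi> where x: "\<xi> \<in> P" "\<And>v. app \<nu> v = 2 * of_real pi * \<i> * of_real (app \<xi> v)"
      using PW_E by blast
    have "\<nu> = \<tau> \<xi>" by (rule blinfun_eqI) (simp add: x app)
    have "sq_poly \<nu> = of_real (- (4 * pi\<^sup>2) * (\<Sum>b\<in>Basis. app \<xi> b * app \<xi> b))"
      unfolding sq_poly_def x(2) by (simp add: sum_distrib_left power2_eq_square algebra_simps sum_negf)
    also have "(\<Sum>b\<in>Basis. app \<xi> b * app \<xi> b) = (norm \<xi>)\<^sup>2"
      using dual_inner_riesz[of \<xi> \<xi>] by (simp add: dual_inner_def norm_riesz dot_square_norm)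
    finally have s: "sq_poly \<nu> = of_real (- (4 * pi\<^sup>2) * (norm \<xi>)\<^sup>2)" .
    have "norm (sq_poly \<nu>) = 4 * pi\<^sup>2 * (norm \<xi>)\<^sup>2" unfolding s norm_of_real by (simp add: abs_mult)
    then have "norm c = 4 * pi\<^sup>2 * (norm \<xi>)\<^sup>2" using nu by simp
    moreover have "4 * pi\<^sup>2 \<ge> 1"
      using power_mono[OF pi_ge_two, of 2] by simp
    ultimately have "(norm \<xi>)\<^sup>2 \<le> norm c" using mult_right_mono[of 1 "4 * pi\<^sup>2" "(norm \<xi>)\<^sup>2"] by simp
    \<comment> \<open>A crude bound that avoids a square root.\<close>
    also have "\<dots> \<le> (1 + norm c)\<^sup>2" by (simp add: power2_eq_square algebra_simps)
    finally have "norm \<xi> \<le> 1 + norm c" by (rule power2_le_imp_le) simp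
    then show "\<nu> \<in> \<tau> ` {\<xi> \<in> P. norm \<xi> \<le> 1 + norm c}" using x(1) \<open>\<nu> = \<tau> \<xi>\<close> by blast
  qed
  then show ?thesis using finite_P_bounded finite_subset by blast
qed

text \<open>The numerator of the Weyl character formula. It is antisymmetric under \<open>W0\<close>
  for every complex \<nu>; for the translations in \<open>W\<close> the exponent is taken in
  2\<pi>iP, see \<open>anti_A\<close>.\<close>

definition A :: "'a cdual \<Rightarrow> 'a \<Rightarrow> complex" where
  "A \<nu> x = (\<Sum>w\<in>W0. eps w * exp (app \<nu> (w x)))"

lemma A_dual_act: "A \<nu> x = (\<Sum>w\<in>W0. eps w * exp (app (dual_act w \<nu>) x))"
proof -
  have "A \<nu> x = (\<Sum>w\<in>W0. eps (inv w) * exp (app \<nu> (inv w x)))"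
    unfolding A_def by (rule sum.reindex_bij_betw[OF bij_betw_W0_inv, symmetric])
  then show ?thesis by (simp add: dual_act_apply eps_inv W0_W cong: sum.cong)
qed

lemma smooth_A: "smooth (A \<nu>)"
proof -
  have "smooth (\<lambda>x. exp (app \<nu> x))" for \<nu> :: "'a cdual"
    using smooth_exp_sum[of "{\<nu>}" "\<lambda>_. 1"] by simp
  then show ?thesis unfolding A_dual_act[abs_def] by (intro smooth_sum smooth_cmult)
qed

lemma A_W0: "u \<in> W0 \<Longrightarrow> A \<nu> (u x) = eps u * A \<nu> x"
proof -
  assume u: "u \<in> W0"
  have "A \<nu> x = (\<Sum>w\<in>W0. eps (w \<circ> u) * exp (app \<nu> ((w \<circ> u) x)))"
    unfolding A_def by (rule sum.reindex_bij_betw[OF bij_betw_W0_comp_right[OF u], symmetric])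
  also have "\<dots> = eps u * A \<nu> (u x)" unfolding A_def sum_distrib_left
    by (rule sum.cong) (simp_all add: eps_comp W0_W u)
  finally have "eps u * A \<nu> x = (eps u * eps u) * A \<nu> (u x)" by simp
  then show ?thesis by (simp add: eps_square)
qed

lemma antiI: assumes "\<And>a v. a \<in> Sig \<Longrightarrow> f (aff_refl a v) = - f v" shows "anti f"
  unfolding anti_def
proof
  fix w assume "w \<in> W"
  then show "\<forall>v. f (w v) = eps w * f v"
  proof (induction rule: W_induct)
    case (refl a w)
    have e: "eps (aff_refl a \<circ> w) = - eps w"
      by (simp only: eps_comp[OF aff_refl_W[OF refl(1)] refl(2)] eps_refl[OF refl(1)] mult_minus1)
    show ?case unfolding e using refl assms by simp
  qed simp
qed

text \<open>An affine reflection is a linear one followed by an integral multiple of a coroot.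
  \<open>W0\<close> permutes the coroots, and the exponentials in question are trivial on their
  integral multiples.\<close>

lemma anti_A: assumes "\<nu> \<in> PW" shows "anti (A \<nu>)"
proof (rule antiI)
  fix a v assume "a \<in> Sig"
  then obtain \<alpha> k where a: "a = (\<alpha>, of_int k)" "\<alpha> \<in> R" by (auto simp: aff_roots_def)
  let ?s = "aff_refl (\<alpha>, 0)"
  have "exp (app \<nu> (w (aff_refl a v))) = exp (app \<nu> (w (?s v)))" if w: "w \<in> W0" for w
  proof -
    obtain \<beta> where b: "\<beta> \<in> R" "w (coroot \<alpha>) = coroot \<beta>" using W0_coroot[OF w a(2)] by blast
    have "aff_refl a v = ?s v + of_int (- k) *\<^sub>R coroot \<alpha>"
      by (simp add: a aff_refl_def aff_apply_def algebra_simps)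
    then have "w (aff_refl a v) = w (?s v) + of_int (- k) *\<^sub>R coroot \<beta>"
      using W0_linear[OF w] b(2) by (simp add: linear_add linear_scale linear_neg linear_diff)
    then show ?thesis by (simp only: blinfun.add_right exp_add PW_exp_Q[OF assms b(1)] mult_1_right)
  qed
  then have "A \<nu> (aff_refl a v) = A \<nu> (?s v)" unfolding A_def by (simp cong: sum.cong)
  also have "\<dots> = - A \<nu> v" using A_W0[OF refl_W0[OF a(2)]] eps_refl[of "(\<alpha>, 0)"] a(2) by (simp add: Sig_iff)
  finally show "A \<nu> (aff_refl a v) = - A \<nu> v" .
qed

lemma A_minus_cnj: "\<nu> \<in> PW \<Longrightarrow> cnj (A \<nu> x) = A (- \<nu>) x"
proof -
  assume "\<nu> \<in> PW"
  moreover have "cnj (eps w) = eps w" for w by (simp add: eps_def)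
  ultimately show ?thesis by (simp add: A_def PW_cnj_exp)
qed

text \<open>This is orthogonality of w, but for a complex bilinear form and not for a norm, hence
  the computation in coordinates.\<close>

lemma sq_poly_dual_act: assumes "w \<in> W0" shows "sq_poly (dual_act w \<nu>) = sq_poly \<nu>"
proof -
  let ?u = "inv w"
  have u: "?u \<in> W0" by (rule W0_inv[OF assms])
  have e: "app \<nu> (?u b) = (\<Sum>c\<in>Basis. of_real (?u b \<bullet> c) * app \<nu> c)" for b
  proof -
    have "app \<nu> (?u b) = app \<nu> (\<Sum>c\<in>Basis. (?u b \<bullet> c) *\<^sub>R c)" by (simp only: euclidean_representation)
    then show ?thesis by (simp only: blinfun.sum_right blinfun.scaleR_right scaleR_conv_of_real)
  qed
  have orth: "(\<Sum>b\<in>Basis. (?u b \<bullet> c) * (?u b \<bullet> d)) = (if c = d then 1 else 0)" if "c \<in> Basis" "d \<in> Basis" for c d :: 'a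
  proof -
    have t: "?u b \<bullet> c = w c \<bullet> b" for b c
      using W0_inner[OF assms, of "?u b" c] W0_inv_apply[OF assms] by (simp add: inner_commute)
    have "(\<Sum>b\<in>Basis. (w c \<bullet> b) * (w d \<bullet> b)) = w c \<bullet> w d" by (rule euclidean_inner[symmetric])
    then show ?thesis using W0_inner[OF assms] that by (simp add: t inner_Basis)
  qed
  have "sq_poly (dual_act w \<nu>) = (\<Sum>b\<in>Basis. \<Sum>c\<in>Basis. \<Sum>d\<in>Basis.
      of_real ((?u b \<bullet> c) * (?u b \<bullet> d)) * (app \<nu> c * app \<nu> d))"
    unfolding sq_poly_def dual_act_apply[OF assms] e sum_product by (simp add: mult_ac)
  also have "\<dots> = (\<Sum>c\<in>Basis. \<Sum>d\<in>Basis. \<Sum>b\<in>Basis.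
      of_real ((?u b \<bullet> c) * (?u b \<bullet> d)) * (app \<nu> c * app \<nu> d))"
    by (subst sum.swap) (intro sum.cong refl sum.swap)
  also have "\<dots> = (\<Sum>c\<in>Basis. \<Sum>d\<in>Basis. of_real (if c = d then 1 else 0) * (app \<nu> c * app \<nu> d))"
    by (intro sum.cong refl) (simp only: sum_distrib_right[symmetric] of_real_sum[symmetric] orth)
  also have "\<dots> = (\<Sum>c\<in>Basis. \<Sum>d\<in>Basis. if d = c then app \<nu> c * app \<nu> c else 0)"
    by (intro sum.cong refl) auto
  also have "\<dots> = sq_poly \<nu>" by (simp add: sq_poly_def)
  finally show ?thesis .
qed

lemma laplacian_A: "laplacian (A \<nu>) x = sq_poly \<nu> * A \<nu> x"
proof -
  \<comment> \<open>The exponents \<open>dual_act w \<nu>\<close> may coincide, so the signs are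
    first collected for each distinct exponent.\<close>
  define cc where "cc \<eta> = (\<Sum>w | w \<in> W0 \<and> dual_act w \<nu> = \<eta>. eps w)" for \<eta>
  have A: "A \<nu> = (\<lambda>x. \<Sum>\<eta>\<in>(\<lambda>w. dual_act w \<nu>) ` W0. cc \<eta> * exp (app \<eta> x))"
  proof
    fix x
    have "A \<nu> x = (\<Sum>\<eta>\<in>(\<lambda>w. dual_act w \<nu>) ` W0. \<Sum>w | w \<in> W0 \<and> dual_act w \<nu> = \<eta>. eps w * exp (app (dual_act w \<nu>) x))"
      unfolding A_dual_act by (rule sum.image_gen[OF finite_W0])
    also have "\<dots> = (\<Sum>\<eta>\<in>(\<lambda>w. dual_act w \<nu>) ` W0. cc \<eta> * exp (app \<eta> x))"
      unfolding cc_def sum_distrib_right by (intro sum.cong refl) auto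
    finally show "A \<nu> x = \<dots>" .
  qed
  have "const_coeff_op UNIV sq_poly (laplacian :: ('a \<Rightarrow> complex) \<Rightarrow> _)" by (rule const_coeff_op_laplacian) simp
  from fun_cong[OF const_coeff_op_exp_sum[OF this finite_imageI[OF finite_W0]]]
  have "laplacian (A \<nu>) x = (\<Sum>\<eta>\<in>(\<lambda>w. dual_act w \<nu>) ` W0. cc \<eta> * sq_poly \<eta> * exp (app \<eta> x))"
    unfolding A .
  also have "\<dots> = (\<Sum>\<eta>\<in>(\<lambda>w. dual_act w \<nu>) ` W0. sq_poly \<nu> * (cc \<eta> * exp (app \<eta> x)))"
    by (rule sum.cong) (auto simp: sq_poly_dual_act)
  also have "\<dots> = sq_poly \<nu> * A \<nu> x" by (simp only: A sum_distrib_left)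
  finally show ?thesis .
qed

section \<open>The weak Dirichlet problem and Green's identity on the alcove\<close>

definition intC :: "('a \<Rightarrow> complex) \<Rightarrow> complex" where
  "intC k = (LINT x|lborel. indicator C x *\<^sub>R k x)"

lemma integrable_C: "continuous_on S k \<Longrightarrow> integrable lborel (\<lambda>x. indicator C x *\<^sub>R (k x :: complex))"
proof -
  assume k: "continuous_on S k"
  have "set_integrable lborel S k" unfolding set_integrable_def by (rule borel_integrable_compact[OF compact_S k])
  then have "set_integrable lborel C k"
    by (rule set_integrable_subset) (use open_C closure_subset in auto)
  then show ?thesis by (simp add: set_integrable_def)
qed

lemma intC_add: "continuous_on S f \<Longrightarrow> continuous_on S g \<Longrightarrow> intC (\<lambda>x. f x + g x) = intC f + intC g"
  unfolding intC_def scaleR_add_right by (intro Bochner_Integration.integral_add integrable_C)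

lemma intC_diff: "continuous_on S f \<Longrightarrow> continuous_on S g \<Longrightarrow> intC (\<lambda>x. f x - g x) = intC f - intC g"
  unfolding intC_def scaleR_diff_right by (intro Bochner_Integration.integral_diff integrable_C)

lemma intC_cmult: "intC (\<lambda>x. c * f x) = c * intC f"
  unfolding intC_def mult_scaleR_right[symmetric] by (rule integral_mult_right_zero)

text \<open>The function is Lipschitz on the compact convex closed alcove. Projecting x to wall j
  might leave the alcove, so one walks towards that wall only until some wall is met. The way is at
  most a constant times \<open>aff_apply j x\<close>, and g vanishes at its end.\<close>

lemma wall_bound:
  fixes g :: "'a \<Rightarrow> complex"
  assumes U: "open U" "S \<subseteq> U" and g: "C1_on U g"
    and z: "\<And>j x. j \<in> Del \<Longrightarrow> x \<in> S \<Longrightarrow> aff_apply j x = 0 \<Longrightarrow> g x = 0"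
  shows "\<exists>K\<ge>0. \<forall>x\<in>S. \<forall>j\<in>Del. norm (g x) \<le> K * aff_apply j x"
proof -
  obtain g' where g': "\<And>x. x \<in> U \<Longrightarrow> (g has_derivative app (g' x)) (at x)" "continuous_on U g'"
    using g unfolding C1_on_def by blast
  have "bounded (g' ` S)"
    using compact_continuous_image[OF continuous_on_subset[OF g'(2) U(2)] compact_S] by (rule compact_imp_bounded)
  then obtain L where L: "L > 0" "\<And>x. x \<in> S \<Longrightarrow> norm (g' x) \<le> L" unfolding bounded_pos by auto
  have lip: "norm (g x - g y) \<le> L * norm (x - y)" if "x \<in> S" "y \<in> S" for x y
  proof (rule differentiable_bound[OF convex_closure[OF convex_C] _ _ that])
    fix x assume x: "x \<in> S"
    show "(g has_derivative app (g' x)) (at x within S)"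
      using g'(1)[of x] U(2) x by (auto intro: has_derivative_at_withinI)
    show "onorm (app (g' x)) \<le> L" using L(2)[OF x] by (simp add: norm_blinfun.rep_eq)
  qed
  \<comment> \<open>Normalised so that moving by t against \<open>d j\<close> lowers
    \<open>aff_apply j\<close> by exactly t.\<close>
  define d where "d j = (1 / (riesz (fst j) \<bullet> riesz (fst j))) *\<^sub>R riesz (fst j)" for j :: "'a affine_fun"
  define K where "K = L * (\<Sum>j\<in>Del. norm (d j))"
  have "norm (g x) \<le> K * aff_apply j x" if x: "x \<in> S" and j: "j \<in> Del" for x j
  proof -
    have dj: "app (fst j) (d j) = 1"
      using fst_Del[OF j] by (simp add: d_def blinfun_eq_riesz riesz_eq_0_iff)
    \<comment> \<open>These are the walls approached on the way, and \<open>?q\<close> gives the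
      times of arrival. As j is among them, the first arrival is no later than
      \<open>aff_apply j x\<close>.\<close>
    let ?I = "{i \<in> Del. app (fst i) (d j) > 0}"
    let ?q = "\<lambda>i. aff_apply i x / app (fst i) (d j)"
    have I: "finite ?I" "j \<in> ?I" using finite_Del j dj by auto
    have "\<exists>m\<in>?q ` ?I. \<not> (\<exists>x\<in>?q ` ?I. x < m)"
    proof (rule ex_min_if_finite)
      show "finite (?q ` ?I)" using I(1) by (rule finite_imageI)
      show "?q ` ?I \<noteq> {}" using I(2) by blast
    qed
    then obtain i where i1: "i \<in> ?I" and "\<not> (\<exists>x\<in>?q ` ?I. x < ?q i)" by blast
    then have i2: "?q i \<le> ?q k" if "k \<in> ?I" for k using that by (meson imageI not_le)
    note i = i1 i2
    let ?t = "?q i"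
    let ?y = "x - ?t *\<^sub>R d j"
    have t: "0 \<le> ?t" "?t \<le> aff_apply j x" using i(1) i(2)[OF I(2)] x dj by (auto simp: S_iff)
    have ay: "aff_apply k ?y = aff_apply k x - ?t * app (fst k) (d j)" for k
      by (simp add: aff_apply_def blinfun.diff_right blinfun.scaleR_right)
    have "aff_apply k ?y \<ge> 0" if k: "k \<in> Del" for k
    proof (cases "app (fst k) (d j) > 0")
      case True
      then have "?t \<le> ?q k" using k i(2) by simp
      then show ?thesis unfolding ay using True by (simp add: pos_le_divide_eq)
    next
      case False
      then have "?t * app (fst k) (d j) \<le> 0" using t by (intro mult_nonneg_nonpos) auto
      moreover have "aff_apply k x \<ge> 0" using x k by (simp add: S_iff)
      ultimately show ?thesis unfolding ay by linarith
    qed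
    then have yS: "?y \<in> S" by (simp add: S_iff)
    have "aff_apply i ?y = 0" unfolding ay using i(1) by simp
    then have "g ?y = 0" using z[OF _ yS] i(1) by blast
    then have "norm (g x) \<le> L * norm (x - ?y)" using lip[OF x yS] by simp
    also have "\<dots> = L * (?t * norm (d j))"
      by (simp only: diff_diff_eq2 add_diff_cancel_left' norm_scaleR abs_of_nonneg[OF t(1)])
    also have "\<dots> \<le> L * (aff_apply j x * (\<Sum>j\<in>Del. norm (d j)))"
      using L t j finite_Del by (intro mult_left_mono mult_mono member_le_sum) auto
    finally show ?thesis by (simp add: K_def mult_ac)
  qed
  moreover have "K \<ge> 0" unfolding K_def using L(1) by (intro mult_nonneg_nonneg sum_nonneg) auto
  ultimately show ?thesis by blast
qed

text \<open>The boundary condition is kept in quantitative form, as a linear bound at every wall,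
  because that is what compensates the derivatives of the cutoffs. The test functions never touch
  the walls.\<close>

definition dirichlet :: "complex \<Rightarrow> ('a \<Rightarrow> complex) \<Rightarrow> bool" where
  "dirichlet c f \<longleftrightarrow> continuous_on S f \<and> (\<exists>K\<ge>0. \<forall>x\<in>S. \<forall>j\<in>Del. norm (f x) \<le> K * aff_apply j x) \<and>
     (\<forall>h. test_function C h \<longrightarrow> (LINT x|lborel. f x * laplacian h x) = c * (LINT x|lborel. f x * h x))"

text \<open>
  These identities bound the derivatives of \<open>s \<mapsto> flat 1 (n s - 1)\<close> by constant multiples of \<open>1/s\<close> and
  \<open>1/s\<^sup>2\<close>, uniformly in \<open>n\<close>; the poles are absorbed by the zeros of \<open>f\<close> and \<open>h\<close> on the wall.
\<close>

lemma flat_scale_1: "(t + 1) * flat (flat_deriv 1) t = flat [:0, 1, 1:] t"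
  by (auto simp: flat_def flat_deriv_def field_simps power2_eq_square)

lemma flat_scale_2: "(t + 1)\<^sup>2 * flat (flat_deriv (flat_deriv 1)) t = flat ([:1, 2, 1:] * [:0, - 2, 1:]) t"
  by (auto simp: flat_def flat_deriv_def pderiv_pCons field_simps power2_eq_square)

text \<open>Letting n tend to infinity removes the cutoff at wall j. Near the wall f h vanishes to
  second order and f times the derivative of h to first, which gives a bound uniform in n.\<close>

lemma dirichlet_green_step:
  assumes f: "continuous_on S f" and K: "K \<ge> 0" "\<And>x. x \<in> S \<Longrightarrow> norm (f x) \<le> K * aff_apply j x"
    and h: "smooth h" and K': "K' \<ge> 0" "\<And>x. x \<in> S \<Longrightarrow> norm (h x) \<le> K' * aff_apply j x"
    and j: "j \<in> Del"
    and hn: "\<And>n::nat. intC (\<lambda>x. f x * (laplacian (\<lambda>x. h x * cutoff 1 (real (Suc n) *\<^sub>R fst j) (real (Suc n) * snd j - 1) x) x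
      - c * (h x * cutoff 1 (real (Suc n) *\<^sub>R fst j) (real (Suc n) * snd j - 1) x))) = 0"
  shows "intC (\<lambda>x. f x * (laplacian h x - c * h x)) = 0"
proof -
  define \<eta> where "\<eta> n = cutoff 1 (real (Suc n) *\<^sub>R fst j) (real (Suc n) * snd j - 1)" for n
  define F where "F n x = f x * (laplacian (\<lambda>x. h x * \<eta> n x) x - c * (h x * \<eta> n x))" for n x
  define D where "D x = (\<Sum>b\<in>Basis. of_real (app (fst j) b) * dir_deriv b h x)" for x
  define g where "g x = f x * (laplacian h x - c * h x)" for x
  let ?r = "riesz (fst j) \<bullet> riesz (fst j)"
  let ?T = "\<lambda>n x. real (Suc n) * aff_apply j x - 1"
  have ct: "cutoff p (real (Suc n) *\<^sub>R fst j) (real (Suc n) * snd j - 1) x = of_real (flat p (?T n x))" for p n x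
    by (simp add: cutoff_def aff_apply_def blinfun.scaleR_left distrib_left add_diff_eq del: of_nat_Suc)
  have sm: "smooth (\<eta> n)" for n unfolding \<eta>_def by (rule smooth_cutoff)
  \<comment> \<open>The Leibniz rule separates the term without derivatives of the cutoff, the one
    with its Laplacian, and the mixed gradient term.\<close>
  have F_eq: "F n x = of_real (flat 1 (?T n x)) * g x
      + of_real (?r * ((real (Suc n))\<^sup>2 * flat (flat_deriv (flat_deriv 1)) (?T n x))) * (f x * h x)
      + of_real (2 * (real (Suc n) * flat (flat_deriv 1) (?T n x))) * (f x * D x)" for n x
  proof -
    have l: "laplacian (\<eta> n) x = of_real (?r * ((real (Suc n))\<^sup>2 * flat (flat_deriv (flat_deriv 1)) (?T n x)))"
      unfolding \<eta>_def laplacian_cutoff ct by (simp add: riesz_scaleR power2_eq_square)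
    have dd: "(\<Sum>b\<in>Basis. dir_deriv b h x * dir_deriv b (\<eta> n) x) = of_real (real (Suc n) * flat (flat_deriv 1) (?T n x)) * D x"
      unfolding \<eta>_def dir_deriv_cutoff ct D_def sum_distrib_left
      by (rule sum.cong) (simp_all add: blinfun.scaleR_left)
    have eta: "\<eta> n x = of_real (flat 1 (?T n x))" unfolding \<eta>_def by (rule ct)
    show ?thesis unfolding F_def laplacian_mult[OF h sm] l dd g_def eta
      by (simp add: algebra_simps del: of_nat_Suc)
  qed
  have Dc: "continuous_on S D" unfolding D_def
    by (intro continuous_intros smooth_continuous smooth_dir_deriv h)
  have gc: "continuous_on S g" unfolding g_def
    by (intro continuous_intros f smooth_continuous smooth_laplacian h)
  have bd: "\<exists>M\<ge>0. \<forall>x\<in>S. norm (k x) \<le> M" if kc: "continuous_on S k" for k :: "'a \<Rightarrow> complex"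
  proof -
    obtain M where "M > 0" "\<forall>z\<in>k ` S. norm z \<le> M"
      using compact_imp_bounded[OF compact_continuous_image[OF kc compact_S]] unfolding bounded_pos by blast
    then show ?thesis by (intro exI[of _ M]) auto
  qed
  obtain Mg MD where Mg: "Mg \<ge> 0" "\<And>x. x \<in> S \<Longrightarrow> norm (g x) \<le> Mg" and MD: "MD \<ge> 0" "\<And>x. x \<in> S \<Longrightarrow> norm (D x) \<le> MD"
    using bd[OF gc] bd[OF Dc] by blast
  obtain k0 k1 k2 where k: "k0 \<ge> 0" "k1 \<ge> 0" "k2 \<ge> 0" "\<And>t. \<bar>flat 1 t\<bar> \<le> k0" "\<And>t. \<bar>flat [:0, 1, 1:] t\<bar> \<le> k1"
    "\<And>t. \<bar>flat ([:1, 2, 1:] * [:0, - 2, 1:]) t\<bar> \<le> k2"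
    using flat_bounded by metis
  have s1: "real (Suc n) * flat (flat_deriv 1) (?T n x) = flat [:0, 1, 1:] (?T n x) / aff_apply j x"
    and s2: "(real (Suc n))\<^sup>2 * flat (flat_deriv (flat_deriv 1)) (?T n x)
      = flat ([:1, 2, 1:] * [:0, - 2, 1:]) (?T n x) / (aff_apply j x)\<^sup>2" if "x \<in> C" for n x
  proof -
    have u: "aff_apply j x > 0" using that j by (simp add: C_iff)
    show "real (Suc n) * flat (flat_deriv 1) (?T n x) = flat [:0, 1, 1:] (?T n x) / aff_apply j x"
      using u unfolding flat_scale_1[symmetric] by (simp add: field_simps)
    show "(real (Suc n))\<^sup>2 * flat (flat_deriv (flat_deriv 1)) (?T n x)
      = flat ([:1, 2, 1:] * [:0, - 2, 1:]) (?T n x) / (aff_apply j x)\<^sup>2"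
      using u unfolding flat_scale_2[symmetric] by (simp add: power_mult_distrib)
  qed
  have "(\<lambda>n. intC (F n)) \<longlonglongrightarrow> intC g"
    unfolding intC_def
  \<comment> \<open>The summands of the majorant belong to the three terms of \<open>F_eq\<close>;
    the negative powers of \<open>aff_apply j x\<close> cancel against the bounds on f and
    h.\<close>
  proof (rule integral_dominated_convergence[where w = "\<lambda>x. indicator S x *\<^sub>R (k0 * Mg + ?r * k2 * K * K' + 2 * k1 * K * MD)"])
    show "(\<lambda>x. indicator C x *\<^sub>R g x) \<in> borel_measurable lborel"
      using integrable_C[OF gc] by (rule borel_measurable_integrable)
    show "(\<lambda>x. indicator C x *\<^sub>R F n x) \<in> borel_measurable lborel" for n
    proof (rule borel_measurable_integrable, rule integrable_C)
      show "continuous_on S (F n)" unfolding F_def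
        by (intro continuous_intros f smooth_continuous smooth_laplacian smooth_mult h sm)
    qed
    show "integrable lborel (\<lambda>x. indicator S x *\<^sub>R (k0 * Mg + ?r * k2 * K * K' + 2 * k1 * K * MD))"
      by (rule borel_integrable_compact[OF compact_S]) simp
    show "AE x in lborel. (\<lambda>n. indicator C x *\<^sub>R F n x) \<longlonglongrightarrow> indicator C x *\<^sub>R g x"
    proof (intro AE_I2)
      fix x
      show "(\<lambda>n. indicator C x *\<^sub>R F n x) \<longlonglongrightarrow> indicator C x *\<^sub>R g x"
      proof (cases "x \<in> C")
        case True
        have u: "aff_apply j x > 0" using True j by (simp add: C_iff)
        have "filterlim (\<lambda>n. real (Suc n)) at_top sequentially"
          by (rule filterlim_compose[OF filterlim_real_sequentially filterlim_Suc])
        then have "filterlim (\<lambda>n. real (Suc n) * aff_apply j x) at_top sequentially"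
          using u by (intro filterlim_at_top_mult_tendsto_pos[OF tendsto_const]) auto
        then have T: "filterlim (\<lambda>n. ?T n x) at_top sequentially"
          using filterlim_tendsto_add_at_top[OF tendsto_const[of "- 1"]] by simp
        have c: "(\<lambda>n. flat p (?T n x)) \<longlonglongrightarrow> poly p 0" for p
          by (rule filterlim_compose[OF flat_at_top T])
        \<comment> \<open>Each limit is the constant coefficient of the polynomial. It is 0 for both
          terms with derivatives of the cutoff, so only g survives.\<close>
        have "(\<lambda>n. F n x) \<longlonglongrightarrow> of_real (poly 1 0) * g x
            + of_real (?r * (poly ([:1, 2, 1:] * [:0, - 2, 1:]) 0 / (aff_apply j x)\<^sup>2)) * (f x * h x)
            + of_real (2 * (poly [:0, 1, 1:] 0 / aff_apply j x)) * (f x * D x)"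
          unfolding F_eq s1[OF True] s2[OF True] using u by (intro tendsto_intros c) auto
        then show ?thesis using True by simp
      qed simp
    qed
    show "AE x in lborel. norm (indicator C x *\<^sub>R F n x)
        \<le> indicator S x *\<^sub>R (k0 * Mg + ?r * k2 * K * K' + 2 * k1 * K * MD)" for n
    proof (intro AE_I2)
      fix x
      show "norm (indicator C x *\<^sub>R F n x) \<le> indicator S x *\<^sub>R (k0 * Mg + ?r * k2 * K * K' + 2 * k1 * K * MD)"
      proof (cases "x \<in> C")
        case True
        have xS: "x \<in> S" by (rule C_S[OF True])
        let ?u = "aff_apply j x"
        have u: "?u > 0" using True j by (simp add: C_iff)
        have 1: "norm (of_real (flat 1 (?T n x)) * g x) \<le> k0 * Mg"
          unfolding norm_mult norm_of_real by (intro mult_mono k Mg(2) xS) auto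
        have "\<bar>flat ([:1, 2, 1:] * [:0, - 2, 1:]) (?T n x) / ?u\<^sup>2\<bar> * (norm (f x) * norm (h x))
            \<le> k2 / ?u\<^sup>2 * ((K * ?u) * (K' * ?u))"
        proof (intro mult_mono K(2) K'(2) xS)
          show "\<bar>flat ([:1, 2, 1:] * [:0, - 2, 1:]) (?T n x) / ?u\<^sup>2\<bar> \<le> k2 / ?u\<^sup>2"
            unfolding abs_divide abs_power2 by (rule divide_right_mono[OF k(6)]) simp
        qed (use u K K' k(3) in auto)
        also have "\<dots> = k2 * K * K'" using u by (simp add: power2_eq_square)
        finally have "?r * (\<bar>flat ([:1, 2, 1:] * [:0, - 2, 1:]) (?T n x) / ?u\<^sup>2\<bar> * (norm (f x) * norm (h x))) \<le> ?r * (k2 * K * K')"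
          by (rule mult_left_mono) simp
        then have 2: "norm (of_real (?r * (flat ([:1, 2, 1:] * [:0, - 2, 1:]) (?T n x) / ?u\<^sup>2)) * (f x * h x)) \<le> ?r * k2 * K * K'"
          by (simp only: norm_mult norm_of_real abs_mult abs_of_nonneg[OF inner_ge_zero] mult.assoc)
        have "\<bar>flat [:0, 1, 1:] (?T n x) / ?u\<bar> * (norm (f x) * norm (D x)) \<le> k1 / ?u * ((K * ?u) * MD)"
        proof (intro mult_mono K(2) MD(2) xS)
          show "\<bar>flat [:0, 1, 1:] (?T n x) / ?u\<bar> \<le> k1 / ?u"
            unfolding abs_divide abs_of_pos[OF u] by (rule divide_right_mono[OF k(5)]) (use u in simp)
        qed (use u K MD k(2) in auto)
        also have "\<dots> = k1 * K * MD" using u by simp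
        finally have 3: "norm (of_real (2 * (flat [:0, 1, 1:] (?T n x) / ?u)) * (f x * D x)) \<le> 2 * k1 * K * MD"
          by (simp only: norm_mult norm_of_real abs_mult)
        have "norm (F n x) \<le> k0 * Mg + ?r * k2 * K * K' + 2 * k1 * K * MD"
          unfolding F_eq s1[OF True] s2[OF True] by (intro norm_triangle_mono 1 2 3)
        then show ?thesis using True xS by simp
      next
        case False
        then show ?thesis using k Mg MD K K' by (auto simp: indicator_def intro!: add_nonneg_nonneg mult_nonneg_nonneg)
      qed
    qed
  qed
  moreover have "intC (F n) = 0" for n using hn[of n] by (simp add: F_def[abs_def] \<eta>_def)
  ultimately have "intC g = 0" by (simp add: LIMSEQ_const_iff)
  then show ?thesis by (simp add: g_def[abs_def])
qed

text \<open>The walls are reached one at a time: on those outside \<open>J\<close> the function \<open>h\<close> is already cut off.\<close>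

lemma dirichlet_green_walls:
  assumes f: "dirichlet c f" and J: "finite J" "J \<subseteq> Del" and h: "smooth h"
    and z: "\<And>j x. j \<in> J \<Longrightarrow> aff_apply j x = 0 \<Longrightarrow> h x = 0"
    and e: "\<And>j. j \<in> Del - J \<Longrightarrow> \<exists>\<epsilon>>0. \<forall>x. aff_apply j x \<le> \<epsilon> \<longrightarrow> h x = 0"
  shows "intC (\<lambda>x. f x * (laplacian h x - c * h x)) = 0"
  using J h z e
proof (induction J arbitrary: h)
  case empty
  have fc: "continuous_on S f" using f by (simp add: dirichlet_def)
  obtain \<epsilon> where eps: "\<And>j. j \<in> Del \<Longrightarrow> \<epsilon> j > 0" "\<And>j x. j \<in> Del \<Longrightarrow> aff_apply j x \<le> \<epsilon> j \<Longrightarrow> h x = 0"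
    using empty.prems(4) by (metis Diff_empty)
  \<comment> \<open>With every wall cut off, h is supported in this compact part of the open alcove
    and is itself an admissible test function.\<close>
  let ?X = "{x. \<forall>j\<in>Del. \<epsilon> j \<le> aff_apply j x}"
  have "?X = (\<Inter>j\<in>Del. {x. \<epsilon> j \<le> aff_apply j x})" by auto
  then have "closed ?X" by (auto intro!: closed_INT closed_Collect_le continuous_aff_apply continuous_intros)
  moreover have XC: "?X \<subseteq> C" using eps(1) by (force simp: C_iff)
  ultimately have X: "compact ?X" using compact_Int_closed[OF compact_S, of ?X] closure_subset[of C] by (simp add: inf_absorb2 subset_trans)
  have hX: "h x = 0" if "x \<notin> ?X" for x using that eps(2) by (force simp: not_le)
  have "test_function C h" by (rule test_functionI[OF empty.prems(2) X XC hX])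
  then have eq: "(LINT x|lborel. f x * laplacian h x) = c * (LINT x|lborel. f x * h x)"
    using f by (simp add: dirichlet_def)
  have lX: "laplacian h x = 0" if "x \<notin> ?X" for x
    using const_coeff_op_support[OF const_coeff_op_laplacian[of UNIV] empty.prems(2) compact_imp_closed[OF X] hX] that by simp
  have i: "intC (\<lambda>x. f x * k x) = (LINT x|lborel. f x * k x)" if kX: "\<And>x. x \<notin> ?X \<Longrightarrow> k x = 0" for k
  proof -
    have "k x = 0" if "x \<notin> C" for x using XC that by (intro kX) blast
    then show ?thesis unfolding intC_def
      by (intro Bochner_Integration.integral_cong) (auto simp: indicator_def)
  qed
  have "intC (\<lambda>x. f x * laplacian h x - c * (f x * h x)) = intC (\<lambda>x. f x * laplacian h x) - c * intC (\<lambda>x. f x * h x)"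
    using fc smooth_continuous[OF empty.prems(2)] smooth_continuous[OF smooth_laplacian[OF empty.prems(2)]]
    by (subst intC_diff) (auto simp: intC_cmult intro!: continuous_intros)
  also have "\<dots> = 0" using eq i[of h, OF hX] i[of "laplacian h", OF lX] by simp
  finally show ?case by (simp add: algebra_simps)
next
  case (insert j J)
  have fc: "continuous_on S f" using f by (simp add: dirichlet_def)
  obtain K where K: "K \<ge> 0" "\<And>x i. x \<in> S \<Longrightarrow> i \<in> Del \<Longrightarrow> norm (f x) \<le> K * aff_apply i x"
    using f unfolding dirichlet_def by blast
  have j: "j \<in> Del" using insert.prems by simp
  have hz: "h x = 0" if i: "i \<in> Del" "aff_apply i x = 0" for i x
  proof (cases "i \<in> insert j J")
    case True
    then show ?thesis using insert.prems(3) i(2) by blast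
  next
    case False
    then obtain \<epsilon> where "\<epsilon> > 0" "\<forall>x. aff_apply i x \<le> \<epsilon> \<longrightarrow> h x = 0" using insert.prems(4)[of i] i(1) by auto
    then show ?thesis using i(2) by simp
  qed
  have "\<exists>K\<ge>0. \<forall>x\<in>S. \<forall>j\<in>Del. norm (h x) \<le> K * aff_apply j x"
    by (rule wall_bound[OF open_UNIV subset_UNIV C1_on_smooth[OF insert.prems(2)]]) (rule hz)
  then obtain K' where K': "K' \<ge> 0" "\<And>x i. x \<in> S \<Longrightarrow> i \<in> Del \<Longrightarrow> norm (h x) \<le> K' * aff_apply i x"
    by blast
  show ?case
  proof (rule dirichlet_green_step[OF fc K(1) K(2)[OF _ j] insert.prems(2) K'(1) K'(2)[OF _ j] j])
    fix n
    let ?\<eta> = "cutoff 1 (real (Suc n) *\<^sub>R fst j) (real (Suc n) * snd j - 1)"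
    have ct: "?\<eta> x = of_real (flat 1 (real (Suc n) * aff_apply j x - 1))" for x
      by (simp add: cutoff_def aff_apply_def blinfun.scaleR_left distrib_left add_diff_eq del: of_nat_Suc)
    show "intC (\<lambda>x. f x * (laplacian (\<lambda>x. h x * ?\<eta> x) x - c * (h x * ?\<eta> x))) = 0"
    proof (rule insert.IH)
      show "J \<subseteq> Del" using insert.prems by simp
      show "smooth (\<lambda>x. h x * ?\<eta> x)" by (intro smooth_mult insert.prems(2) smooth_cutoff)
      show "h x * ?\<eta> x = 0" if "i \<in> J" "aff_apply i x = 0" for i x
        using insert.prems(3)[of i x] that by simp
      fix i assume i: "i \<in> Del - J"
      show "\<exists>\<epsilon>>0. \<forall>x. aff_apply i x \<le> \<epsilon> \<longrightarrow> h x * ?\<eta> x = 0"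
      proof (cases "i = j")
        case True
        \<comment> \<open>\<open>flat\<close> is 0 at nonpositive arguments, which provides the
          strip for the wall j that has just left J.\<close>
        have "?\<eta> x = 0" if "aff_apply j x \<le> 1 / real (Suc n)" for x
        proof -
          have "real (Suc n) * aff_apply j x \<le> 1" using that by (simp add: field_simps)
          then show ?thesis unfolding ct by (simp add: flat_def)
        qed
        then show ?thesis using True by (intro exI[of _ "1 / real (Suc n)"]) auto
      next
        case False
        then have "i \<in> Del - insert j J" using i by simp
        from insert.prems(4)[OF this] show ?thesis by auto
      qed
    qed
  qed
qed

lemma dirichlet_green:
  assumes f: "dirichlet c f" and nu: "\<nu> \<in> PW"
  shows "(sq_poly \<nu> - c) * intC (\<lambda>x. f x * A \<nu> x) = 0"
proof -
  have "intC (\<lambda>x. f x * (laplacian (A \<nu>) x - c * A \<nu> x)) = 0"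
    by (rule dirichlet_green_walls[OF f finite_Del subset_refl smooth_A])
      (use anti_wall[OF anti_A[OF nu] Del_Sig] in auto)
  moreover have "f x * (laplacian (A \<nu>) x - c * A \<nu> x) = (sq_poly \<nu> - c) * (f x * A \<nu> x)" for x
    by (simp add: laplacian_A algebra_simps)
  ultimately show ?thesis by (simp add: intC_cmult)
qed

end

section \<open>Completeness\<close>

lemma sum_fun_apply: "(\<Sum>i\<in>I. f i) x = (\<Sum>i\<in>I. (f i x :: complex))"
  by (induction I rule: infinite_finite_induct) auto

lemma exp_sum_transpose:
  fixes N :: "'a::euclidean_space cdual set"
  assumes "finite N" "const_coeff_op UNIV (\<lambda>\<xi>. p (- \<xi>)) D" "test_function \<Omega> h"
  shows "(LINT x|lborel. (\<Sum>\<nu>\<in>N. c \<nu> * exp (app \<nu> x)) * D h x)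
    = (LINT x|lborel. (\<Sum>\<nu>\<in>N. c \<nu> * p \<nu> * exp (app \<nu> x)) * h x)"
proof -
  obtain D' where D': "const_coeff_op UNIV (\<lambda>\<xi>. p (- (- \<xi>))) D'" "formal_transpose D D'"
    using const_coeff_op_transpose[OF assms(2)] by blast
  have z: "h x = 0" if "x \<notin> closure {x. h x \<noteq> 0}" for x using that closure_subset[of "{x. h x \<noteq> 0}"] by auto
  have "(LINT x|lborel. (\<Sum>\<nu>\<in>N. c \<nu> * exp (app \<nu> x)) * D h x)
      = (LINT x|lborel. D' (\<lambda>x. \<Sum>\<nu>\<in>N. c \<nu> * exp (app \<nu> x)) x * h x)"
    by (rule formal_transposeD[OF D'(2) smooth_exp_sum[OF assms(1)], of _ "closure {x. h x \<noteq> 0}"])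
      (use assms(3) in \<open>auto simp: test_function_def intro: z\<close>)
  then show ?thesis using const_coeff_op_exp_sum[OF D'(1) assms(1)] by simp
qed

definition expo :: "'a::euclidean_space cdual \<Rightarrow> 'a \<Rightarrow> complex" where
  "expo \<nu> x = exp (app \<nu> x)"

lemma span_expo_E:
  assumes "f \<in> cfun.span (expo ` X)"
  obtains N c where "finite N" "N \<subseteq> X" "\<And>x. f x = (\<Sum>\<nu>\<in>N. c \<nu> * exp (app \<nu> x))"
proof -
  obtain T r where T: "finite T" "T \<subseteq> expo ` X" "f = (\<Sum>a\<in>T. fscale (r a) a)"
    using assms unfolding cfun.span_explicit by blast
  obtain N where N: "N \<subseteq> X" "inj_on expo N" "T = expo ` N" using T(2) unfolding subset_image_inj by blast
  have "finite N" using T(1) N finite_imageD by blast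
  moreover have "f x = (\<Sum>\<nu>\<in>N. r (expo \<nu>) * exp (app \<nu> x))" for x
    unfolding T(3) N(3) sum_fun_apply by (subst sum.reindex[OF N(2)]) (simp add: fscale_def expo_def)
  ultimately show ?thesis using that[of N "\<lambda>\<nu>. r (expo \<nu>)"] N(1) by blast
qed

context root_data begin

abbreviation "spanA \<equiv> cfun.span (A ` PW)"

lemma spanA_I: "\<nu> \<in> PW \<Longrightarrow> A \<nu> \<in> spanA"
  by (intro cfun.span_base imageI)

lemma span_sum_fun: "(\<And>i. i \<in> I \<Longrightarrow> f i \<in> cfun.span X) \<Longrightarrow> (\<lambda>x. \<Sum>i\<in>I. f i x) \<in> cfun.span X"
proof -
  assume "\<And>i. i \<in> I \<Longrightarrow> f i \<in> cfun.span X"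
  then have "(\<Sum>i\<in>I. f i) \<in> cfun.span X" by (intro cfun.span_sum)
  moreover have "(\<Sum>i\<in>I. f i) = (\<lambda>x. \<Sum>i\<in>I. f i x)" by (rule ext) (rule sum_fun_apply)
  ultimately show ?thesis by simp
qed

lemma span_add_fun: "f \<in> cfun.span X \<Longrightarrow> g \<in> cfun.span X \<Longrightarrow> (\<lambda>x. f x + g x) \<in> cfun.span X"
  using cfun.span_add[of f X g] by (simp add: plus_fun_def)

lemma span_cmult_fun: "f \<in> cfun.span X \<Longrightarrow> (\<lambda>x. c * f x) \<in> cfun.span X"
  using cfun.span_scale[of f X c] by (simp add: fscale_def)

lemma spanA_induct [consumes 1, case_names zero step]:
  assumes "f \<in> cfun.span (A ` X)" "Pr (\<lambda>x. 0)" "\<And>c \<nu> g. \<nu> \<in> X \<Longrightarrow> Pr g \<Longrightarrow> Pr (\<lambda>x. c * A \<nu> x + g x)"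
  shows "Pr f"
  using assms(1)
proof (induction rule: cfun.span_induct_alt)
  case base
  then show ?case using assms(2) by (simp add: zero_fun_def)
next
  case (step c x y)
  then obtain \<nu> where "\<nu> \<in> X" "x = A \<nu>" by blast
  then show ?case using assms(3)[of \<nu> y c] step by (simp add: plus_fun_def fscale_def)
qed

section \<open>Multipliers and completeness of the antisymmetric sums\<close>

definition orbit_sum :: "'a cdual \<Rightarrow> 'a \<Rightarrow> complex" where
  "orbit_sum \<nu> x = (\<Sum>w\<in>W0. exp (app \<nu> (w x)))"

text \<open>In the summand of w the invariant factor may be evaluated at w x; exchanging the sums
  regroups the product into antisymmetric sums with shifted exponents.\<close>

lemma A_mult_orbit_sum:
  assumes "\<nu> \<in> PW" "\<eta> \<in> PW" shows "(\<lambda>x. A \<nu> x * orbit_sum \<eta> x) \<in> spanA"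
proof -
  have "A \<nu> x * orbit_sum \<eta> x = (\<Sum>u\<in>W0. A (\<nu> + dual_act (inv u) \<eta>) x)" for x
  proof -
    have orbit_sum: "orbit_sum \<eta> x = (\<Sum>u\<in>W0. exp (app \<eta> (u (w x))))" if w: "w \<in> W0" for w
      unfolding orbit_sum_def using sum.reindex_bij_betw[OF bij_betw_W0_comp_right[OF w], of "\<lambda>u. exp (app \<eta> (u x))"] by simp
    have "A \<nu> x * orbit_sum \<eta> x = (\<Sum>w\<in>W0. (eps w * exp (app \<nu> (w x))) * (\<Sum>u\<in>W0. exp (app \<eta> (u (w x)))))"
      unfolding A_def sum_distrib_right by (rule sum.cong) (simp_all add: orbit_sum)
    also have "\<dots> = (\<Sum>u\<in>W0. \<Sum>w\<in>W0. (eps w * exp (app \<nu> (w x))) * exp (app \<eta> (u (w x))))"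
      unfolding sum_distrib_left by (rule sum.swap)
    also have "\<dots> = (\<Sum>u\<in>W0. A (\<nu> + dual_act (inv u) \<eta>) x)"
      unfolding A_def
      by (intro sum.cong refl) (simp add: dual_act_apply W0_inv blinfun.add_left exp_add inv_inv_eq W_inv W0_W)
    finally show ?thesis .
  qed
  moreover have "(\<lambda>x. \<Sum>u\<in>W0. A (\<nu> + dual_act (inv u) \<eta>) x) \<in> spanA"
    by (intro span_sum_fun spanA_I PW_add PW_dual_act W0_inv assms)
  ultimately show ?thesis by simp
qed

lemma spanA_mult_orbit_sum: "f \<in> spanA \<Longrightarrow> \<eta> \<in> PW \<Longrightarrow> (\<lambda>x. f x * orbit_sum \<eta> x) \<in> spanA"
proof (induction rule: spanA_induct)
  case zero
  show ?case using cfun.span_zero[of "A ` PW"] by (simp add: zero_fun_def)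
next
  case (step c \<nu> g)
  have "(\<lambda>x. c * (A \<nu> x * orbit_sum \<eta> x) + g x * orbit_sum \<eta> x) \<in> spanA"
    using step by (intro span_add_fun span_cmult_fun A_mult_orbit_sum)
  then show ?case by (simp add: algebra_simps)
qed

lemma spanA_smooth_anti: "f \<in> spanA \<Longrightarrow> smooth f \<and> anti f"
proof (induction rule: spanA_induct)
  case zero
  show ?case by (simp add: smooth_const anti_def)
next
  case (step c \<nu> g)
  then show ?case using anti_A[of \<nu>]
    by (auto intro!: smooth_add smooth_cmult smooth_A simp: anti_def algebra_simps)
qed

lemma orbit_sum_cnj: "\<eta> \<in> PW \<Longrightarrow> cnj (orbit_sum \<eta> x) = orbit_sum (- \<eta>) x"
  by (simp add: orbit_sum_def PW_cnj_exp)

lemma continuous_orbit_sum: "continuous_on X (orbit_sum \<eta>)"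
  unfolding orbit_sum_def
  by (intro continuous_intros linear_continuous_on linear_conv_bounded_linear[THEN iffD1] W0_linear)

text \<open>Unlike the span, this set is a ring with constants. It consists of real functions
  because Stone-Weierstrass is applied over the reals.\<close>

definition multipliers :: "('a \<Rightarrow> real) set" where
  "multipliers = {r. continuous_on S r \<and> (\<forall>f\<in>spanA. (\<lambda>x. f x * of_real (r x)) \<in> spanA)}"

lemma Re_Im_orbit_sum_multipliers: assumes "\<eta> \<in> PW" shows "(\<lambda>x. Re (orbit_sum \<eta> x)) \<in> multipliers" "(\<lambda>x. Im (orbit_sum \<eta> x)) \<in> multipliers"
proof -
  have re: "of_real (Re z) = (1 / 2) * (z + cnj z)" for z by (simp add: complex_eq_iff)
  have im: "of_real (Im z) = (1 / (2 * \<i>)) * (z + (- 1) * cnj z)" for z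
    by (simp add: complex_eq_iff Re_divide Im_divide)
  have "(\<lambda>x. (1 / 2) * (f x * orbit_sum \<eta> x + f x * orbit_sum (- \<eta>) x)) \<in> spanA" if "f \<in> spanA" for f
    by (intro span_cmult_fun span_add_fun spanA_mult_orbit_sum that assms PW_minus)
  moreover have "(\<lambda>x. (1 / (2 * \<i>)) * (f x * orbit_sum \<eta> x + (- 1) * (f x * orbit_sum (- \<eta>) x))) \<in> spanA" if "f \<in> spanA" for f
    by (intro span_cmult_fun span_add_fun spanA_mult_orbit_sum that assms PW_minus)
  ultimately show "(\<lambda>x. Re (orbit_sum \<eta> x)) \<in> multipliers" "(\<lambda>x. Im (orbit_sum \<eta> x)) \<in> multipliers"
    unfolding multipliers_def mem_Collect_eq re im orbit_sum_cnj[OF assms]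
    by (auto intro!: continuous_intros continuous_orbit_sum simp: algebra_simps)
qed

text \<open>Translations by the coroot lattice lie in \<open>W\<close>, so w followed by one does
  too. The last conclusion recovers the linear part when stabilizers are considered.\<close>

lemma Q_related_W: "x - w y \<in> Q \<Longrightarrow> w \<in> W0 \<Longrightarrow> \<exists>u\<in>W. u y = x \<and> (u = id \<longrightarrow> w = id)"
proof -
  assume q: "x - w y \<in> Q" and w: "w \<in> W0"
  let ?u = "(\<lambda>v. v + (x - w y)) \<circ> w"
  have "?u \<in> W" by (intro W_comp translation_W q W0_W w)
  moreover have "?u y = x" by simp
  moreover have "w = id" if "?u = id"
  proof -
    have "x - w y = 0" using fun_cong[OF that, of 0] W0_0[OF w] by simp
    then show ?thesis using that by (simp add: fun_eq_iff)
  qed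
  ultimately show ?thesis by blast
qed

text \<open>Otherwise all orbit sums agree at x and y. Independence of characters then produces some
  w y with the same character as x, so x and y lie in one orbit, which is impossible for distinct
  points of the closed alcove.\<close>

lemma multipliers_separate:
  assumes x: "x \<in> S" and y: "y \<in> S" and ne: "x \<noteq> y" shows "\<exists>r\<in>multipliers. r x \<noteq> r y"
proof (rule ccontr)
  assume "\<not> ?thesis"
  then have eq: "orbit_sum \<eta> x = orbit_sum \<eta> y" if "\<eta> \<in> PW" for \<eta>
    using Re_Im_orbit_sum_multipliers[OF that] by (auto intro: complex_eqI)
  \<comment> \<open>\<open>True\<close> marks the points w x with coefficient 1 and
    \<open>False\<close> the points w y with coefficient -1. A class with only coefficients 1 cannot
    sum to 0.\<close>
  let ?I = "(UNIV :: bool set) \<times> W0"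
  define c :: "bool \<times> ('a \<Rightarrow> 'a) \<Rightarrow> complex" where "c i = (if fst i then 1 else - 1)" for i
  define p :: "bool \<times> ('a \<Rightarrow> 'a) \<Rightarrow> 'a" where "p i = snd i (if fst i then x else y)" for i
  have "(\<Sum>i\<in>?I. c i * exp (app \<nu> (p i))) = orbit_sum \<nu> x - orbit_sum \<nu> y" for \<nu>
  proof -
    have "(\<Sum>i\<in>?I. F i) = (\<Sum>b\<in>UNIV. \<Sum>w\<in>W0. F (b, w))" for F :: "bool \<times> ('a \<Rightarrow> 'a) \<Rightarrow> complex"
      by (subst sum.cartesian_product) (simp add: case_prod_unfold)
    then show ?thesis by (simp add: UNIV_bool c_def p_def orbit_sum_def sum_negf)
  qed
  then have s: "(\<Sum>i\<in>?I. c i * exp (app \<nu> (p i))) = 0" if "\<nu> \<in> PW" for \<nu> using eq[OF that] by simp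
  define J where "J = {i. i \<in> ?I \<and> (\<forall>\<nu>\<in>PW. exp (app \<nu> (p i)) = exp (app \<nu> (p (True, id))))}"
  have "(\<Sum>i\<in>J. c i) = 0" unfolding J_def
    by (rule characters_independent[OF PW_0 PW_add _ s]) (use finite_W0 W0_id in auto)
  moreover have "c i = 1" if "i \<in> J" for i
  proof (cases "fst i")
    case False
    have "exp (app \<nu> x) = exp (app \<nu> (snd i y))" if "\<nu> \<in> PW" for \<nu>
      using \<open>i \<in> J\<close> that False by (auto simp: J_def p_def)
    then have "x - snd i y \<in> Q" by (rule PW_exp_eq_imp_Q)
    then obtain u where "u \<in> W" "u y = x" using Q_related_W[of x "snd i" y] \<open>i \<in> J\<close> by (auto simp: J_def)
    then show ?thesis using S_fundamental[of u y] x y ne by simp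
  qed (simp add: c_def)
  moreover have "(True, id) \<in> J" by (simp add: J_def W0_id)
  moreover have "finite J" unfolding J_def by (rule finite_subset[of _ ?I]) (use finite_W0 in auto)
  ultimately show False by (auto simp: sum.cong)
qed

text \<open>Stabilizers are trivial in the open alcove, so no w x with w other than
  \<open>id\<close> shares the character of x, and independence would force \<open>eps id\<close> to
  be 0.\<close>

lemma A_nonzero_at:
  assumes x: "x \<in> C" shows "\<exists>\<nu>\<in>PW. A \<nu> x \<noteq> 0"
proof (rule ccontr)
  assume "\<not> ?thesis"
  then have s: "(\<Sum>w\<in>W0. eps w * exp (app \<nu> (w x))) = 0" if "\<nu> \<in> PW" for \<nu> using that by (auto simp: A_def)
  define J where "J = {w. w \<in> W0 \<and> (\<forall>\<nu>\<in>PW. exp (app \<nu> (w x)) = exp (app \<nu> (id x)))}"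
  have "(\<Sum>w\<in>J. eps w) = 0" unfolding J_def
    by (rule characters_independent[OF PW_0 PW_add finite_W0 s W0_id])
  moreover have "J = {id}"
  proof (intro equalityI subsetI)
    fix w assume w: "w \<in> J"
    then have "exp (app \<nu> x) = exp (app \<nu> (w x))" if "\<nu> \<in> PW" for \<nu>
      using that by (auto simp: J_def)
    then have "x - w x \<in> Q" by (rule PW_exp_eq_imp_Q)
    then obtain u where u: "u \<in> W" "u x = x" "u = id \<longrightarrow> w = id" using Q_related_W[of x w x] w by (auto simp: J_def)
    then show "w \<in> {id}" using stabilizer_trivial[OF u(1) x u(2)] by blast
  qed (auto simp: J_def W0_id)
  ultimately show False by simp
qed

lemma intC_cong: "(\<And>x. x \<in> C \<Longrightarrow> f x = g x) \<Longrightarrow> intC f = intC g"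
  unfolding intC_def by (rule Bochner_Integration.integral_cong) (auto simp: indicator_def)

text \<open>The points of C where K is nonzero form an open set, and the integral makes it a null
  set.\<close>

lemma intC_norm_sq_eq_0:
  assumes K: "continuous_on S K" and z: "intC (\<lambda>x. K x * cnj (K x)) = 0" and x: "x \<in> C"
  shows "K x = 0"
proof (rule ccontr)
  assume nz: "K x \<noteq> 0"
  have i: "integrable lborel (\<lambda>x. indicator C x *\<^sub>R (K x * cnj (K x)))"
    by (rule integrable_C) (intro continuous_intros K)
  have e: "indicator C x *\<^sub>R (K x * cnj (K x)) = of_real (indicator C x * (norm (K x))\<^sup>2)" for x
    by (simp only: scaleR_conv_of_real of_real_mult complex_norm_square)
  have ir: "integrable lborel (\<lambda>x. indicator C x * (norm (K x))\<^sup>2)"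
    using integrable_Re[OF i] unfolding e by simp
  have "(LINT x|lborel. indicator C x * (norm (K x))\<^sup>2) = 0"
    using z unfolding intC_def e by (simp only: integral_complex_of_real of_real_eq_0_iff)
  then have "AE x in lborel. indicator C x * (norm (K x))\<^sup>2 = 0"
    by (subst (asm) integral_nonneg_eq_0_iff_AE[OF ir]) auto
  then have ae: "AE x in lborel. x \<notin> {x \<in> C. K x \<noteq> 0}" by (rule AE_mp) (auto simp: indicator_def)
  have "continuous_on C K" using K closure_subset by (rule continuous_on_subset)
  then have "open (C \<inter> K -` (- {0}))" using open_C by (intro continuous_open_preimage) auto
  then have o: "open {x \<in> C. K x \<noteq> 0}" by (simp add: vimage_def Int_def)
  have "{x \<in> C. K x \<noteq> 0} \<in> null_sets lborel"
    using ae o AE_iff_null_sets[of "{x \<in> C. K x \<noteq> 0}" lborel] by (simp add: borel_open)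
  then have "negligible {x \<in> C. K x \<noteq> 0}" by (simp add: negligible_iff_null_sets null_sets_completionI)
  then show False using open_not_negligible[OF o] x nz by blast
qed

text \<open>For fixed \<nu> the product k A \<nu> is orthogonal to all multipliers, by approximation
  to all continuous functions, and hence 0 on C. At every point of C some A \<nu> is
  nonzero.\<close>

lemma completeness:
  assumes k: "continuous_on S k" and z: "\<And>\<nu>. \<nu> \<in> PW \<Longrightarrow> intC (\<lambda>x. k x * A \<nu> x) = 0" and x: "x \<in> S"
  shows "k x = 0"
proof -
  interpret function_ring_on multipliers S
  proof
    show "compact S" by (rule compact_S)
    show "continuous_on S f" if "f \<in> multipliers" for f using that by (simp add: multipliers_def)
    show "(\<lambda>x. f x + g x) \<in> multipliers" if "f \<in> multipliers" "g \<in> multipliers" for f g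
      using that by (auto simp: multipliers_def distrib_left intro!: continuous_intros span_add_fun)
    show "(\<lambda>x. f x * g x) \<in> multipliers" if fg: "f \<in> multipliers" "g \<in> multipliers" for f g
    proof -
      have "(\<lambda>x. h x * of_real (f x) * of_real (g x)) \<in> spanA" if "h \<in> spanA" for h
      proof -
        have f1: "(\<lambda>x. h x * of_real (f x)) \<in> spanA" if "h \<in> spanA" for h
          using fg(1) that by (simp add: multipliers_def)
        have g1: "(\<lambda>x. h x * of_real (g x)) \<in> spanA" if "h \<in> spanA" for h
          using fg(2) that by (simp add: multipliers_def)
        show ?thesis by (rule g1[OF f1[OF that]])
      qed
      then show ?thesis using fg by (auto simp: multipliers_def mult.assoc intro!: continuous_intros)
    qed
    show "(\<lambda>_. c) \<in> multipliers" for c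
      using span_cmult_fun[of _ "A ` PW" "of_real c"] by (auto simp: multipliers_def mult.commute)
    show "\<exists>f\<in>multipliers. f x \<noteq> f y" if "x \<in> S" "y \<in> S" "x \<noteq> y" for x y using multipliers_separate[OF that] .
  qed
  have span0: "intC (\<lambda>x. k x * f x) = 0" if "f \<in> spanA" for f
  proof -
    have "continuous_on S f \<and> intC (\<lambda>x. k x * f x) = 0" using that
    proof (induction rule: spanA_induct)
      case zero
      show ?case by (simp add: intC_def)
    next
      case (step c \<nu> g)
      have Ac: "continuous_on S (A \<nu>)" by (intro smooth_continuous smooth_A)
      have "intC (\<lambda>x. c * (k x * A \<nu> x) + k x * g x) = c * intC (\<lambda>x. k x * A \<nu> x) + intC (\<lambda>x. k x * g x)"
        using step Ac k by (subst intC_add) (auto simp: intC_cmult intro!: continuous_intros)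
      then show ?case using step z Ac by (auto simp: algebra_simps intro!: continuous_intros)
    qed
    then show ?thesis by blast
  qed
  have kA: "k x * A \<nu> x = 0" if nu: "\<nu> \<in> PW" and xC: "x \<in> C" for \<nu> x
  proof -
    define K where "K x = k x * A \<nu> x" for x
    have Kc: "continuous_on S K" unfolding K_def by (intro continuous_intros k smooth_continuous smooth_A)
    have g0: "intC (\<lambda>x. K x * of_real (g x)) = 0" if g: "continuous_on S g" for g :: "'a \<Rightarrow> real"
    proof -
      define m where "m = (LINT x|lborel. norm (indicator C x *\<^sub>R K x))"
      have m0: "m \<ge> 0" unfolding m_def by (rule Bochner_Integration.integral_nonneg) simp
      have Kint: "integrable lborel (\<lambda>x. indicator C x *\<^sub>R K x)" by (rule integrable_C[OF Kc])
      have le: "norm (intC (\<lambda>x. K x * of_real (g x))) \<le> e * m" if e: "e > 0" for e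
      proof -
        obtain r where r: "r \<in> multipliers" "\<And>x. x \<in> S \<Longrightarrow> \<bar>g x - r x\<bar> < e" using Stone_Weierstrass_basic[OF g e] by blast
        have rc: "continuous_on S r" using r(1) by (simp add: multipliers_def)
        have "(\<lambda>x. A \<nu> x * of_real (r x)) \<in> spanA" using r(1) spanA_I[OF nu] by (simp add: multipliers_def)
        from span0[OF this] have r0: "intC (\<lambda>x. K x * of_real (r x)) = 0" by (simp add: K_def mult.assoc)
        have "intC (\<lambda>x. K x * of_real (g x)) = intC (\<lambda>x. K x * of_real (g x) - K x * of_real (r x))"
          using Kc g rc r0 by (subst intC_diff) (auto intro!: continuous_intros)
        also have "norm \<dots> \<le> (LINT x|lborel. norm (indicator C x *\<^sub>R (K x * of_real (g x) - K x * of_real (r x))))"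
          unfolding intC_def by (rule integral_norm_bound)
        also have "\<dots> \<le> (LINT x|lborel. e * norm (indicator C x *\<^sub>R K x))"
        proof (rule integral_mono)
          show "integrable lborel (\<lambda>x. norm (indicator C x *\<^sub>R (K x * of_real (g x) - K x * of_real (r x))))"
            by (intro integrable_norm integrable_C continuous_intros Kc g rc)
          show "integrable lborel (\<lambda>x. e * norm (indicator C x *\<^sub>R K x))"
            by (intro integrable_mult_right integrable_norm Kint)
          fix x
          have "norm (K x * of_real (g x) - K x * of_real (r x)) \<le> e * norm (K x)" if "x \<in> C"
          proof -
            have "norm (K x * of_real (g x) - K x * of_real (r x)) = norm (K x) * \<bar>g x - r x\<bar>"
              by (metis norm_mult norm_of_real of_real_diff right_diff_distrib)
            also have "\<dots> \<le> norm (K x) * e" using r(2)[OF C_S[OF that]] by (intro mult_left_mono) auto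
            finally show ?thesis by (simp add: mult.commute)
          qed
          then show "norm (indicator C x *\<^sub>R (K x * of_real (g x) - K x * of_real (r x))) \<le> e * norm (indicator C x *\<^sub>R K x)"
            by (auto simp: indicator_def)
        qed
        also have "\<dots> = e * m" unfolding m_def by simp
        finally show ?thesis .
      qed
      have "norm (intC (\<lambda>x. K x * of_real (g x))) \<le> 0 + e" if "e > 0" for e
      proof -
        \<comment> \<open>Dividing by m + 1 covers the case m = 0.\<close>
        have "e / (m + 1) * m \<le> e" using m0 that by (simp add: field_simps)
        moreover have "norm (intC (\<lambda>x. K x * of_real (g x))) \<le> e / (m + 1) * m"
          using m0 that by (intro le) simp
        ultimately show ?thesis by linarith
      qed
      then have "norm (intC (\<lambda>x. K x * of_real (g x))) \<le> 0" by (rule field_le_epsilon)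
      then show ?thesis by simp
    qed
    \<comment> \<open>The real and imaginary parts of K are admissible choices of g, so the integral
      of |K|^2 vanishes.\<close>
    have "K x * cnj (K x) = K x * of_real (Re (K x)) - \<i> * (K x * of_real (Im (K x)))" for x
      by (simp add: complex_eq_iff)
    then have "intC (\<lambda>x. K x * cnj (K x)) = intC (\<lambda>x. K x * of_real (Re (K x))) - \<i> * intC (\<lambda>x. K x * of_real (Im (K x)))"
      using Kc by (simp only:) (subst intC_diff, auto simp: intC_cmult intro!: continuous_intros)
    also have "\<dots> = 0" using Kc by (simp add: g0 continuous_intros)
    finally have "K x = 0" by (rule intC_norm_sq_eq_0[OF Kc _ xC])
    then show ?thesis by (simp add: K_def)
  qed
  have "k x = 0" if "x \<in> C" for x
    using A_nonzero_at[OF that] kA[OF _ that] by auto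
  then show ?thesis using continuous_constant_on_closure[OF k _ x, of 0] by blast
qed

section \<open>Orthogonal projection and the expansion of weak solutions\<close>

lemma continuous_span:
  assumes "\<And>g. g \<in> X \<Longrightarrow> continuous_on S g" "f \<in> cfun.span X" shows "continuous_on S f"
  using assms(2)
proof (induction rule: cfun.span_induct_alt)
  case base
  show ?case by (simp add: zero_fun_def)
next
  case (step c x y)
  then show ?case using assms(1) by (auto simp: plus_fun_def fscale_def intro!: continuous_intros)
qed

lemma orthogonal_span:
  assumes f: "continuous_on S f" and X: "\<And>g. g \<in> X \<Longrightarrow> continuous_on S g"
    and o: "\<And>g. g \<in> X \<Longrightarrow> intC (\<lambda>x. f x * cnj (g x)) = 0" and h: "h \<in> cfun.span X"
  shows "intC (\<lambda>x. f x * cnj (h x)) = 0"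
proof -
  have "continuous_on S h \<and> intC (\<lambda>x. f x * cnj (h x)) = 0" using h
  proof (induction rule: cfun.span_induct_alt)
    case base
    show ?case by (simp add: zero_fun_def intC_def)
  next
    case (step c g h)
    have "intC (\<lambda>x. cnj c * (f x * cnj (g x)) + f x * cnj (h x)) = cnj c * intC (\<lambda>x. f x * cnj (g x)) + intC (\<lambda>x. f x * cnj (h x))"
      using step f X by (subst intC_add) (auto simp: intC_cmult intro!: continuous_intros)
    then show ?case using step o X by (auto simp: plus_fun_def fscale_def algebra_simps intro!: continuous_intros)
  qed
  then show ?thesis by blast
qed

text \<open>Gram-Schmidt without assuming independence: the A \<nu> of one level can vanish or be
  proportional along an orbit.\<close>

lemma orthogonal_projection:
  assumes "finite X" "\<And>g. g \<in> X \<Longrightarrow> continuous_on S g" "continuous_on S f"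
  shows "\<exists>f0\<in>cfun.span X. \<forall>g\<in>X. intC (\<lambda>x. (f x - f0 x) * cnj (g x)) = 0"
  using assms
proof (induction X arbitrary: f)
  case empty
  then show ?case by (auto intro: cfun.span_zero)
next
  case (insert g X)
  have Xc: "\<And>h. h \<in> X \<Longrightarrow> continuous_on S h" and gc: "continuous_on S g" using insert.prems by auto
  obtain f0 where f0: "f0 \<in> cfun.span X" "\<And>h. h \<in> X \<Longrightarrow> intC (\<lambda>x. (f x - f0 x) * cnj (h x)) = 0"
    using insert.IH[OF Xc insert.prems(2)] by blast
  obtain g0 where g0: "g0 \<in> cfun.span X" "\<And>h. h \<in> X \<Longrightarrow> intC (\<lambda>x. (g x - g0 x) * cnj (h x)) = 0"
    using insert.IH[OF Xc gc] by blast
  have fc: "continuous_on S f0" and g0c: "continuous_on S g0" using continuous_span[OF Xc] f0(1) g0(1) by auto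
  define g' where "g' x = g x - g0 x" for x
  have g'c: "continuous_on S g'" unfolding g'_def by (intro continuous_intros gc g0c)
  define q where "q = intC (\<lambda>x. g' x * cnj (g' x))"
  \<comment> \<open>For q = 0 the function g' vanishes on C and the coefficient is
    immaterial.\<close>
  define t where "t = (if q = 0 then 0 else intC (\<lambda>x. (f x - f0 x) * cnj (g' x)) / q)"
  define f1 where "f1 x = f0 x + t * g' x" for x
  have f1c: "continuous_on S (\<lambda>x. f x - f1 x)" unfolding f1_def by (intro continuous_intros fc g'c insert.prems)
  have mono: "cfun.span X \<subseteq> cfun.span (insert g X)" by (intro cfun.span_mono) auto
  have f1_eq: "f1 = f0 + fscale t (g - g0)" by (simp add: fun_eq_iff f1_def fscale_def g'_def)
  have "f0 \<in> cfun.span (insert g X)" "g0 \<in> cfun.span (insert g X)" using f0(1) g0(1) mono by auto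
  moreover have "g \<in> cfun.span (insert g X)" by (intro cfun.span_base insertI1)
  ultimately have span: "f1 \<in> cfun.span (insert g X)"
    unfolding f1_eq by (intro cfun.span_add cfun.span_scale cfun.span_diff)
  have split: "intC (\<lambda>x. (f x - f1 x) * cnj (h x)) = intC (\<lambda>x. (f x - f0 x) * cnj (h x)) - t * intC (\<lambda>x. g' x * cnj (h x))"
    if hc: "continuous_on S h" for h
  proof -
    have "intC (\<lambda>x. (f x - f0 x) * cnj (h x) - t * (g' x * cnj (h x)))
        = intC (\<lambda>x. (f x - f0 x) * cnj (h x)) - t * intC (\<lambda>x. g' x * cnj (h x))"
      using hc fc g'c insert.prems by (subst intC_diff) (auto simp: intC_cmult intro!: continuous_intros)
    then show ?thesis by (simp add: f1_def algebra_simps)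
  qed
  have oX: "intC (\<lambda>x. (f x - f1 x) * cnj (h x)) = 0" if "h \<in> X" for h
    using split[OF Xc[OF that]] f0(2)[OF that] g0(2)[OF that] by (simp add: g'_def)
  have og': "intC (\<lambda>x. (f x - f1 x) * cnj (g' x)) = 0"
  proof (cases "q = 0")
    case True
    then have "g' x = 0" if "x \<in> C" for x using intC_norm_sq_eq_0[OF g'c _ that] by (simp add: q_def)
    then have "intC (\<lambda>x. (f x - f1 x) * cnj (g' x)) = intC (\<lambda>x. 0)" by (intro intC_cong) simp
    then show ?thesis by (simp add: intC_def)
  next
    case False
    then show ?thesis using split[OF g'c] by (simp add: t_def q_def)
  qed
  have "intC (\<lambda>x. (f x - f1 x) * cnj (g0 x)) = 0" by (rule orthogonal_span[OF f1c Xc oX g0(1)])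
  moreover have "intC (\<lambda>x. (f x - f1 x) * cnj (g' x) + (f x - f1 x) * cnj (g0 x))
      = intC (\<lambda>x. (f x - f1 x) * cnj (g' x)) + intC (\<lambda>x. (f x - f1 x) * cnj (g0 x))"
    by (rule intC_add) (intro continuous_intros f1c g'c g0c)+
  moreover have "(f x - f1 x) * cnj (g' x) + (f x - f1 x) * cnj (g0 x) = (f x - f1 x) * cnj (g x)" for x
    by (simp add: g'_def algebra_simps)
  ultimately have "intC (\<lambda>x. (f x - f1 x) * cnj (g x)) = 0" using og' by simp
  then show ?case using span oX by blast
qed

lemma A_span_expo: "A \<nu> \<in> cfun.span (expo ` {\<eta>. \<exists>w\<in>W0. \<eta> = dual_act w \<nu>})"
proof -
  have "A \<nu> = (\<lambda>x. \<Sum>w\<in>W0. eps w * expo (dual_act w \<nu>) x)" by (simp add: fun_eq_iff A_dual_act expo_def)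
  also have "\<dots> \<in> cfun.span (expo ` {\<eta>. \<exists>w\<in>W0. \<eta> = dual_act w \<nu>})"
    by (intro span_sum_fun span_cmult_fun cfun.span_base imageI) auto
  finally show ?thesis .
qed

text \<open>Subtract from f its projection to the finite span of the A \<nu> with eigenvalue c. The
  difference is orthogonal to these by construction and to the others by Green's identity for both
  functions, so completeness applies.\<close>

lemma dirichlet_expansion:
  assumes f: "dirichlet c f"
  obtains N a f0 where "finite N" "N \<subseteq> PW" "anti f0" "\<And>x. f0 x = (\<Sum>\<nu>\<in>N. a \<nu> * exp (app \<nu> x))"
    "\<And>x. x \<in> S \<Longrightarrow> f x = f0 x"
proof -
  let ?F = "{\<nu> \<in> PW. sq_poly \<nu> = c}"
  have fc: "continuous_on S f" using f by (simp add: dirichlet_def)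
  have Ac: "continuous_on S (A \<nu>)" for \<nu> by (intro smooth_continuous smooth_A)
  have "\<exists>f0\<in>cfun.span (A ` ?F). \<forall>g\<in>A ` ?F. intC (\<lambda>x. (f x - f0 x) * cnj (g x)) = 0"
    by (rule orthogonal_projection) (use finite_PW_level Ac fc in auto)
  then obtain f0 where f0: "f0 \<in> cfun.span (A ` ?F)" "\<And>\<nu>. \<nu> \<in> ?F \<Longrightarrow> intC (\<lambda>x. (f x - f0 x) * cnj (A \<nu> x)) = 0"
    by blast
  have fA: "f0 \<in> spanA" using f0(1) cfun.span_mono[of "A ` ?F" "A ` PW"] by blast
  have sm: "smooth f0" and an: "anti f0" using spanA_smooth_anti[OF fA] by auto
  have "cfun.span (A ` ?F) \<subseteq> cfun.span (expo ` ?F)"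
  proof (rule cfun.span_minimal)
    show "A ` ?F \<subseteq> cfun.span (expo ` ?F)"
    proof clarify
      fix \<nu> assume "\<nu> \<in> PW" "c = sq_poly \<nu>"
      then have "{\<eta>. \<exists>w\<in>W0. \<eta> = dual_act w \<nu>} \<subseteq> {\<nu>' \<in> PW. sq_poly \<nu>' = sq_poly \<nu>}" by (auto simp: PW_dual_act sq_poly_dual_act)
      then show "A \<nu> \<in> cfun.span (expo ` {\<nu>' \<in> PW. sq_poly \<nu>' = sq_poly \<nu>})"
        using A_span_expo[of \<nu>] cfun.span_mono[OF image_mono, of _ _ expo] by blast
    qed
  qed (rule cfun.subspace_span)
  then have "f0 \<in> cfun.span (expo ` ?F)" using f0(1) by blast
  then obtain N a where N: "finite N" "N \<subseteq> ?F" "\<And>x. f0 x = (\<Sum>\<nu>\<in>N. a \<nu> * exp (app \<nu> x))"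
    by (rule span_expo_E) blast
  have f0c: "continuous_on S f0" by (rule smooth_continuous[OF sm])
  have "dirichlet c f0"
    unfolding dirichlet_def
  proof (intro conjI allI impI f0c)
    show "\<exists>K\<ge>0. \<forall>x\<in>S. \<forall>j\<in>Del. norm (f0 x) \<le> K * aff_apply j x"
      by (rule wall_bound[OF open_UNIV subset_UNIV C1_on_smooth[OF sm]]) (use anti_wall[OF an Del_Sig] in blast)
    fix h assume h: "test_function C h"
    have "const_coeff_op UNIV (\<lambda>\<xi>. sq_poly (- \<xi>)) (laplacian :: ('a \<Rightarrow> complex) \<Rightarrow> _)"
      unfolding sq_poly_minus by (rule const_coeff_op_laplacian) simp
    from exp_sum_transpose[OF N(1) this h, of a]
    have "(LINT x|lborel. f0 x * laplacian h x) = (LINT x|lborel. (\<Sum>\<nu>\<in>N. a \<nu> * sq_poly \<nu> * exp (app \<nu> x)) * h x)"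
      unfolding N(3) .
    moreover have "(\<Sum>\<nu>\<in>N. a \<nu> * sq_poly \<nu> * exp (app \<nu> x)) = c * f0 x" for x
      unfolding N(3) sum_distrib_left by (rule sum.cong) (use N(2) in auto)
    ultimately show "(LINT x|lborel. f0 x * laplacian h x) = c * (LINT x|lborel. f0 x * h x)"
      by (simp add: mult.assoc)
  qed
  note d0 = this
  have z: "intC (\<lambda>x. (f x - f0 x) * A \<nu> x) = 0" if nu: "\<nu> \<in> PW" for \<nu>
  proof (cases "sq_poly \<nu> = c")
    case True
    \<comment> \<open>Completeness pairs without conjugation, whereas the projection conjugates;
      conjugation negates the exponent and preserves the level.\<close>
    then have "- \<nu> \<in> ?F" using nu by (simp add: PW_minus sq_poly_minus)
    from f0(2)[OF this] show ?thesis by (simp add: A_minus_cnj[OF PW_minus[OF nu]])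
  next
    case False
    have "intC (\<lambda>x. f x * A \<nu> x - f0 x * A \<nu> x) = intC (\<lambda>x. f x * A \<nu> x) - intC (\<lambda>x. f0 x * A \<nu> x)"
      by (rule intC_diff) (intro continuous_intros fc f0c Ac)+
    also have "\<dots> = 0" using dirichlet_green[OF f nu] dirichlet_green[OF d0 nu] False by simp
    finally show ?thesis by (simp add: algebra_simps)
  qed
  have "f x = f0 x" if "x \<in> S" for x
    using completeness[of "\<lambda>x. f x - f0 x" x] z that fc f0c by (auto intro!: continuous_intros)
  then show ?thesis using that[OF N(1) _ an N(3)] N(2) by blast
qed

end

section \<open>Solutions of the boundary value problem\<close>

lemma const_coeff_op_mono: "const_coeff_op K p D \<Longrightarrow> K \<subseteq> K' \<Longrightarrow> const_coeff_op K' p D"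
  by (induction rule: const_coeff_op.induct) (auto intro: const_coeff_op.intros)

lemma smooth_prod: "(\<And>i. i \<in> I \<Longrightarrow> smooth (f i)) \<Longrightarrow> smooth (\<lambda>x. \<Prod>i\<in>I. f i x)"
  by (induction I rule: infinite_finite_induct) (auto intro: smooth_const smooth_mult)

text \<open>Proper subspaces are null sets, and finitely many null sets do not cover the
  space.\<close>

lemma finite_union_proper_kernels:
  fixes L :: "'i \<Rightarrow> 'a::euclidean_space cdual"
  assumes "finite I" "\<And>v. \<exists>i\<in>I. app (L i) v = 0" shows "\<exists>i\<in>I. L i = 0"
proof (rule ccontr)
  assume n: "\<not> ?thesis"
  have "negligible {v. app (L i) v = 0}" if "i \<in> I" for i
  proof (rule negligible_lowdim)
    have sub: "subspace {v. app (L i) v = 0}"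
      by (rule subspaceI) (auto simp: blinfun.add_right blinfun.scaleR_right)
    have "{v. app (L i) v = 0} \<noteq> UNIV"
    proof
      assume "{v. app (L i) v = 0} = UNIV"
      then have "L i = 0" by (intro blinfun_eqI) auto
      then show False using n that by blast
    qed
    then have "dim {v. app (L i) v = 0} \<noteq> DIM('a)"
      using sub by (simp add: dim_eq_full span_eq_iff[THEN iffD2])
    then show "dim {v. app (L i) v = 0} < DIM('a)"
      using dim_subset_UNIV[of "{v. app (L i) v = 0}"] by linarith
  qed
  then have "negligible (\<Union>i\<in>I. {v. app (L i) v = 0})"
    using assms(1) by (intro negligible_Union) auto
  moreover have "(\<Union>i\<in>I. {v. app (L i) v = 0}) = UNIV" using assms(2) by auto
  ultimately show False by simp
qed

context root_data begin

lemma dual_act_inv: "w \<in> W0 \<Longrightarrow> dual_act w (dual_act (inv w) \<nu>) = \<nu>"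
  by (rule blinfun_eqI) (simp add: dual_act_apply W0_inv W0_inv_apply inv_inv_eq W_inv W0_W)

lemma A_dual_act_eq: assumes "w \<in> W0" shows "A (dual_act w \<nu>) x = eps w * A \<nu> x"
proof -
  have "A (dual_act w \<nu>) x = (\<Sum>u\<in>W0. eps (w \<circ> u) * exp (app (dual_act w \<nu>) ((w \<circ> u) x)))"
    unfolding A_def by (rule sum.reindex_bij_betw[OF bij_betw_W0_comp_left[OF assms], symmetric])
  also have "\<dots> = eps w * A \<nu> x" unfolding A_def sum_distrib_left
  proof (rule sum.cong)
    fix u assume "u \<in> W0"
    then have "eps (w \<circ> u) = eps w * eps u" using assms by (intro eps_comp W0_W)
    moreover have "app (dual_act w \<nu>) ((w \<circ> u) x) = app \<nu> (u x)"
      using assms by (simp add: dual_act_apply W0_inv_apply)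
    ultimately show "eps (w \<circ> u) * exp (app (dual_act w \<nu>) ((w \<circ> u) x)) = eps w * (eps u * exp (app \<nu> (u x)))"
      by (simp only: mult.assoc)
  qed simp
  finally show ?thesis .
qed

text \<open>Test with the conjugate of the sum times a nonnegative cutoff: the integrand is
  nonnegative, so the sum vanishes on the alcove. Exponents in 2\<pi>iP make the conjugate again an
  exponential sum, hence smooth.\<close>

lemma exp_sum_vanishes:
  fixes N :: "'a cdual set"
  assumes N: "finite N" "N \<subseteq> PW"
    and z: "\<And>h. test_function C h \<Longrightarrow> (LINT x|lborel. (\<Sum>\<nu>\<in>N. b \<nu> * exp (app \<nu> x)) * h x) = 0"
    and \<nu>: "\<nu> \<in> N"
  shows "b \<nu> = 0"
proof (rule exp_linear_independent[OF N(1) open_C _ _ \<nu>])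
  show "C \<noteq> {}" using x0_C by blast
  fix x assume x: "x \<in> C"
  define F where "F x = (\<Sum>\<nu>\<in>N. b \<nu> * exp (app \<nu> x))" for x
  \<comment> \<open>Chosen after x, so that the product of the cutoffs is positive at x.\<close>
  have "\<forall>\<^sub>F n in sequentially. \<forall>j\<in>Del. real (Suc n) * aff_apply j x > 1"
  proof (intro eventually_ball_finite[OF finite_Del] ballI)
    fix j assume "j \<in> Del"
    then have "aff_apply j x > 0" using x by (simp add: C_iff)
    moreover have "filterlim (\<lambda>n. real (Suc n)) at_top sequentially"
      by (rule filterlim_compose[OF filterlim_real_sequentially filterlim_Suc])
    ultimately have "filterlim (\<lambda>n. real (Suc n) * aff_apply j x) at_top sequentially"
      by (intro filterlim_at_top_mult_tendsto_pos[OF tendsto_const]) auto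
    then show "\<forall>\<^sub>F n in sequentially. real (Suc n) * aff_apply j x > 1"
      by (simp add: filterlim_at_top_dense)
  qed
  then obtain n where n: "\<And>j. j \<in> Del \<Longrightarrow> real (Suc n) * aff_apply j x > 1"
    by (auto simp: eventually_sequentially)
  let ?T = "\<lambda>j x. real (Suc n) * aff_apply j x - 1"
  define \<eta> where "\<eta> x = (\<Prod>j\<in>Del. flat 1 (?T j x))" for x
  have ct: "cutoff 1 (real (Suc n) *\<^sub>R fst j) (real (Suc n) * snd j - 1) x = of_real (flat 1 (?T j x))" for j x
    by (simp add: cutoff_def aff_apply_def blinfun.scaleR_left distrib_left add_diff_eq del: of_nat_Suc)
  have "(\<lambda>x. \<Prod>j\<in>Del. cutoff 1 (real (Suc n) *\<^sub>R fst j) (real (Suc n) * snd j - 1) x) = (\<lambda>x. of_real (\<eta> x))"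
    unfolding ct \<eta>_def by simp
  moreover have "smooth (\<lambda>x. \<Prod>j\<in>Del. cutoff 1 (real (Suc n) *\<^sub>R fst j) (real (Suc n) * snd j - 1) x)"
    by (intro smooth_prod smooth_cutoff)
  ultimately have sm_eta: "smooth (\<lambda>x. complex_of_real (\<eta> x))" by simp
  have eta0: "\<eta> y \<ge> 0" for y unfolding \<eta>_def by (intro prod_nonneg) (simp add: flat_def)
  have sm_exp: "smooth (\<lambda>x. exp (app \<nu> x))" for \<nu> :: "'a cdual"
    using smooth_exp_sum[of "{\<nu>}" "\<lambda>_. 1"] by simp
  have "(\<lambda>x. cnj (F x)) = (\<lambda>x. \<Sum>\<nu>\<in>N. cnj (b \<nu>) * exp (app (- \<nu>) x))"
    unfolding F_def using N(2) by (auto simp: PW_cnj_exp fun_eq_iff intro!: sum.cong)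
  moreover have "smooth (\<lambda>x. \<Sum>\<nu>\<in>N. cnj (b \<nu>) * exp (app (- \<nu>) x))"
    by (intro smooth_sum smooth_cmult sm_exp)
  ultimately have sm_F: "smooth (\<lambda>x. cnj (F x))" by simp
  define h where "h x = cnj (F x) * of_real (\<eta> x)" for x
  let ?X = "{x. \<forall>j\<in>Del. 1 / real (Suc n) \<le> aff_apply j x}"
  have "?X = (\<Inter>j\<in>Del. {x. 1 / real (Suc n) \<le> aff_apply j x})" by auto
  then have "closed ?X" by (auto intro!: closed_INT closed_Collect_le continuous_aff_apply continuous_intros)
  moreover have XC: "?X \<subseteq> C"
  proof
    fix y assume y: "y \<in> ?X"
    have "(0 :: real) < 1 / real (Suc n)" by simp
    then show "y \<in> C" unfolding C_iff using y less_le_trans by blast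
  qed
  ultimately have X: "compact ?X" using compact_Int_closed[OF compact_S, of ?X] closure_subset[of C] by (simp add: inf_absorb2 subset_trans)
  have hX: "h y = 0" if y: "y \<notin> ?X" for y
  proof -
    obtain j where j: "j \<in> Del" "aff_apply j y < 1 / real (Suc n)" using y by (auto simp: not_le)
    have "real (Suc n) * aff_apply j y < 1" using j(2) by (simp add: pos_less_divide_eq mult.commute del: of_nat_Suc)
    then have "flat 1 (?T j y) = 0" by (simp add: flat_def del: of_nat_Suc)
    then have "\<eta> y = 0" unfolding \<eta>_def using j(1) finite_Del by (intro prod_zero) auto
    then show ?thesis by (simp add: h_def)
  qed
  have "smooth h" unfolding h_def[abs_def] by (intro smooth_mult sm_F sm_eta)
  then have "test_function C h" by (rule test_functionI[OF _ X XC hX])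
  then have Fh: "(LINT x|lborel. F x * h x) = 0" using z by (simp add: F_def)
  \<comment> \<open>The square root writes the integrand as |K|^2; continuity of K suffices.\<close>
  define K where "K x = F x * of_real (sqrt (\<eta> x))" for x
  have KK: "K x * cnj (K x) = F x * h x" for x
  proof -
    have "complex_of_real (sqrt (\<eta> x)) * of_real (sqrt (\<eta> x)) = of_real (\<eta> x)"
      by (simp only: of_real_mult[symmetric] real_sqrt_mult_self abs_of_nonneg[OF eta0])
    then show ?thesis unfolding K_def h_def by (simp add: algebra_simps)
  qed
  have "intC (\<lambda>x. K x * cnj (K x)) = (LINT x|lborel. F x * h x)"
    unfolding intC_def KK
    by (rule Bochner_Integration.integral_cong) (use XC hX in \<open>force simp: indicator_def\<close>)+
  then have K0: "intC (\<lambda>x. K x * cnj (K x)) = 0" using Fh by simp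
  have "continuous_on S (\<lambda>x. Re (complex_of_real (\<eta> x)))"
    by (intro continuous_intros smooth_continuous sm_eta)
  then have ec: "continuous_on S \<eta>" by simp
  have "continuous_on S (\<lambda>x. cnj (cnj (F x)))" by (intro continuous_intros smooth_continuous sm_F)
  then have Fc: "continuous_on S F" by simp
  have "continuous_on S K" unfolding K_def by (intro continuous_intros Fc ec)
  then have "K x = 0" by (rule intC_norm_sq_eq_0[OF _ K0 x])
  moreover have "\<eta> x > 0" unfolding \<eta>_def
    by (intro prod_pos) (use n in \<open>auto simp: flat_def simp del: of_nat_Suc\<close>)
  ultimately show "(\<Sum>\<nu>\<in>N. b \<nu> * exp (app \<nu> x)) = 0" by (simp add: K_def F_def)
qed

section \<open>Invariant polynomials and the orbit of the spectral parameter\<close>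

definition W0_poly :: "'a \<Rightarrow> complex \<Rightarrow> 'a cdual \<Rightarrow> complex" where
  "W0_poly v z \<xi> = (\<Prod>w\<in>W0. z - app \<xi> (w v))"

text \<open>The product is the monic polynomial with roots \<xi>(w v), evaluated at z. A real z
  keeps the coefficients in \<xi> real, as the boundary value problem tests only real
  invariants.\<close>

lemma W0_poly_op: "\<exists>D. const_coeff_op \<real> (W0_poly v (of_real z)) D"
  unfolding W0_poly_def[abs_def]
proof (rule const_coeff_op_prod[OF finite_W0])
  fix w :: "'a \<Rightarrow> 'a"
  have "(\<lambda>\<xi>. of_real z - app \<xi> (w v)) = (\<lambda>\<xi> :: 'a cdual. of_real z + app \<xi> (- w v))"
    by (simp add: blinfun.minus_right)
  then show "\<exists>D. const_coeff_op \<real> (\<lambda>\<xi>. of_real z - app \<xi> (w v)) D"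
    using const_coeff_op.add[OF const_coeff_op.const[of "of_real z" \<real>] const_coeff_op.vector[of \<real> "- w v"]] by auto
qed simp

lemma W0_poly_invariant: "weyl_invariant R (W0_poly v z)"
  unfolding weyl_invariant_def
proof (intro ballI allI)
  fix u and \<xi> :: "'a cdual" assume u: "u \<in> W0"
  have "W0_poly v z (dual_act u \<xi>) = (\<Prod>w\<in>W0. z - app \<xi> ((inv u \<circ> w) v))"
    by (simp add: W0_poly_def dual_act_apply u)
  also have "\<dots> = W0_poly v z \<xi>" unfolding W0_poly_def
    by (rule prod.reindex_bij_betw[OF bij_betw_W0_comp_left[OF W0_inv[OF u]]])
  finally show "W0_poly v z (dual_act u \<xi>) = W0_poly v z \<xi>" .
qed

text \<open>
  For every \<open>v\<close> some \<open>w\<close> satisfies \<open>\<nu>(w v) = \<mu>(v)\<close>; as \<open>V\<close> is not a finite union of proper subspaces,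
  one \<open>w\<close> works for all \<open>v\<close>.
\<close>

lemma W0_poly_separates:
  assumes "\<And>v z. W0_poly v (of_real z) \<nu> = W0_poly v (of_real z) \<mu>"
  shows "\<exists>w\<in>W0. \<nu> = dual_act w \<mu>"
proof -
  have ex: "\<exists>w\<in>W0. app (dual_act (inv w) \<nu> - \<mu>) v = 0" for v
  proof -
    let ?p = "\<lambda>\<xi> :: 'a cdual. \<Prod>w\<in>W0. [:- app \<xi> (w v), 1:]"
    have pv: "poly (?p \<xi>) z = W0_poly v z \<xi>" for \<xi> z by (simp add: W0_poly_def poly_prod)
    \<comment> \<open>Polynomials in z that agree at all real z are equal, so z may be taken to be
      the complex number \<mu>(v), where the factor of \<open>id\<close> vanishes.\<close>
    have "?p \<nu> - ?p \<mu> = 0"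
    proof (rule ccontr)
      assume "?p \<nu> - ?p \<mu> \<noteq> 0"
      then have "finite {z. poly (?p \<nu> - ?p \<mu>) z = 0}" by (rule poly_roots_finite)
      moreover have "range complex_of_real \<subseteq> {z. poly (?p \<nu> - ?p \<mu>) z = 0}" using assms by (auto simp: pv)
      ultimately have "finite (range complex_of_real)" using finite_subset by blast
      then show False using finite_imageD[OF _ inj_of_real] infinite_UNIV_char_0 by blast
    qed
    then have "W0_poly v (app \<mu> v) \<nu> = W0_poly v (app \<mu> v) \<mu>" by (simp flip: pv)
    also have "\<dots> = 0" unfolding W0_poly_def by (rule prod_zero[OF finite_W0]) (use W0_id in \<open>auto intro!: bexI[of _ id]\<close>)
    finally obtain w where "w \<in> W0" "app \<mu> v = app \<nu> (w v)"
      using finite_W0 by (auto simp: W0_poly_def)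
    then show ?thesis
      by (intro bexI[of _ w]) (simp_all add: blinfun.diff_left dual_act_apply W0_inv inv_inv_eq W_inv W0_W)
  qed
  obtain w where w: "w \<in> W0" "dual_act (inv w) \<nu> - \<mu> = 0"
    using finite_union_proper_kernels[OF finite_W0 ex] by blast
  then have "\<nu> = dual_act w \<mu>" using dual_act_inv[OF w(1), of \<nu>] by simp
  then show ?thesis using w(1) by blast
qed

text \<open>Only data on the closed alcove and weak equations inside it enter, so that antisymmetric
  eigenfunctions and solutions of the boundary value problem are treated alike.\<close>

lemma boundary_value_solution:
  assumes fc: "continuous_on S f"
    and bound: "\<exists>K\<ge>0. \<forall>x\<in>S. \<forall>j\<in>Del. norm (f x) \<le> K * aff_apply j x"
    and weak: "\<And>p D. const_coeff_op \<real> p D \<Longrightarrow> weyl_invariant R p \<Longrightarrow> weak_eigen C p \<mu> f"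
  shows "(\<exists>a. \<forall>x\<in>S. f x = a * A \<mu> x) \<and> ((\<exists>x\<in>S. f x \<noteq> 0) \<longrightarrow> \<mu> \<in> PW)"
proof -
  have "const_coeff_op \<real> sq_poly (laplacian :: ('a \<Rightarrow> complex) \<Rightarrow> _)" by (rule const_coeff_op_laplacian) simp
  moreover have "weyl_invariant R sq_poly" by (simp add: weyl_invariant_def sq_poly_dual_act)
  ultimately have "weak_eigen C sq_poly \<mu> f" by (rule weak)
  moreover have "const_coeff_op UNIV (\<lambda>\<xi>. sq_poly (- \<xi>)) (laplacian :: ('a \<Rightarrow> complex) \<Rightarrow> _)"
    unfolding sq_poly_minus by (rule const_coeff_op_laplacian) simp
  ultimately have "dirichlet (sq_poly \<mu>) f" using fc bound by (auto simp: dirichlet_def weak_eigen_def)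
  then obtain N a f0 where N: "finite N" "N \<subseteq> PW" and an: "anti f0"
    and f0: "\<And>x. f0 x = (\<Sum>\<nu>\<in>N. a \<nu> * exp (app \<nu> x))" and ff0: "\<And>x. x \<in> S \<Longrightarrow> f x = f0 x"
    by (rule dirichlet_expansion) blast
  \<comment> \<open>On an exponential sum p(\<partial>) multiplies the coefficient of \<nu> by
    p(\<nu>), so only exponents at which p takes its value at \<mu> can survive.\<close>
  have same: "a \<nu> * (p \<nu> - p \<mu>) = 0" if p: "const_coeff_op \<real> p D" "weyl_invariant R p" and nu: "\<nu> \<in> N" for p D \<nu>
  proof (rule exp_sum_vanishes[OF N _ nu, where b = "\<lambda>\<nu>. a \<nu> * (p \<nu> - p \<mu>)"])
    fix h assume h: "test_function C h"
    obtain D' where "const_coeff_op \<real> (\<lambda>\<xi>. p (- \<xi>)) D'" using const_coeff_op_transpose[OF p(1)] by blast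
    then have D': "const_coeff_op UNIV (\<lambda>\<xi>. p (- \<xi>)) D'" by (rule const_coeff_op_mono) simp
    have X: "closed (closure {x. h x \<noteq> 0})" "closure {x. h x \<noteq> 0} \<subseteq> C" "smooth h" "compact (closure {x. h x \<noteq> 0})"
      using h by (auto simp: test_function_def)
    have hz: "h x = 0" if "x \<notin> closure {x. h x \<noteq> 0}" for x using that closure_subset[of "{x. h x \<noteq> 0}"] by auto
    have Dz: "D' h x = 0" if "x \<notin> closure {x. h x \<noteq> 0}" for x
      using const_coeff_op_support[OF D' X(3,1) hz] that by blast
    have e1: "f x * D' h x = f0 x * D' h x" and e2: "f x * h x = f0 x * h x" for x
      using ff0[of x] Dz[of x] hz[of x] X(2) C_S[of x] by (cases "x \<in> closure {x. h x \<noteq> 0}"; auto)+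
    have "(LINT x|lborel. f x * D' h x) = p \<mu> * (LINT x|lborel. f x * h x)"
      using weak[OF p] D' h by (simp add: weak_eigen_def)
    then have x1: "(LINT x|lborel. f0 x * D' h x) = p \<mu> * (LINT x|lborel. f0 x * h x)" by (simp only: e1 e2)
    have x2: "(LINT x|lborel. f0 x * D' h x)
        = (LINT x|lborel. (\<Sum>\<nu>\<in>N. a \<nu> * p \<nu> * exp (app \<nu> x)) * h x)"
      unfolding f0 by (rule exp_sum_transpose[OF N(1) D' h])
    have x3: "(LINT x|lborel. (p \<mu> * f0 x) * h x) = p \<mu> * (LINT x|lborel. f0 x * h x)"
      by (simp only: mult.assoc integral_mult_right_zero)
    have eq: "(LINT x|lborel. (\<Sum>\<nu>\<in>N. a \<nu> * p \<nu> * exp (app \<nu> x)) * h x)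
        = (LINT x|lborel. (p \<mu> * f0 x) * h x)"
      by (rule trans[OF x2[symmetric] trans[OF x1 x3[symmetric]]])
    have i: "integrable lborel (\<lambda>x. (\<Sum>\<nu>\<in>N. b \<nu> * exp (app \<nu> x)) * h x)" for b
      by (rule integrable_continuous_compact_support[OF smooth_continuous[OF smooth_mult[OF smooth_exp_sum[OF N(1)] X(3)]] X(4)])
        (drule hz, simp)
    have pf: "p \<mu> * f0 x = (\<Sum>\<nu>\<in>N. (p \<mu> * a \<nu>) * exp (app \<nu> x))" for x
      by (simp only: f0 sum_distrib_left mult.assoc)
    have "(LINT x|lborel. (\<Sum>\<nu>\<in>N. a \<nu> * p \<nu> * exp (app \<nu> x)) * h x - (p \<mu> * f0 x) * h x) = 0"
      using Bochner_Integration.integral_diff[OF i[of "\<lambda>\<nu>. a \<nu> * p \<nu>"] i[of "\<lambda>\<nu>. p \<mu> * a \<nu>"]] eq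
      unfolding pf by simp
    moreover have "(\<Sum>\<nu>\<in>N. a \<nu> * p \<nu> * exp (app \<nu> x)) * h x - (p \<mu> * f0 x) * h x
        = (\<Sum>\<nu>\<in>N. a \<nu> * (p \<nu> - p \<mu>) * exp (app \<nu> x)) * h x" for x
      unfolding f0 left_diff_distrib[symmetric] sum_distrib_left sum_subtractf[symmetric]
      by (simp add: algebra_simps)
    ultimately show "(LINT x|lborel. (\<Sum>\<nu>\<in>N. a \<nu> * (p \<nu> - p \<mu>) * exp (app \<nu> x)) * h x) = 0" by simp
  qed
  have orbit: "\<exists>w\<in>W0. \<nu> = dual_act w \<mu>" if "\<nu> \<in> N" "a \<nu> \<noteq> 0" for \<nu>
  proof (rule W0_poly_separates)
    fix v z
    obtain D where "const_coeff_op \<real> (W0_poly v (of_real z)) D" using W0_poly_op by blast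
    from same[OF this W0_poly_invariant that(1)] that(2)
    show "W0_poly v (of_real z) \<nu> = W0_poly v (of_real z) \<mu>" by simp
  qed
  have "\<exists>b. \<forall>x. a \<nu> * A \<nu> x = b * A \<mu> x" if nu: "\<nu> \<in> N" for \<nu>
  proof (cases "a \<nu> = 0")
    case True
    then show ?thesis by (intro exI[of _ 0]) simp
  next
    case False
    then obtain w where "w \<in> W0" "\<nu> = dual_act w \<mu>" using orbit[OF nu] by blast
    then show ?thesis by (intro exI[of _ "a \<nu> * eps w"]) (simp add: A_dual_act_eq)
  qed
  then obtain b where b: "\<And>\<nu> x. \<nu> \<in> N \<Longrightarrow> a \<nu> * A \<nu> x = b \<nu> * A \<mu> x" by metis
  have card0: "of_nat (card W0) \<noteq> (0 :: complex)" using finite_W0 W0_id by auto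
  have f0A: "f0 x = (sum b N / of_nat (card W0)) * A \<mu> x" for x
  proof -
    \<comment> \<open>Antisymmetrising f0 only multiplies it by the order of \<open>W0\<close>, and
      it turns each exponential into some A \<nu>, here a multiple of A \<mu>.\<close>
    have "of_nat (card W0) * f0 x = (\<Sum>u\<in>W0. eps u * f0 (u x))"
      using an W0_W by (simp add: anti_def eps_square flip: mult.assoc)
    also have "\<dots> = (\<Sum>\<nu>\<in>N. a \<nu> * A \<nu> x)"
      unfolding f0 A_def sum_distrib_left by (subst sum.swap) (simp add: mult_ac)
    also have "\<dots> = sum b N * A \<mu> x" unfolding sum_distrib_right by (rule sum.cong) (simp_all add: b)
    finally show ?thesis using card0 by (simp add: field_simps)
  qed
  \<comment> \<open>Some exponent in 2\<pi>iP occurs, it lies in the orbit of \<mu>, and 2\<pi>iP is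
    stable under \<open>W0\<close>.\<close>
  have "\<mu> \<in> PW" if ex: "\<exists>x\<in>S. f x \<noteq> 0"
  proof -
    have "\<exists>\<nu>\<in>N. a \<nu> \<noteq> 0" using ex ff0 by (force simp: f0 intro: sum.neutral)
    then obtain \<nu> w where nu: "\<nu> \<in> N" "w \<in> W0" "\<nu> = dual_act w \<mu>" using orbit by blast
    have "\<mu> = dual_act (inv w) \<nu>"
      using dual_act_inv[OF W0_inv[OF nu(2)], of \<mu>] nu by (simp add: inv_inv_eq W_inv W0_W)
    then show ?thesis using PW_dual_act[of \<nu> "inv w"] nu N(2) W0_inv by auto
  qed
  moreover have "\<forall>x\<in>S. f x = (sum b N / of_nat (card W0)) * A \<mu> x" using ff0 f0A by simp
  ultimately show ?thesis by blast
qed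

text \<open>A reflection that fixes \<mu> has sign -1, so A \<mu> equals its negative.\<close>

lemma A_eq_0_not_regular: assumes "\<not> regular R \<mu>" shows "A \<mu> x = 0"
proof -
  obtain \<alpha> where a: "\<alpha> \<in> R" "app \<mu> (coroot \<alpha>) = 0" using assms by (auto simp: regular_def)
  let ?s = "aff_refl (\<alpha>, 0)"
  have "?s \<in> W0" by (rule refl_W0[OF a(1)])
  moreover have "dual_act ?s \<mu> = \<mu>"
  proof (rule blinfun_eqI)
    fix v
    have S: "(\<alpha>, 0) \<in> Sig" using a by (simp add: Sig_iff)
    have "inv ?s = ?s" by (rule inv_unique_comp) (rule aff_refl_comp_self[OF S])+
    then show "app (dual_act ?s \<mu>) v = app \<mu> v"
      by (simp add: dual_act_apply refl_W0 a) (simp add: aff_refl_def blinfun.diff_right blinfun.scaleR_right a)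
  qed
  ultimately have "A \<mu> x = - A \<mu> x" using A_dual_act_eq[of ?s \<mu> x] eps_refl[of "(\<alpha>, 0)"] a(1) by (simp add: Sig_iff)
  then show ?thesis by simp
qed

text \<open>Regularity makes the exponents \<open>dual_act w \<mu>\<close> pairwise distinct, and
  distinct exponentials are independent.\<close>

lemma A_nonzero:
  assumes reg: "regular R \<mu>" and mu: "\<mu> \<in> PW" shows "\<exists>x. A \<mu> x \<noteq> 0"
proof (rule ccontr)
  assume "\<not> ?thesis"
  then have z: "(\<Sum>w\<in>W0. eps w * exp (app (dual_act w \<mu>) x)) = 0" for x
    by (simp flip: A_dual_act)
  obtain \<xi> where xi: "\<xi> \<in> P" "\<And>v. app \<mu> v = 2 * of_real pi * \<i> * of_real (app \<xi> v)"
    using PW_E[OF mu] by blast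
  have inj: "inj_on (\<lambda>w. dual_act w \<mu>) W0"
  proof (rule inj_onI)
    fix w w' assume w: "w \<in> W0" "w' \<in> W0" "dual_act w \<mu> = dual_act w' \<mu>"
    have i: "inv w \<circ> w' = id"
    proof (rule regular_stabilizer)
      show "app \<xi> (coroot \<alpha>) \<noteq> 0" if "\<alpha> \<in> R" for \<alpha>
        using reg that by (auto simp: regular_def xi)
      show "inv w \<circ> w' \<in> W0" by (intro W0_comp W0_inv w)
      fix v
      have "app (dual_act w \<mu>) (w' v) = app (dual_act w' \<mu>) (w' v)" using w by simp
      then have "app \<mu> (inv w (w' v)) = app \<mu> v"
        by (simp only: dual_act_apply[OF w(1)] dual_act_apply[OF w(2)] W0_inv_apply(1)[OF w(2)])
      then show "app \<xi> ((inv w \<circ> w') v) = app \<xi> v" by (simp add: xi)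
    qed
    have e: "inv w (w' v) = v" for v using fun_cong[OF i, of v] by simp
    have "w' v = w v" for v using W0_inv_apply(2)[OF w(1), of "w' v"] unfolding e by simp
    then show "w = w'" by auto
  qed
  \<comment> \<open>The sign of w, read as a function of the exponent that w produces.\<close>
  define c where "c = eps \<circ> the_inv_into W0 (\<lambda>w. dual_act w \<mu>)"
  have cw: "c (dual_act w \<mu>) = eps w" if "w \<in> W0" for w using the_inv_into_f_f[OF inj that] by (simp add: c_def)
  have "c (dual_act id \<mu>) = 0"
  proof (rule exp_linear_independent[where N = "(\<lambda>w. dual_act w \<mu>) ` W0" and U = UNIV])
    show "(\<Sum>\<nu>\<in>(\<lambda>w. dual_act w \<mu>) ` W0. c \<nu> * exp (app \<nu> x)) = 0" for x
      using z[of x] by (subst sum.reindex[OF inj]) (simp add: cw cong: sum.cong)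
  qed (use finite_W0 W0_id in auto)
  then show False using cw[OF W0_id] by simp
qed

section \<open>The two solution spaces and the map \<open>G\<close> between them\<close>

lemma psi_inf_eq:
  "psi_inf R B \<phi> \<mu> v = (1 / of_nat (card W0) * (\<Prod>\<alpha>\<in>pos_roots R B. inverse (app \<mu> (coroot \<alpha>)))) * A \<mu> v"
  by (simp add: psi_inf_def A_dual_act eps_def)

lemma eigenspace_E_anti_iff: "f \<in> eigenspace_E_anti R B \<phi> \<mu> \<longleftrightarrow> f \<in> eigenspace_E R \<mu> \<and> anti f"
  by (simp add: eigenspace_E_anti_def anti_iff_inv)

text \<open>All exponents of A \<mu> lie in the orbit of \<mu>, on which invariant polynomials are
  constant.\<close>

lemma A_eigenspace: assumes "\<mu> \<in> PW" shows "(\<lambda>x. a * A \<mu> x) \<in> eigenspace_E_anti R B \<phi> \<mu>"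
proof -
  have "A \<mu> \<in> cfun.span (expo ` {\<eta>. \<exists>w\<in>W0. \<eta> = dual_act w \<mu>})" by (rule A_span_expo)
  then have "(\<lambda>x. a * A \<mu> x) \<in> cfun.span (expo ` {\<eta>. \<exists>w\<in>W0. \<eta> = dual_act w \<mu>})" by (rule span_cmult_fun)
  then obtain N c where N: "finite N" "N \<subseteq> {\<eta>. \<exists>w\<in>W0. \<eta> = dual_act w \<mu>}"
    and A: "\<And>x. a * A \<mu> x = (\<Sum>\<nu>\<in>N. c \<nu> * exp (app \<nu> x))" by (rule span_expo_E) blast
  have "D (\<lambda>x. a * A \<mu> x) x = p \<mu> * (a * A \<mu> x)" if "const_coeff_op UNIV p D" "weyl_invariant R p" for p D x
  proof -
    have "D (\<lambda>x. a * A \<mu> x) x = (\<Sum>\<nu>\<in>N. c \<nu> * p \<nu> * exp (app \<nu> x))"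
      unfolding A const_coeff_op_exp_sum[OF that(1) N(1)] ..
    also have "\<dots> = (\<Sum>\<nu>\<in>N. p \<mu> * (c \<nu> * exp (app \<nu> x)))"
    proof (rule sum.cong)
      fix \<nu> assume "\<nu> \<in> N"
      then have "p \<nu> = p \<mu>" using N(2) that(2) by (auto simp: weyl_invariant_def)
      then show "c \<nu> * p \<nu> * exp (app \<nu> x) = p \<mu> * (c \<nu> * exp (app \<nu> x))" by simp
    qed simp
    also have "\<dots> = p \<mu> * (a * A \<mu> x)" by (simp only: A sum_distrib_left)
    finally show ?thesis .
  qed
  moreover have "real_analytic (\<lambda>x. a * A \<mu> x)" unfolding A by (rule real_analytic_exp_sum[OF N(1)])
  moreover have "anti (\<lambda>x. a * A \<mu> x)" using anti_A[OF assms] by (simp add: anti_def)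
  ultimately show ?thesis by (simp add: eigenspace_E_anti_iff eigenspace_E_def)
qed

lemma eigenspace_weak_eigen:
  "f \<in> eigenspace_E R \<mu> \<Longrightarrow> weyl_invariant R p \<Longrightarrow> weak_eigen \<Omega> p \<mu> f"
  by (rule weak_eigen_of_strong) (auto simp: eigenspace_E_def real_analytic_smooth)

text \<open>Antisymmetry extends the formula from the closed alcove to V. The case distinction
  supplies \<mu> in 2\<pi>iP, from which the antisymmetry of A \<mu> itself follows.\<close>

lemma eigenspace_E_anti_subset:
  assumes "f \<in> eigenspace_E_anti R B \<phi> \<mu>"
  shows "(\<exists>a. f = (\<lambda>x. a * A \<mu> x)) \<and> (f \<noteq> (\<lambda>x. 0) \<longrightarrow> \<mu> \<in> PW)"
proof -
  have E: "f \<in> eigenspace_E R \<mu>" and an: "anti f" using assms by (auto simp: eigenspace_E_anti_iff)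
  have sm: "smooth f" using E by (simp add: eigenspace_E_def real_analytic_smooth)
  have "\<exists>K\<ge>0. \<forall>x\<in>S. \<forall>j\<in>Del. norm (f x) \<le> K * aff_apply j x"
    by (rule wall_bound[OF open_UNIV subset_UNIV C1_on_smooth[OF sm]]) (use anti_wall[OF an Del_Sig] in blast)
  from boundary_value_solution[OF smooth_continuous[OF sm] this eigenspace_weak_eigen[OF E]]
  have r: "\<exists>a. \<forall>x\<in>S. f x = a * A \<mu> x" "(\<exists>x\<in>S. f x \<noteq> 0) \<longrightarrow> \<mu> \<in> PW" by auto
  show ?thesis
  proof (cases "\<exists>x\<in>S. f x \<noteq> 0")
    case True
    then have mu: "\<mu> \<in> PW" using r(2) by blast
    obtain a where a: "\<forall>x\<in>S. f x = a * A \<mu> x" using r(1) by blast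
    have "anti (\<lambda>x. a * A \<mu> x)" using anti_A[OF mu] by (simp add: anti_def)
    then have "f = (\<lambda>x. a * A \<mu> x)" using a by (intro anti_eqI[OF an]) auto
    then show ?thesis using mu by blast
  next
    case False
    have "f = (\<lambda>x. 0)" by (rule anti_eqI[OF an]) (use False in \<open>auto simp: anti_def\<close>)
    then show ?thesis by (auto intro!: exI[of _ 0])
  qed
qed

text \<open>The C1 extension from the fundamental alcove agrees with g on the closure by continuity
  and yields the wall bound; invariance carries the result to all of V.\<close>

lemma BVP_inf_W_subset:
  assumes "g \<in> BVP_inf_W R B \<phi> \<mu>"
  shows "(\<exists>a. g = G (\<lambda>x. a * A \<mu> x)) \<and> (g \<noteq> (\<lambda>x. 0) \<longrightarrow> \<mu> \<in> PW)"
proof -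
  have CB: "g \<in> CB1 R B \<phi>" and inv: "W_invariant R g"
    and z: "\<And>a v. pos a \<Longrightarrow> aff_apply a v = 0 \<Longrightarrow> g v = 0"
    and w: "\<And>p D. const_coeff_op \<real> p D \<Longrightarrow> weyl_invariant R p \<Longrightarrow> weak_eigen (V_reg R B \<phi>) p \<mu> g"
    using assms by (auto simp: BVP_inf_W_def BVP_inf_def aff_pos_roots_eq hyperplane_def)
  have gc: "continuous_on X g" for X using CB continuous_on_subset by (auto simp: CB1_def)
  have "\<forall>D\<in>alcoves R B \<phi>. \<exists>U k. open U \<and> closure D \<subseteq> U \<and> C1_on U k \<and> (\<forall>x\<in>D. k x = g x)"
    using CB by (simp add: CB1_def)
  from bspec[OF this C_alcove] obtain U k
    where Uk: "open U \<and> S \<subseteq> U \<and> C1_on U k \<and> (\<forall>x\<in>C. k x = g x)" by (elim exE)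
  then have U: "open U" "S \<subseteq> U" "C1_on U k" and "\<forall>x\<in>C. k x = g x" by simp_all
  then have kgC: "k x = g x" if "x \<in> C" for x using that by blast
  have kc: "continuous_on S k"
    using U(2,3) unfolding C1_on_def
    by (meson continuous_at_imp_continuous_on has_derivative_continuous subset_iff)
  have kg: "k x = g x" if "x \<in> S" for x
  proof -
    have "k x - g x = 0"
      by (rule continuous_constant_on_closure[of C "\<lambda>x. k x - g x", OF _ _ that])
        (auto intro!: continuous_intros kc gc simp: kgC)
    then show ?thesis by simp
  qed
  have "\<exists>K\<ge>0. \<forall>x\<in>S. \<forall>j\<in>Del. norm (k x) \<le> K * aff_apply j x"
  proof (rule wall_bound[OF U])
    fix j x assume j: "j \<in> Del" "x \<in> S" "aff_apply j x = 0"
    show "k x = 0" using kg[OF j(2)] z[OF Del_pos[OF j(1)] j(3)] by simp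
  qed
  then have bound: "\<exists>K\<ge>0. \<forall>x\<in>S. \<forall>j\<in>Del. norm (g x) \<le> K * aff_apply j x" using kg by simp
  have weak: "weak_eigen C p \<mu> g" if "const_coeff_op \<real> p D" "weyl_invariant R p" for p D
  proof -
    have "C \<subseteq> V_reg R B \<phi>" using W_C_V_reg[OF W_id] by auto
    then show ?thesis using w[OF that] unfolding weak_eigen_def test_function_def by blast
  qed
  from boundary_value_solution[OF gc bound weak]
  have r: "\<exists>a. \<forall>x\<in>S. g x = a * A \<mu> x" "(\<exists>x\<in>S. g x \<noteq> 0) \<longrightarrow> \<mu> \<in> PW" by auto
  obtain a where a: "\<forall>x\<in>S. g x = a * A \<mu> x" using r(1) by blast
  have "g = G (\<lambda>x. a * A \<mu> x)" using a by (intro W_invariant_eq_G[OF inv]) auto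
  moreover have "g = (\<lambda>x. 0)" if "\<not> (\<exists>x\<in>S. g x \<noteq> 0)"
  proof
    fix x
    obtain u v where "u \<in> W" "v \<in> S" "x = u v" by (rule W_orbit_S)
    then show "g x = 0" using that inv by (simp add: W_invariant_iff)
  qed
  ultimately show ?thesis using r(2) by blast
qed

text \<open>\<open>chi\<close> is locally constant on \<open>V_reg\<close>, and h vanishes outside a
  closed subset of it, so the jumps of \<open>chi\<close> are invisible.\<close>

lemma smooth_chi_mult:
  assumes X: "closed X" "X \<subseteq> V_reg R B \<phi>" and h: "smooth h" "\<And>x. x \<notin> X \<Longrightarrow> h x = 0"
  shows "smooth (\<lambda>x. chi x * h x) \<and> (\<forall>v. dir_deriv v (\<lambda>x. chi x * h x) = (\<lambda>x. chi x * dir_deriv v h x))"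
proof -
  have loc: "(\<lambda>x. chi x * k x) differentiable at x \<and> dir_deriv v (\<lambda>x. chi x * k x) x = chi x * dir_deriv v k x"
    if k: "smooth k" "\<And>x. x \<notin> X \<Longrightarrow> k x = 0" for k v x
  proof (cases "x \<in> V_reg R B \<phi>")
    case True
    then obtain U where U: "open U" "x \<in> U" "\<And>y. y \<in> U \<Longrightarrow> chi y = chi x" using chi_locally_constant by metis
    have d: "(\<lambda>y. chi x * k y) differentiable at x" by (intro smooth_differentiable smooth_cmult k)
    have e: "chi x * k y = chi y * k y" if "y \<in> U" for y using U(3)[OF that] by simp
    show ?thesis using dir_deriv_local(1)[OF U(1,2) e d] dir_deriv_local(2)[OF U(1,2) e d, where v = v]
      by (simp add: dir_deriv_cmult[OF smooth_differentiable[OF k(1)]])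
  next
    case False
    then have x: "x \<in> - X" using X(2) by auto
    have o: "open (- X)" using X(1) by auto
    have e: "0 = chi y * k y" if "y \<in> - X" for y using k(2) that by simp
    have d: "(\<lambda>y. 0 :: complex) differentiable at x" by simp
    show ?thesis using dir_deriv_local(1)[OF o x e d] dir_deriv_local(2)[OF o x e d, where v = v] False
      by (simp add: chi_def)
  qed
  have sm: "smooth (\<lambda>x. chi x * h x)"
  proof (rule smoothI_class[of _ "{f. \<exists>k. f = (\<lambda>x. chi x * k x) \<and> smooth k \<and> (\<forall>x. x \<notin> X \<longrightarrow> k x = 0)}"])
    show "(\<lambda>x. chi x * h x) \<in> {f. \<exists>k. f = (\<lambda>x. chi x * k x) \<and> smooth k \<and> (\<forall>x. x \<notin> X \<longrightarrow> k x = 0)}"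
      using h by blast
  next
    fix g :: "'a \<Rightarrow> complex" and x v
    assume "g \<in> {f. \<exists>k. f = (\<lambda>x. chi x * k x) \<and> smooth k \<and> (\<forall>x. x \<notin> X \<longrightarrow> k x = 0)}"
    then obtain k where k: "g = (\<lambda>x. chi x * k x)" "smooth k" "\<And>x. x \<notin> X \<Longrightarrow> k x = 0" by blast
    show "g differentiable at x" using loc[OF k(2,3)] unfolding k(1) by blast
    have "dir_deriv v g = (\<lambda>x. chi x * dir_deriv v k x)" unfolding k(1) using loc[OF k(2,3)] by blast
    moreover have "smooth (dir_deriv v k)" "\<forall>x. x \<notin> X \<longrightarrow> dir_deriv v k x = 0"
      using const_coeff_op_support[OF const_coeff_op.vector[of UNIV v] k(2) X(1) k(3)] by auto
    ultimately show "dir_deriv v g \<in> {f. \<exists>k. f = (\<lambda>x. chi x * k x) \<and> smooth k \<and> (\<forall>x. x \<notin> X \<longrightarrow> k x = 0)}"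
      by blast
  qed
  then show ?thesis using loc[OF h] by blast
qed

lemma const_coeff_op_chi:
  assumes "const_coeff_op K p D" and X: "closed X" "X \<subseteq> V_reg R B \<phi>"
    and "smooth h" "\<And>x. x \<notin> X \<Longrightarrow> h x = 0"
  shows "D (\<lambda>x. chi x * h x) = (\<lambda>x. chi x * D h x)"
  using assms(1,4,5)
proof (induction arbitrary: h rule: const_coeff_op.induct)
  case (const c)
  show ?case by (simp add: fun_eq_iff)
next
  case (vector v)
  then show ?case using smooth_chi_mult[OF X vector] by blast
next
  case (add p D q E)
  have "D (\<lambda>x. chi x * h x) = (\<lambda>x. chi x * D h x)" "E (\<lambda>x. chi x * h x) = (\<lambda>x. chi x * E h x)"
    using add by blast+
  then show ?case by (simp add: distrib_left)
next
  case (mult p D q E)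
  have s: "smooth (E h)" "\<And>x. x \<notin> X \<Longrightarrow> E h x = 0"
    using const_coeff_op_support[OF mult.hyps(2) mult.prems(1) X(1) mult.prems(2)] by auto
  have e: "E (\<lambda>x. chi x * h x) = (\<lambda>x. chi x * E h x)" by (rule mult.IH(2)) (use mult.prems in auto)
  have "D (\<lambda>x. chi x * E h x) = (\<lambda>x. chi x * D (E h) x)" by (rule mult.IH(1)) (use s in auto)
  then show ?case by (simp only: e)
qed

text \<open>Here G f is \<open>chi\<close> times f. It is continuous at the hyperplanes because f
  vanishes there and \<open>chi\<close> is bounded, and on each alcove \<open>chi\<close> is
  constant, so a multiple of f is the C1 extension.\<close>

lemma G_BVP:
  assumes "f \<in> eigenspace_E_anti R B \<phi> \<mu>" shows "G f \<in> BVP_inf_W R B \<phi> \<mu>"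
proof -
  have E: "f \<in> eigenspace_E R \<mu>" and an: "anti f" using assms by (auto simp: eigenspace_E_anti_iff)
  have sm: "smooth f" using E by (simp add: eigenspace_E_def real_analytic_smooth)
  have fc: "continuous_on UNIV f" by (rule smooth_continuous[OF sm])
  have Gf: "G f = (\<lambda>x. chi x * f x)" using G_chi[OF an] by blast
  have chi1: "norm (chi x) \<le> 1" for x by (simp add: chi_def)
  have "isCont (G f) x" for x
  proof (cases "x \<in> V_reg R B \<phi>")
    case True
    then obtain U where U: "open U" "x \<in> U" "\<And>y. y \<in> U \<Longrightarrow> chi y = chi x" using chi_locally_constant by metis
    have "isCont (\<lambda>y. chi x * f y) x" using fc by (intro continuous_intros) (simp add: continuous_on_eq_continuous_at)
    moreover have "\<forall>\<^sub>F y in nhds x. chi x * f y = G f y"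
      using eventually_nhds_in_open[OF U(1,2)] by (rule eventually_mono) (simp add: Gf U(3))
    ultimately show ?thesis using isCont_cong[of "\<lambda>y. chi x * f y" "G f" x] by simp
  next
    case False
    then have fx: "f x = 0" using anti_wall[OF an] by (auto simp: V_reg_eq)
    have "isCont f x" using fc by (simp add: continuous_on_eq_continuous_at)
    then have "(f \<longlongrightarrow> 0) (at x)" by (simp add: isCont_def fx)
    then have "(G f \<longlongrightarrow> 0) (at x)" unfolding Gf
      by (rule Lim_null_comparison[rotated, OF tendsto_norm_zero])
        (auto intro!: always_eventually simp: norm_mult mult_left_le_one_le chi1)
    then show ?thesis by (simp add: isCont_def Gf fx)
  qed
  then have Gc: "continuous_on UNIV (G f)" by (simp add: continuous_on_eq_continuous_at)
  have alcove: "\<exists>U g. open U \<and> closure D \<subseteq> U \<and> C1_on U g \<and> (\<forall>x\<in>D. g x = G f x)" if D: "D \<in> alcoves R B \<phi>" for D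
  proof -
    have Dc: "connected D" "D \<subseteq> V_reg R B \<phi>"
      using D by (auto simp: alcoves_def in_components_connected in_components_subset)
    have "isCont chi x" if xV: "x \<in> V_reg R B \<phi>" for x
    proof -
      obtain U where U: "open U" "x \<in> U" "\<And>y. y \<in> U \<Longrightarrow> chi y = chi x" using chi_locally_constant[OF xV] by metis
      have "\<forall>\<^sub>F y in nhds x. chi x = chi y"
        using eventually_nhds_in_open[OF U(1,2)] by (rule eventually_mono) (simp add: U(3))
      then show ?thesis using isCont_cong[of "\<lambda>_. chi x" chi x] by simp
    qed
    then have "continuous_on D chi" using Dc(2) by (intro continuous_at_imp_continuous_on) blast
    then have "connected (chi ` D)" using Dc(1) by (rule connected_continuous_image)
    moreover have "finite (chi ` D)" by (rule finite_subset[of _ "{1, - 1, 0}"]) (auto simp: chi_def)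
    ultimately have "chi ` D = {} \<or> (\<exists>c. chi ` D = {c})" by (simp add: connected_finite_iff_sing)
    then obtain c where c: "\<And>x. x \<in> D \<Longrightarrow> chi x = c" by blast
    show ?thesis
      by (intro exI[of _ UNIV] exI[of _ "\<lambda>x. c * f x"] conjI C1_on_smooth smooth_cmult sm) (auto simp: Gf c)
  qed
  have weak: "weak_eigen (V_reg R B \<phi>) p \<mu> (G f)" if p: "weyl_invariant R p" for p
    unfolding weak_eigen_def
  proof (intro allI impI, elim conjE)
    fix D h assume D: "const_coeff_op UNIV (\<lambda>\<xi>. p (- \<xi>)) D" and h: "test_function (V_reg R B \<phi>) h"
    let ?X = "closure {x. h x \<noteq> 0}"
    have X: "closed ?X" "?X \<subseteq> V_reg R B \<phi>" "smooth h" "compact ?X" using h by (auto simp: test_function_def)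
    have hz: "h x = 0" if "x \<notin> ?X" for x using that closure_subset[of "{x. h x \<noteq> 0}"] by auto
    \<comment> \<open>The sign is moved from f to the test function, which remains admissible, so
      that the equation for f itself applies.\<close>
    have "test_function (V_reg R B \<phi>) (\<lambda>x. chi x * h x)"
      by (rule test_functionI[OF conjunct1[OF smooth_chi_mult[OF X(1-3) hz]] X(4,2)]) (assumption, drule hz, simp)
    then have "(LINT x|lborel. f x * D (\<lambda>x. chi x * h x) x) = p \<mu> * (LINT x|lborel. f x * (chi x * h x))"
      using eigenspace_weak_eigen[OF E p, of "V_reg R B \<phi>"] D unfolding weak_eigen_def by blast
    moreover have "D (\<lambda>x. chi x * h x) = (\<lambda>x. chi x * D h x)"
      by (rule const_coeff_op_chi[OF D X(1-3)]) (rule hz)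
    ultimately have "(LINT x|lborel. f x * (chi x * D h x)) = p \<mu> * (LINT x|lborel. f x * (chi x * h x))"
      by (simp only:)
    then show "(LINT x|lborel. G f x * D h x) = p \<mu> * (LINT x|lborel. G f x * h x)"
      by (simp add: Gf mult_ac)
  qed
  have "G f v = 0" if "pos a" "aff_apply a v = 0" for a v
    using anti_wall[OF an, of a v] that by (simp add: Gf pos_def)
  then show ?thesis using Gc alcove weak W_invariant_G
    by (auto simp: BVP_inf_W_def BVP_inf_def CB1_def aff_pos_roots_eq hyperplane_def)
qed

lemma G_cmult: "G (\<lambda>x. a * f x) = (\<lambda>x. a * G f x)"
proof
  fix x
  obtain u v where u: "u \<in> W" "v \<in> S" "x = u v" by (rule W_orbit_S)
  then show "G (\<lambda>x. a * f x) x = a * G f x" by (simp add: G_apply)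
qed

lemma G_add: "G (f + g) = G f + G g"
proof
  fix x
  obtain u v where u: "u \<in> W" "v \<in> S" "x = u v" by (rule W_orbit_S)
  then show "G (f + g) x = (G f + G g) x" by (simp add: G_apply)
qed

end

section \<open>Dimensions and the conclusion\<close>

lemma has_dim_0_singleton: "has_dim {0} 0"
  unfolding has_dim_def by (intro exI[of _ "{}"]) (auto simp: cfun.independent_empty)

lemma not_has_dim_1_singleton: "\<not> has_dim {0 :: 'a \<Rightarrow> complex} 1"
proof
  assume "has_dim {0 :: 'a \<Rightarrow> complex} 1"
  then have "\<exists>X :: ('a \<Rightarrow> complex) set. finite X \<and> card X = 1 \<and> cfun.independent X \<and> cfun.span X = {0}"
    unfolding has_dim_def .
  then obtain X :: "('a \<Rightarrow> complex) set"
    where X: "finite X \<and> card X = 1 \<and> cfun.independent X \<and> cfun.span X = {0}" ..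
  then have "card X = 1" by (rule conjunct1[OF conjunct2])
  then obtain f where f: "X = {f}" by (rule card_1_singletonE)
  have "f \<in> cfun.span X" unfolding f by (rule cfun.span_base) simp
  then have "f = 0" using X by simp
  then have "cfun.dependent X" unfolding f by (intro cfun.dependent_zero) simp
  then show False using X by simp
qed

lemma has_dim_1_span: "f \<noteq> 0 \<Longrightarrow> has_dim (cfun.span {f}) 1"
  unfolding has_dim_def
  by (intro exI[of _ "{f}"]) (auto simp: cfun.dependent_single)

lemma span_singleton_iff: "g \<in> cfun.span {f} \<longleftrightarrow> (\<exists>a. g = (\<lambda>x. a * f x))"
  unfolding cfun.span_singleton by (auto simp: fscale_def)

text \<open>Both spaces are computed outright, as the lines through \<psi> and G \<psi> or as zero.
  For bijectivity no inverse of G has to be constructed; it is enough that G \<psi> is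
  nonzero.\<close>

theorem proposition3p3:
  fixes R B :: "'a::euclidean_space dual set"
    and \<phi> :: "'a dual"
    and \<mu> :: "'a cdual"
  assumes "root_system R" and "irreducible_roots R" and "reduced R" and "crystallographic R"
    and "root_basis R B"
    and "highest_root R B \<phi>"
  shows
    "linear_iso (G_map R B \<phi>) (eigenspace_E_anti R B \<phi> \<mu>) (BVP_inf_W R B \<phi> \<mu>) \<and>
     (has_dim (BVP_inf_W R B \<phi> \<mu>) 0 \<or> has_dim (BVP_inf_W R B \<phi> \<mu>) 1) \<and>
     (has_dim (BVP_inf_W R B \<phi> \<mu>) 1 \<longleftrightarrow> regular R \<mu> \<and> \<mu> \<in> two_pi_i_weights R) \<and>
     (regular R \<mu> \<and> \<mu> \<in> two_pi_i_weights R \<longrightarrow>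
        BVP_inf_W R B \<phi> \<mu> = cfun.span {G_map R B \<phi> (psi_inf R B \<phi> \<mu>)} \<and>
        (\<forall>g. (W_invariant R g \<and>
              (\<forall>v\<in>closure (C_plus B \<phi>).
                 g v = 1 / of_nat (card (weyl R)) *
                       (\<Prod>\<alpha>\<in>pos_roots R B. inverse (blinfun_apply \<mu> (coroot \<alpha>))) *
                       (\<Sum>w\<in>weyl R. (- 1) ^ len B \<phi> w * exp (blinfun_apply (dual_act w \<mu>) v))))
             \<longleftrightarrow> g = G_map R B \<phi> (psi_inf R B \<phi> \<mu>)))"
proof -
  interpret root_data R B \<phi> using assms by unfold_locales
  let ?E = "eigenspace_E_anti R B \<phi> \<mu>" and ?V = "BVP_inf_W R B \<phi> \<mu>" and ?\<psi> = "psi_inf R B \<phi> \<mu>"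
  have unique: "W_invariant R g \<and> (\<forall>v\<in>S. g v = 1 / of_nat (card (weyl R)) *
      (\<Prod>\<alpha>\<in>pos_roots R B. inverse (blinfun_apply \<mu> (coroot \<alpha>))) *
      (\<Sum>w\<in>weyl R. (- 1) ^ len B \<phi> w * exp (blinfun_apply (dual_act w \<mu>) v))) \<longleftrightarrow> g = G ?\<psi>" for g
    unfolding psi_inf_def[symmetric] using W_invariant_eq_G[of g ?\<psi>] W_invariant_G[of ?\<psi>] G_S[of _ ?\<psi>] by blast
  show ?thesis
  proof (cases "regular R \<mu> \<and> \<mu> \<in> PW")
    case True
    define k where "k = 1 / of_nat (card W0) * (\<Prod>\<alpha>\<in>pos_roots R B. inverse (blinfun_apply \<mu> (coroot \<alpha>)))"
    have psi: "?\<psi> = (\<lambda>x. k * A \<mu> x)" by (rule ext) (simp only: psi_inf_eq k_def)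
    have "card W0 \<noteq> 0" using finite_W0 W0_id by auto
    then have k0: "k \<noteq> 0" using True finite_R unfolding k_def
      by (auto simp: regular_def pos_roots_def)
    then have span: "(\<exists>a. f = (\<lambda>x. a * A \<mu> x)) \<longleftrightarrow> (\<exists>a. f = (\<lambda>x. a * ?\<psi> x))" for f
    proof -
      have "(\<lambda>x. a * A \<mu> x) = (\<lambda>x. (a / k) * ?\<psi> x)" "(\<lambda>x. a * ?\<psi> x) = (\<lambda>x. (a * k) * A \<mu> x)" for a
        using k0 by (simp_all add: psi fun_eq_iff)
      then show ?thesis by metis
    qed
    have E: "?E = cfun.span {?\<psi>}"
    proof (rule set_eqI)
      fix f
      show "f \<in> ?E \<longleftrightarrow> f \<in> cfun.span {?\<psi>}"
        unfolding span_singleton_iff span[symmetric]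
        using eigenspace_E_anti_subset[of f \<mu>] A_eigenspace[of \<mu>] True by blast
    qed
    have V: "?V = cfun.span {G ?\<psi>}"
    proof (rule set_eqI)
      fix g
      have "g \<in> ?V \<longleftrightarrow> (\<exists>a. g = G (\<lambda>x. a * A \<mu> x))"
        using BVP_inf_W_subset[of g \<mu>] G_BVP[OF A_eigenspace] True by blast
      also have "\<dots> \<longleftrightarrow> (\<exists>f. (\<exists>a. f = (\<lambda>x. a * A \<mu> x)) \<and> g = G f)" by blast
      also have "\<dots> \<longleftrightarrow> (\<exists>a. g = (\<lambda>x. a * G ?\<psi> x))" unfolding span by (auto simp: G_cmult)
      finally show "g \<in> ?V \<longleftrightarrow> g \<in> cfun.span {G ?\<psi>}" by (simp only: span_singleton_iff)
    qed
    obtain x where x: "A \<mu> x \<noteq> 0" using A_nonzero True by blast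
    have psi_anti: "anti ?\<psi>" using anti_A[of \<mu>] True by (simp add: psi anti_def)
    \<comment> \<open>G reads \<psi> only on the closed alcove, so a point where \<psi> is nonzero
      is moved there by antisymmetry.\<close>
    obtain y where y: "y \<in> S" "?\<psi> y \<noteq> 0"
    proof -
      obtain u v where u: "u \<in> W" "v \<in> S" "x = u v" by (rule W_orbit_S)
      have "?\<psi> v \<noteq> 0"
      proof
        assume "?\<psi> v = 0"
        then have "?\<psi> x = 0" using psi_anti u by (simp add: anti_def)
        then show False using x k0 by (simp add: psi)
      qed
      then show ?thesis using that u by blast
    qed
    have Gy: "G ?\<psi> y \<noteq> 0" using y G_S by simp
    then have G0: "G ?\<psi> \<noteq> 0" by auto
    have "bij_betw G ?E ?V"
      unfolding bij_betw_def
    proof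
      show "inj_on G ?E"
      proof (rule inj_onI)
        fix f g assume fg: "f \<in> ?E" "g \<in> ?E" "G f = G g"
        then obtain a b where ab: "f = (\<lambda>x. a * ?\<psi> x)" "g = (\<lambda>x. b * ?\<psi> x)" unfolding E span_singleton_iff by blast
        then have "a * G ?\<psi> y = b * G ?\<psi> y" using fun_cong[OF fg(3), of y] by (simp add: G_cmult)
        then show "f = g" using Gy ab by simp
      qed
      show "G ` ?E = ?V"
      proof (intro equalityI subsetI)
        fix g assume "g \<in> G ` ?E"
        then obtain f where "f \<in> ?E" "g = G f" by blast
        then obtain a where "g = G (\<lambda>x. a * ?\<psi> x)" unfolding E span_singleton_iff by blast
        then show "g \<in> ?V" unfolding V span_singleton_iff G_cmult by blast
      next
        fix g assume "g \<in> ?V"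
        then obtain a where "g = G (\<lambda>x. a * ?\<psi> x)" unfolding V span_singleton_iff G_cmult by blast
        moreover have "(\<lambda>x. a * ?\<psi> x) \<in> ?E" unfolding E span_singleton_iff by blast
        ultimately show "g \<in> G ` ?E" by blast
      qed
    qed
    moreover have "cfun.subspace ?E" "cfun.subspace ?V" unfolding E V by (rule cfun.subspace_span)+
    ultimately have "linear_iso G ?E ?V" by (auto simp: linear_iso_def G_add fscale_def G_cmult)
    moreover have "has_dim ?V 1" unfolding V by (rule has_dim_1_span[OF G0])
    ultimately show ?thesis using True V unique by blast
  next
    case False
    \<comment> \<open>Either \<mu> is outside 2\<pi>iP, and then both spaces contain only 0 by the
      two inclusions, or \<mu> is not regular and A \<mu> is 0.\<close>
    have A0: "\<mu> \<in> PW \<Longrightarrow> A \<mu> = (\<lambda>x. 0)" using False A_eq_0_not_regular by blast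
    have z: "(0 :: 'a \<Rightarrow> complex) = (\<lambda>x. 0)" by (simp add: zero_fun_def)
    have G0: "G (\<lambda>x. 0) = (\<lambda>x. 0)" using G_cmult[of 0 "\<lambda>x. 0"] by simp
    have E0: "(\<lambda>x. 0) \<in> ?E"
    proof -
      have "\<forall>p D. const_coeff_op UNIV p D \<and> weyl_invariant R p \<longrightarrow> (\<forall>x. D (\<lambda>x :: 'a. 0 :: complex) x = p \<mu> * 0)"
      proof (intro allI impI, elim conjE)
        fix p :: "'a cdual \<Rightarrow> complex" and D :: "('a \<Rightarrow> complex) \<Rightarrow> 'a \<Rightarrow> complex" and x
        assume "const_coeff_op UNIV p D"
        from fun_cong[OF const_coeff_op_exp_sum[OF this, of "{}"]] show "D (\<lambda>x. 0) x = p \<mu> * 0" by simp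
      qed
      moreover have "real_analytic (\<lambda>x :: 'a. 0)" using real_analytic_exp_sum[of "{}"] by simp
      ultimately show ?thesis by (simp add: eigenspace_E_anti_iff eigenspace_E_def anti_def)
    qed
    have "f = (\<lambda>x. 0)" if "f \<in> ?E" for f using eigenspace_E_anti_subset[OF that] A0 by auto
    then have E: "?E = {0}" using E0 unfolding z by blast
    have "g = (\<lambda>x. 0)" if "g \<in> ?V" for g using BVP_inf_W_subset[OF that] A0 G0 by auto
    then have V: "?V = {0}" using G_BVP[OF E0] unfolding z G0 by blast
    have "linear_iso G ?E ?V"
      unfolding E V linear_iso_def
    proof (intro conjI ballI allI)
      show "bij_betw G {0} {0}" unfolding bij_betw_def z using G0 by simp
      show "G (f + g) = G f + G g" for f g by (rule G_add)
      show "G (fscale c f) = fscale c (G f)" for c f unfolding fscale_def by (rule G_cmult)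
    qed (rule cfun.subspace_single_0)+
    then show ?thesis using False has_dim_0_singleton not_has_dim_1_singleton unfolding V by blast
  qed
qed

end
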